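(* Let $\mathbf{k}$ be a commutative unitary ring, $\lambda\in\mathbf{k}$, and let $A$ be a nonunitary Rota--Baxter algebra of weight $\lambda$. Let $X$ be a generating set of $A$ as a nonunitary Rota--Baxter algebra, with inclusion map $g:X\hookrightarrow A$. Let $(\mathrm{Sh}^{NC,0}(X),j_X)$ and $(\mathrm{Sh}^{NC}(X),\tilde j_X)$ be the free nonunitary and the free unitary Rota--Baxter algebras of weight $\lambda$ on $X$, let $u_X:\mathrm{Sh}^{NC,0}(X)\to\mathrm{Sh}^{NC}(X)$ be the unique nonunitary Rota--Baxter algebra homomorphism with $u_X\circ j_X=\tilde j_X$, and let $\bar g:\mathrm{Sh}^{NC,0}(X)\to A$ be the unique (surjective) nonunitary Rota--Baxter algebra homomorphism with $g=\bar g\circ j_X$. Let $J=\ker\bar g$, let $\tilde J$ be the Rota--Baxter ideal of $\mathrm{Sh}^{NC}(X)$ generated by $u_X(J)$, put $\tilde A=\mathrm{Sh}^{NC}(X)/\tilde J$, and let $q:\mathrm{Sh}^{NC}(X)\to\tilde A$ be the quotient homomorphism. Let $u_A:A\cong\mathrm{Sh}^{NC,0}(X)/J\to\tilde A$ be the unique homomorphism of nonunitary Rota--Baxter algebras such that $u_A\circ\bar g=q\circ u_X$. Then the nonunitary Rota--Baxter algebra homomorphism $u_A:A\to\tilde A$ gives the unitarization of $A$.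
   Context: Rota--Baxter algebra of weight $\lambda$: an associative $\mathbf{k}$-algebra $R$ with a $\mathbf{k}$-linear map $P:R\to R$ such that $P(x)P(y)=P\big(P(x)y+xP(y)+\lambda xy\big)$ for all $x,y\in R$. It is unitary if $R$ has an identity; nonunitary means no identity is required. Homomorphisms of nonunitary Rota--Baxter algebras are $\mathbf{k}$-linear multiplicative maps commuting with the operators; homomorphisms of unitary Rota--Baxter algebras moreover preserve the identity. A Rota--Baxter ideal is a two-sided ideal (and $\mathbf{k}$-submodule) stable under the operator; the quotient by it is again a Rota--Baxter algebra. All Rota--Baxter algebras below have weight $\lambda$. Unitarization: for a nonunitary Rota--Baxter algebra $(A,P)$, a unitarization of $A$ is a unitary Rota--Baxter algebra $(\tilde A,\tilde P)$ with a nonunitary Rota--Baxter algebra homomorphism $u_A:A\to\tilde A$ such that for any unitary Rota--Baxter algebra $B$ and any homomorphism $f:A\to B$ of nonunitary Rota--Baxter algebras, there is a unique homomorphism $\tilde f:\tilde A\to B$ of unitary Rota--Baxter algebras with $f=\tilde f\circ u_A$. Free objects: $(\mathrm{Sh}^{NC}(X),\tilde j_X)$ has the universal property that every map from $X$ to a unitary Rota--Baxter algebra factors uniquely as $\bar f\circ\tilde j_X$ with $\bar f$ a homomorphism of unitary Rota--Baxter algebras; $(\mathrm{Sh}^{NC,0}(X),j_X)$ has the analogous property for nonunitary Rota--Baxter algebras. Realization of the free objects used in the paper. $\mathcal{T}$ is the set of planar rooted trees, $\bullet$ the one-vertex tree, $\mathcal{F}$ the free semigroup on $\mathcal{T}$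 with product $\sqcup$ (elements are planar rooted forests), $\lfloor T_1\sqcup\cdots\sqcup T_b\rfloor$ is the tree obtained by joining a new root to the roots of $T_1,\dots,T_b$; every tree is $\bullet$ or $\lfloor\overline F\rfloor$ for a unique forest $\overline F$. $\ell(F)$ is the number of leaves ($\ell(\bullet)=1$). On $\mathbf{k}\,\mathcal{F}$ the bilinear product $\diamond$ is defined recursively (on the sum of the depths) by: for trees, $F\diamond\bullet=F$, $\bullet\diamond F'=F'$, $\lfloor\overline F\rfloor\diamond\lfloor\overline F'\rfloor=\lfloor\lfloor\overline F\rfloor\diamond\overline F'\rfloor+\lfloor\overline F\diamond\lfloor\overline F'\rfloor\rfloor+\lambda\lfloor\overline F\diamond\overline F'\rfloor$; for forests, $(T_1\sqcup\cdots\sqcup T_b)\diamond(T'_1\sqcup\cdots\sqcup T'_{b'})=T_1\sqcup\cdots\sqcup T_{b-1}\sqcup(T_b\diamond T'_1)\sqcup T'_2\sqcup\cdots\sqcup T'_{b'}$ (with $\sqcup$, $\lfloor\ \rfloor$ extended (bi)linearly). $\mathrm{Sh}^{NC}(X)$ is the free $\mathbf{k}$-module on the pairs $(F;\vec x)$ with $F\in\mathcal{F}$, $\vec x\in X^{\ell(F)-1}$ ($X^0$ consisting of the empty tuple), with bilinear product $(F;\vec x)\,\overline\diamond\,(F';\vec x')=(F\diamond F';(\vec x,\vec x'))$ (linear in the first entry; tuples concatenated), operator $(F;\vec x)\mapsto(\lfloor F\rfloor;\vec x)$, and $\tilde j_X(x)=(\bullet\sqcup\bullet;(x))$. $\mathrm{Sh}^{NC,0}(X)$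 is the submodule spanned by the $(F;\vec x)$ with $F\in\mathcal{F}^0$, with the restricted product and operator and $j_X(x)=(\bullet\sqcup\bullet;(x))$; here $\mathcal{F}^0$ is the set of forests $F\neq\bullet$ in which no bracket $\lfloor B\rfloor$ occurring in $F$ equals $\lfloor\bullet\rfloor$ (no vertex has exactly one child with that child a leaf). *)

theory Defs
  imports "HOL-Algebra.Module" "HOL-Algebra.QuotRing" "HOL-Library.FuncSet"
begin

section \<open>Rota--Baxter algebras\<close>

record ('k, 'a) rb_alg = "('k, 'a) module" +
  rb_op :: "'a \<Rightarrow> 'a"

text \<open>
  In a nonunitary algebra the field \<open>one\<close> of the record is unconstrained, and no definition
  concerning nonunitary algebras mentions it.
\<close>

locale nonunitary_rb_algebra = module K A
  for K :: "('k, 'm) ring_scheme" (structure) and A :: "('k, 'a, 'n) rb_alg_scheme" (structure) +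
  fixes lam :: 'k
  assumes weight_closed: "lam \<in> carrier K"
    and mult_closed: "\<lbrakk>x \<in> carrier A; y \<in> carrier A\<rbrakk> \<Longrightarrow> x \<otimes>\<^bsub>A\<^esub> y \<in> carrier A"
    and mult_assoc: "\<lbrakk>x \<in> carrier A; y \<in> carrier A; z \<in> carrier A\<rbrakk> \<Longrightarrow>
      (x \<otimes>\<^bsub>A\<^esub> y) \<otimes>\<^bsub>A\<^esub> z = x \<otimes>\<^bsub>A\<^esub> (y \<otimes>\<^bsub>A\<^esub> z)"
    and mult_l_distr: "\<lbrakk>x \<in> carrier A; y \<in> carrier A; z \<in> carrier A\<rbrakk> \<Longrightarrow>
      (x \<oplus>\<^bsub>A\<^esub> y) \<otimes>\<^bsub>A\<^esub> z = x \<otimes>\<^bsub>A\<^esub> z \<oplus>\<^bsub>A\<^esub> y \<otimes>\<^bsub>A\<^esub> z"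
    and mult_r_distr: "\<lbrakk>x \<in> carrier A; y \<in> carrier A; z \<in> carrier A\<rbrakk> \<Longrightarrow>
      z \<otimes>\<^bsub>A\<^esub> (x \<oplus>\<^bsub>A\<^esub> y) = z \<otimes>\<^bsub>A\<^esub> x \<oplus>\<^bsub>A\<^esub> z \<otimes>\<^bsub>A\<^esub> y"
    and mult_smult_l: "\<lbrakk>r \<in> carrier K; x \<in> carrier A; y \<in> carrier A\<rbrakk> \<Longrightarrow>
      (r \<odot>\<^bsub>A\<^esub> x) \<otimes>\<^bsub>A\<^esub> y = r \<odot>\<^bsub>A\<^esub> (x \<otimes>\<^bsub>A\<^esub> y)"
    and mult_smult_r: "\<lbrakk>r \<in> carrier K; x \<in> carrier A; y \<in> carrier A\<rbrakk> \<Longrightarrow>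
      x \<otimes>\<^bsub>A\<^esub> (r \<odot>\<^bsub>A\<^esub> y) = r \<odot>\<^bsub>A\<^esub> (x \<otimes>\<^bsub>A\<^esub> y)"
    and op_closed: "x \<in> carrier A \<Longrightarrow> rb_op A x \<in> carrier A"
    and op_add: "\<lbrakk>x \<in> carrier A; y \<in> carrier A\<rbrakk> \<Longrightarrow>
      rb_op A (x \<oplus>\<^bsub>A\<^esub> y) = rb_op A x \<oplus>\<^bsub>A\<^esub> rb_op A y"
    and op_smult: "\<lbrakk>r \<in> carrier K; x \<in> carrier A\<rbrakk> \<Longrightarrow>
      rb_op A (r \<odot>\<^bsub>A\<^esub> x) = r \<odot>\<^bsub>A\<^esub> rb_op A x"
    and rota_baxter: "\<lbrakk>x \<in> carrier A; y \<in> carrier A\<rbrakk> \<Longrightarrow>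
      rb_op A x \<otimes>\<^bsub>A\<^esub> rb_op A y =
        rb_op A (rb_op A x \<otimes>\<^bsub>A\<^esub> y \<oplus>\<^bsub>A\<^esub> x \<otimes>\<^bsub>A\<^esub> rb_op A y \<oplus>\<^bsub>A\<^esub> lam \<odot>\<^bsub>A\<^esub> (x \<otimes>\<^bsub>A\<^esub> y))"

locale unitary_rb_algebra = nonunitary_rb_algebra K A lam + ring A
  for K :: "('k, 'm) ring_scheme" (structure) and A :: "('k, 'a, 'n) rb_alg_scheme" (structure)
    and lam :: 'k

text \<open>
  Homomorphisms are taken to be extensional (\<open>undefined\<close> outside the carrier), so that
  uniqueness of a homomorphism can be expressed by \<open>\<exists>!\<close>.
\<close>

definition rb_hom ::
  "('k, 'm) ring_scheme \<Rightarrow> ('k, 'a) rb_alg \<Rightarrow> ('k, 'b) rb_alg \<Rightarrow> ('a \<Rightarrow> 'b) set" where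
  "rb_hom K A B = {h \<in> carrier A \<rightarrow>\<^sub>E carrier B.
     (\<forall>x\<in>carrier A. \<forall>y\<in>carrier A. h (x \<oplus>\<^bsub>A\<^esub> y) = h x \<oplus>\<^bsub>B\<^esub> h y) \<and>
     (\<forall>r\<in>carrier K. \<forall>x\<in>carrier A. h (r \<odot>\<^bsub>A\<^esub> x) = r \<odot>\<^bsub>B\<^esub> h x) \<and>
     (\<forall>x\<in>carrier A. \<forall>y\<in>carrier A. h (x \<otimes>\<^bsub>A\<^esub> y) = h x \<otimes>\<^bsub>B\<^esub> h y) \<and>
     (\<forall>x\<in>carrier A. h (rb_op A x) = rb_op B (h x))}"

definition unitary_rb_hom ::
  "('k, 'm) ring_scheme \<Rightarrow> ('k, 'a) rb_alg \<Rightarrow> ('k, 'b) rb_alg \<Rightarrow> ('a \<Rightarrow> 'b) set" where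
  "unitary_rb_hom K A B = {h \<in> rb_hom K A B. h \<one>\<^bsub>A\<^esub> = \<one>\<^bsub>B\<^esub>}"

definition rb_subalgebra :: "('k, 'm) ring_scheme \<Rightarrow> ('k, 'a) rb_alg \<Rightarrow> 'a set \<Rightarrow> bool" where
  "rb_subalgebra K A S \<longleftrightarrow> submodule S K A \<and>
     (\<forall>x\<in>S. \<forall>y\<in>S. x \<otimes>\<^bsub>A\<^esub> y \<in> S) \<and> (\<forall>x\<in>S. rb_op A x \<in> S)"

definition rb_generated :: "('k, 'm) ring_scheme \<Rightarrow> ('k, 'a) rb_alg \<Rightarrow> 'a set \<Rightarrow> 'a set" where
  "rb_generated K A X = \<Inter>{S. rb_subalgebra K A S \<and> X \<subseteq> S}"

definition rb_ideal :: "('k, 'm) ring_scheme \<Rightarrow> ('k, 'a) rb_alg \<Rightarrow> 'a set \<Rightarrow> bool" where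
  "rb_ideal K A I \<longleftrightarrow> submodule I K A \<and>
     (\<forall>x\<in>carrier A. \<forall>y\<in>I. x \<otimes>\<^bsub>A\<^esub> y \<in> I \<and> y \<otimes>\<^bsub>A\<^esub> x \<in> I) \<and> (\<forall>y\<in>I. rb_op A y \<in> I)"

definition rb_ideal_generated :: "('k, 'm) ring_scheme \<Rightarrow> ('k, 'a) rb_alg \<Rightarrow> 'a set \<Rightarrow> 'a set" where
  "rb_ideal_generated K A S = \<Inter>{I. rb_ideal K A I \<and> S \<subseteq> I}"

text \<open>The ring part is that of \<^const>\<open>FactRing\<close>; the other operations are extended in the same way.\<close>

definition rb_quot :: "('k, 'a) rb_alg \<Rightarrow> 'a set \<Rightarrow> ('k, 'a set) rb_alg" where
  "rb_quot A I =
     \<lparr>carrier = a_rcosets\<^bsub>A\<^esub> I, mult = rcoset_mult A I, one = I +>\<^bsub>A\<^esub> \<one>\<^bsub>A\<^esub>,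
      zero = I, add = set_add A,
      smult = (\<lambda>r C. \<Union>x\<in>C. I +>\<^bsub>A\<^esub> (r \<odot>\<^bsub>A\<^esub> x)),
      rb_op = (\<lambda>C. \<Union>x\<in>C. I +>\<^bsub>A\<^esub> rb_op A x)\<rparr>"

definition rb_proj :: "('k, 'a) rb_alg \<Rightarrow> 'a set \<Rightarrow> 'a \<Rightarrow> 'a set" where
  "rb_proj A I = (\<lambda>x\<in>carrier A. I +>\<^bsub>A\<^esub> x)"

text \<open>
  The target algebras range over all types: since HOL cannot quantify over types inside a
  formula, the type \<open>'b\<close> of elements of the target is a parameter, to be left arbitrary
  in theorems.
\<close>

definition unitarization ::
  "'b itself \<Rightarrow> ('k, 'm) ring_scheme \<Rightarrow> 'k \<Rightarrow> ('k, 'a) rb_alg \<Rightarrow>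
    ('k, 'c) rb_alg \<Rightarrow> ('a \<Rightarrow> 'c) \<Rightarrow> bool" where
  "unitarization TYPE('b) K lam A A' u \<longleftrightarrow>
     unitary_rb_algebra K A' lam \<and> u \<in> rb_hom K A A' \<and>
     (\<forall>B :: ('k, 'b) rb_alg. unitary_rb_algebra K B lam \<longrightarrow>
       (\<forall>f \<in> rb_hom K A B.
         \<exists>!h. h \<in> unitary_rb_hom K A' B \<and> (\<forall>a\<in>carrier A. f a = h (u a))))"


section \<open>Planar rooted trees and forests\<close>

text \<open>
  A tree is the list of the subtrees at its root: \<open>\<bullet>\<close> is \<open>Node []\<close>, and \<open>\<lfloor>F\<rfloor>\<close> is
  \<open>Node F\<close> for a forest \<open>F\<close>.  Forests are the nonempty lists of trees, with \<open>\<squnion>\<close> being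
  \<open>@\<close>; the empty list is not a forest.
\<close>

datatype ptree = Node "ptree list"

abbreviation bullet :: ptree where
  "bullet \<equiv> Node []"

fun leaves :: "ptree \<Rightarrow> nat" where
  "leaves (Node F) = (if F = [] then 1 else sum_list (map leaves F))"

definition forest_leaves :: "ptree list \<Rightarrow> nat" where
  "forest_leaves F = sum_list (map leaves F)"

text \<open>No vertex of the tree has a leaf as its only child.\<close>

fun ladder_free :: "ptree \<Rightarrow> bool" where
  "ladder_free (Node F) \<longleftrightarrow> F \<noteq> [bullet] \<and> (\<forall>T\<in>set F. ladder_free T)"

definition forests0 :: "ptree list set" where
  "forests0 = {F. F \<noteq> [] \<and> F \<noteq> [bullet] \<and> (\<forall>T\<in>set F. ladder_free T)}"


section \<open>Formal linear combinations\<close>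

text \<open>
  A formal linear combination of elements of \<open>'b\<close> is its coefficient function, with
  finite support and values in the carrier of the ring.
\<close>

definition supp :: "('k, 'm) ring_scheme \<Rightarrow> ('b \<Rightarrow> 'k) \<Rightarrow> 'b set" where
  "supp K c = {b. c b \<noteq> \<zero>\<^bsub>K\<^esub>}"

definition free_carrier :: "('k, 'm) ring_scheme \<Rightarrow> 'b set \<Rightarrow> ('b \<Rightarrow> 'k) set" where
  "free_carrier K S = {c. (\<forall>b. c b \<in> carrier K) \<and> finite (supp K c) \<and> supp K c \<subseteq> S}"

definition basis_elt :: "('k, 'm) ring_scheme \<Rightarrow> 'b \<Rightarrow> ('b \<Rightarrow> 'k)" where
  "basis_elt K b = (\<lambda>d. if d = b then \<one>\<^bsub>K\<^esub> else \<zero>\<^bsub>K\<^esub>)"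

definition lin_ext ::
  "('k, 'm) ring_scheme \<Rightarrow> ('b \<Rightarrow> 'd \<Rightarrow> 'k) \<Rightarrow> ('b \<Rightarrow> 'k) \<Rightarrow> ('d \<Rightarrow> 'k)" where
  "lin_ext K f c = (\<lambda>d. \<Oplus>\<^bsub>K\<^esub>b\<in>supp K c. c b \<otimes>\<^bsub>K\<^esub> f b d)"

definition bilin_ext ::
  "('k, 'm) ring_scheme \<Rightarrow> ('b \<Rightarrow> 'e \<Rightarrow> 'd \<Rightarrow> 'k) \<Rightarrow>
    ('b \<Rightarrow> 'k) \<Rightarrow> ('e \<Rightarrow> 'k) \<Rightarrow> ('d \<Rightarrow> 'k)" where
  "bilin_ext K f c c' = lin_ext K (\<lambda>b. lin_ext K (f b) c') c"


section \<open>The product of forests\<close>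

definition brackets :: "('k, 'm) ring_scheme \<Rightarrow> (ptree list \<Rightarrow> 'k) \<Rightarrow> (ptree \<Rightarrow> 'k)" where
  "brackets K = lin_ext K (\<lambda>F. basis_elt K (Node F))"

text \<open>
  The product of two trees is a linear combination of trees, that of two forests a linear
  combination of forests.  The value on the empty list is irrelevant.
\<close>

function tree_prod ::
    "('k, 'm) ring_scheme \<Rightarrow> 'k \<Rightarrow> ptree \<Rightarrow> ptree \<Rightarrow> (ptree \<Rightarrow> 'k)"
  and forest_prod ::
    "('k, 'm) ring_scheme \<Rightarrow> 'k \<Rightarrow> ptree list \<Rightarrow> ptree list \<Rightarrow> (ptree list \<Rightarrow> 'k)" where
  "tree_prod K lam (Node F) (Node F') =
     (if F' = [] then basis_elt K (Node F)
      else if F = [] then basis_elt K (Node F')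
      else (\<lambda>T. brackets K (forest_prod K lam [Node F] F') T
               \<oplus>\<^bsub>K\<^esub> brackets K (forest_prod K lam F [Node F']) T
               \<oplus>\<^bsub>K\<^esub> lam \<otimes>\<^bsub>K\<^esub> brackets K (forest_prod K lam F F') T))"
| "forest_prod K lam F F' =
     (if F = [] \<or> F' = [] then (\<lambda>_. \<zero>\<^bsub>K\<^esub>)
      else lin_ext K (\<lambda>T. basis_elt K (butlast F @ [T] @ tl F'))
             (tree_prod K lam (last F) (hd F')))"
  by pat_completeness auto
termination
proof (relation "measure (\<lambda>s. case s of
    Inl (K, lam, T, T') \<Rightarrow> 2 * (size T + size T')
  | Inr (K, lam, F, F') \<Rightarrow> 2 * (sum_list (map size F) + sum_list (map size F')) + 1)", goal_cases)
  have list: "sum_list (map size F) + length F = size_list size F" for F :: "ptree list"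
    by (induction F) auto
  have lt: "F \<noteq> [] \<Longrightarrow> sum_list (map size F) + 1 < size (Node F)" for F
    by (cases F) (auto simp flip: list)
  {
    case 2 then show ?case using lt by fastforce
  next
    case 3 then show ?case using lt by fastforce
  next
    case (4 K lam F F') then show ?case using lt[of F] lt[of F'] by simp
  next
    case (5 K lam F F')
    have "size (last F) \<le> sum_list (map size F)" "size (hd F') \<le> sum_list (map size F')"
      using 5 by (auto intro!: member_le_sum_list)
    then show ?case by simp
  }
qed simp


section \<open>The free Rota--Baxter algebras\<close>

type_synonym 'x decorated = "ptree list \<times> 'x list"

definition decorated_forests :: "'x set \<Rightarrow> 'x decorated set" where
  "decorated_forests X =
     {(F, xs). F \<noteq> [] \<and> set xs \<subseteq> X \<and> length xs = forest_leaves F - 1}"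

definition sh_nc ::
  "('k, 'm) ring_scheme \<Rightarrow> 'k \<Rightarrow> 'x set \<Rightarrow> ('k, 'x decorated \<Rightarrow> 'k) rb_alg" where
  "sh_nc K lam X =
     \<lparr>carrier = free_carrier K (decorated_forests X),
      mult = bilin_ext K (\<lambda>(F, xs) (F', xs').
        lin_ext K (\<lambda>G. basis_elt K (G, xs @ xs')) (forest_prod K lam F F')),
      one = basis_elt K ([bullet], []),
      zero = (\<lambda>_. \<zero>\<^bsub>K\<^esub>),
      add = (\<lambda>c c' b. c b \<oplus>\<^bsub>K\<^esub> c' b),
      smult = (\<lambda>r c b. r \<otimes>\<^bsub>K\<^esub> c b),
      rb_op = lin_ext K (\<lambda>(F, xs). basis_elt K ([Node F], xs))\<rparr>"

definition sh_nc0 ::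
  "('k, 'm) ring_scheme \<Rightarrow> 'k \<Rightarrow> 'x set \<Rightarrow> ('k, 'x decorated \<Rightarrow> 'k) rb_alg" where
  "sh_nc0 K lam X =
     (sh_nc K lam X)\<lparr>carrier := free_carrier K {(F, xs) \<in> decorated_forests X. F \<in> forests0}\<rparr>"

text \<open>The maps \<open>j\<close> from \<open>X\<close> to both free algebras are given by the same formula.\<close>

definition sh_gen :: "('k, 'm) ring_scheme \<Rightarrow> 'x \<Rightarrow> ('x decorated \<Rightarrow> 'k)" where
  "sh_gen K x = basis_elt K ([bullet, bullet], [x])"

end

theory Submission
  imports Defs
begin

text \<open>
  Once the two algebras of decorated forests are known to be free on \<open>X\<close>, the theorem is a formal
  consequence.  A homomorphism \<open>f\<close> from \<open>A\<close> to a unitary Rota--Baxter algebra \<open>B\<close> is determined by its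
  values on \<open>X\<close>; these values extend to a unitary homomorphism \<open>fbar\<close> on the free unitary algebra.  On
  the free nonunitary algebra \<open>fbar\<close> agrees with \<open>f \<circ> gbar\<close>, so it kills the relations \<open>J\<close> of \<open>A\<close> and the
  Rota--Baxter ideal generated by them, and descends to the quotient.  It is the only possible
  factorization, since the quotient is generated by the image of \<open>X\<close> and the unit (lemma
  \<open>unitarization\<close>).

  Most of the work goes into freeness.  It has three parts.

  The algebras of decorated forests are Rota--Baxter algebras.  The Rota--Baxter identity is
  built into the recursion for the product.  Associativity (lemma \<open>forest_assoc_basis\<close>) holds because
  two forests interact only through the two trees that meet, and because for three brackets both
  ways of multiplying expand, by the Rota--Baxter identity, into the same products of smaller
  forests.

  They are generated by \<open>X\<close> (lemma \<open>basis_in_generated\<close>), so homomorphisms out of them are determined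
  by their values on \<open>X\<close>.

  Every map from \<open>X\<close> to a Rota--Baxter algebra extends, by evaluating a decorated forest: the
  decorations go to their images, brackets to the operator, juxtaposition to the product and \<open>\<bullet>\<close> to
  the unit (lemma \<open>ev_prod\<close>).  If the target \<open>B\<close> has no unit, the evaluation takes place in its Dorroh
  extension, where the operator satisfies the Rota--Baxter identity only on the ideal \<open>B\<close>.  This
  is enough: the identity is needed only for the values of the contents of brackets, and in a
  ladder-free forest these contents differ from \<open>\<bullet>\<close>, so their values lie in \<open>B\<close>.
\<close>

section \<open>Linear maps out of free modules\<close>

definition linear_maps ::
  "('k, 'm) ring_scheme \<Rightarrow> ('k, 'a, 'p) module_scheme \<Rightarrow> ('k, 'b, 'q) module_scheme \<Rightarrow> ('a \<Rightarrow> 'b) set" where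
  "linear_maps K M N = {h \<in> carrier M \<rightarrow> carrier N.
     (\<forall>x\<in>carrier M. \<forall>y\<in>carrier M. h (x \<oplus>\<^bsub>M\<^esub> y) = h x \<oplus>\<^bsub>N\<^esub> h y) \<and>
     (\<forall>r\<in>carrier K. \<forall>x\<in>carrier M. h (r \<odot>\<^bsub>M\<^esub> x) = r \<odot>\<^bsub>N\<^esub> h x)}"

definition free_module :: "('k, 'm) ring_scheme \<Rightarrow> 'b set \<Rightarrow> ('k, 'b \<Rightarrow> 'k) module" where
  "free_module K S =
     \<lparr>carrier = free_carrier K S, mult = (\<lambda>_ _ _. \<zero>\<^bsub>K\<^esub>), one = (\<lambda>_. \<zero>\<^bsub>K\<^esub>),
      zero = (\<lambda>_. \<zero>\<^bsub>K\<^esub>), add = (\<lambda>c c' b. c b \<oplus>\<^bsub>K\<^esub> c' b), smult = (\<lambda>r c b. r \<otimes>\<^bsub>K\<^esub> c b)\<rparr>"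

text \<open>
  The linear extension of \<open>f\<close> with values in an arbitrary module.  The extensions \<open>lin_ext\<close> into a
  free module are a special case; values in the target of a homomorphism need the general one.
\<close>

definition lin_comb ::
  "('k, 'm) ring_scheme \<Rightarrow> ('k, 'a, 'p) module_scheme \<Rightarrow> ('b \<Rightarrow> 'a) \<Rightarrow> ('b \<Rightarrow> 'k) \<Rightarrow> 'a" where
  "lin_comb K M f c = (\<Oplus>\<^bsub>M\<^esub>b\<in>supp K c. c b \<odot>\<^bsub>M\<^esub> f b)"

lemma free_module_simps [simp]:
  "carrier (free_module K S) = free_carrier K S"
  "zero (free_module K S) = (\<lambda>_. \<zero>\<^bsub>K\<^esub>)"
  "add (free_module K S) = (\<lambda>c c' b. c b \<oplus>\<^bsub>K\<^esub> c' b)"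
  "smult (free_module K S) = (\<lambda>r c b. r \<otimes>\<^bsub>K\<^esub> c b)"
  by (simp_all add: free_module_def)

lemma linear_mapsD:
  assumes "h \<in> linear_maps K M N"
  shows "x \<in> carrier M \<Longrightarrow> h x \<in> carrier N"
    and "x \<in> carrier M \<Longrightarrow> y \<in> carrier M \<Longrightarrow> h (x \<oplus>\<^bsub>M\<^esub> y) = h x \<oplus>\<^bsub>N\<^esub> h y"
    and "r \<in> carrier K \<Longrightarrow> x \<in> carrier M \<Longrightarrow> h (r \<odot>\<^bsub>M\<^esub> x) = r \<odot>\<^bsub>N\<^esub> h x"
  using assms by (auto simp: linear_maps_def)

context cring
begin

lemma free_carrierI:
  "(\<And>b. c b \<in> carrier R) \<Longrightarrow> finite (supp R c) \<Longrightarrow> supp R c \<subseteq> S \<Longrightarrow> c \<in> free_carrier R S"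
  by (simp add: free_carrier_def)

lemma free_carrierD:
  assumes "c \<in> free_carrier R S"
  shows "finite (supp R c)" "supp R c \<subseteq> S"
  using assms by (simp_all add: free_carrier_def)

lemma free_carrier_closed [simp]: "c \<in> free_carrier R S \<Longrightarrow> c b \<in> carrier R"
  by (simp add: free_carrier_def)

lemma free_carrier_mono: "c \<in> free_carrier R S \<Longrightarrow> S \<subseteq> T \<Longrightarrow> c \<in> free_carrier R T"
  by (meson free_carrierD free_carrierI free_carrier_closed subset_trans)

lemma free_carrier_zero [simp]: "(\<lambda>_. \<zero>) \<in> free_carrier R S"
  by (intro free_carrierI) (auto simp: supp_def)

lemma free_carrier_basis [simp]: "b \<in> S \<Longrightarrow> basis_elt R b \<in> free_carrier R S"
  by (intro free_carrierI) (auto simp: basis_elt_def supp_def)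

lemma free_carrier_add [simp]:
  assumes "c \<in> free_carrier R S" "d \<in> free_carrier R S"
  shows "(\<lambda>b. c b \<oplus> d b) \<in> free_carrier R S"
proof -
  have "supp R (\<lambda>b. c b \<oplus> d b) \<subseteq> supp R c \<union> supp R d"
    using assms by (auto simp: supp_def)
  then show ?thesis
    using assms free_carrierD[OF assms(1)] free_carrierD[OF assms(2)]
      finite_subset[of "supp R (\<lambda>b. c b \<oplus> d b)" "supp R c \<union> supp R d"]
    by (intro free_carrierI) auto
qed

lemma free_carrier_smult [simp]:
  assumes "r \<in> carrier R" "c \<in> free_carrier R S"
  shows "(\<lambda>b. r \<otimes> c b) \<in> free_carrier R S"
proof -
  have "supp R (\<lambda>b. r \<otimes> c b) \<subseteq> supp R c"
    using assms by (auto simp: supp_def)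
  then show ?thesis
    using assms free_carrierD[OF assms(2)] finite_subset[of "supp R (\<lambda>b. r \<otimes> c b)" "supp R c"]
    by (intro free_carrierI) auto
qed

lemma free_module_carrier:
  assumes "carrier M = free_carrier R S" and "zero M = (\<lambda>_. \<zero>)"
    and "add M = (\<lambda>c c' b. c b \<oplus> c' b)" and "smult M = (\<lambda>r c b. r \<otimes> c b)"
  shows "module R M"
proof (intro moduleI abelian_groupI is_cring)
  fix c assume c: "c \<in> carrier M"
  have "(\<lambda>b. \<ominus> \<one> \<otimes> c b) \<in> carrier M"
    using c assms by simp
  moreover have "(\<lambda>b. \<ominus> \<one> \<otimes> c b) \<oplus>\<^bsub>M\<^esub> c = \<zero>\<^bsub>M\<^esub>"
    using c assms by (auto simp: fun_eq_iff l_minus l_neg)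
  ultimately show "\<exists>y\<in>carrier M. y \<oplus>\<^bsub>M\<^esub> c = \<zero>\<^bsub>M\<^esub>" by blast
qed (auto simp: assms fun_eq_iff a_assoc a_comm a_lcomm m_assoc l_distr r_distr)

lemma free_module: "module R (free_module R S)"
  by (rule free_module_carrier) auto

text \<open>
  The support is finite, so a vector is used up by removing one basis element at a time.  Almost
  every linear identity below is reduced to basis elements in this way.
\<close>

lemma free_induct [consumes 1, case_names zero basis add smult]:
  assumes "c \<in> free_carrier R S"
    and zero: "P (\<lambda>_. \<zero>)" and basis: "\<And>b. b \<in> S \<Longrightarrow> P (basis_elt R b)"
    and add: "\<And>c d. \<lbrakk>c \<in> free_carrier R S; d \<in> free_carrier R S; P c; P d\<rbrakk> \<Longrightarrow> P (\<lambda>b. c b \<oplus> d b)"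
    and smult: "\<And>r c. \<lbrakk>r \<in> carrier R; c \<in> free_carrier R S; P c\<rbrakk> \<Longrightarrow> P (\<lambda>b. r \<otimes> c b)"
  shows "P c"
proof -
  have "c \<in> free_carrier R S \<Longrightarrow> supp R c \<subseteq> B \<Longrightarrow> P c" if "finite B" for B
    using that
  proof (induction B arbitrary: c rule: finite_induct)
    case empty
    then have "c = (\<lambda>_. \<zero>)" by (auto simp: supp_def)
    then show ?case using zero by simp
  next
    case (insert a B)
    show ?case
    proof (cases "c a = \<zero>")
      case True
      with insert show ?thesis by (auto simp: supp_def)
    next
      case False
      then have a: "a \<in> S" using insert.prems free_carrierD(2) by (auto simp: supp_def)
      let ?d = "c(a := \<zero>)"
      have supp_d: "supp R ?d \<subseteq> supp R c - {a}" by (auto simp: supp_def)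
      have d: "?d \<in> free_carrier R S"
        using insert.prems(1) supp_d free_carrierD[OF insert.prems(1)]
        by (intro free_carrierI) (auto intro: finite_subset)
      have "P ?d" using insert d supp_d by blast
      moreover have "c = (\<lambda>b. c a \<otimes> basis_elt R a b \<oplus> ?d b)"
        using insert.prems(1) by (auto simp: basis_elt_def fun_eq_iff)
      moreover have "P (\<lambda>b. c a \<otimes> basis_elt R a b)"
        using insert.prems(1) a by (intro smult basis) auto
      ultimately show ?thesis
        using add[of "\<lambda>b. c a \<otimes> basis_elt R a b" ?d] d a insert.prems(1) by simp
    qed
  qed
  from this[of "supp R c"] assms(1) free_carrierD(1)[OF assms(1)] show ?thesis by blast
qed

end

context module
begin

text \<open>
  The sum in a linear extension runs over the support, which changes from vector to vector; a
  common finite index set makes the sums of two vectors comparable.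
\<close>

lemma lin_comb_superset:
  assumes "c \<in> free_carrier R S" "f \<in> S \<rightarrow> carrier M" "finite B" "supp R c \<subseteq> B" "B \<subseteq> S"
  shows "lin_comb R M f c = (\<Oplus>\<^bsub>M\<^esub>b\<in>B. c b \<odot>\<^bsub>M\<^esub> f b)"
  unfolding lin_comb_def
  by (rule M.add.finprod_mono_neutral_cong_left)
     (use assms in \<open>auto simp: supp_def Pi_def subset_iff\<close>)

lemma lin_comb_linear:
  assumes f: "f \<in> S \<rightarrow> carrier M"
  shows "lin_comb R M f \<in> linear_maps R (free_module R S) M"
proof -
  have closed: "lin_comb R M f c \<in> carrier M" if "c \<in> free_carrier R S" for c
    unfolding lin_comb_def using that f R.free_carrierD[OF that]
    by (intro M.finsum_closed) (auto simp: Pi_def)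
  moreover have "lin_comb R M f (\<lambda>b. c b \<oplus> d b) = lin_comb R M f c \<oplus>\<^bsub>M\<^esub> lin_comb R M f d"
    if c: "c \<in> free_carrier R S" and d: "d \<in> free_carrier R S" for c d
  proof -
    let ?B = "supp R c \<union> supp R d"
    have B: "finite ?B" "?B \<subseteq> S" using R.free_carrierD[OF c] R.free_carrierD[OF d] by auto
    have "lin_comb R M f (\<lambda>b. c b \<oplus> d b) = (\<Oplus>\<^bsub>M\<^esub>b\<in>?B. (c b \<oplus> d b) \<odot>\<^bsub>M\<^esub> f b)"
      by (rule lin_comb_superset[OF _ f B(1) _ B(2)]) (use c d in \<open>auto simp: supp_def\<close>)
    also have "\<dots> = (\<Oplus>\<^bsub>M\<^esub>b\<in>?B. c b \<odot>\<^bsub>M\<^esub> f b \<oplus>\<^bsub>M\<^esub> d b \<odot>\<^bsub>M\<^esub> f b)"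
      by (rule M.finsum_cong') (use c d f B in \<open>auto simp: smult_l_distr Pi_def subset_iff\<close>)
    also have "\<dots> = (\<Oplus>\<^bsub>M\<^esub>b\<in>?B. c b \<odot>\<^bsub>M\<^esub> f b) \<oplus>\<^bsub>M\<^esub> (\<Oplus>\<^bsub>M\<^esub>b\<in>?B. d b \<odot>\<^bsub>M\<^esub> f b)"
      by (rule M.finsum_addf) (use c d f B in \<open>auto simp: Pi_def subset_iff\<close>)
    finally show ?thesis
      using lin_comb_superset[OF c f B(1) _ B(2)] lin_comb_superset[OF d f B(1) _ B(2)] by auto
  qed
  moreover have "lin_comb R M f (\<lambda>b. r \<otimes> c b) = r \<odot>\<^bsub>M\<^esub> lin_comb R M f c"
    if c: "c \<in> free_carrier R S" and r: "r \<in> carrier R" for r c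
  proof -
    let ?B = "supp R c"
    have B: "finite ?B" "?B \<subseteq> S" using R.free_carrierD[OF c] by auto
    have "lin_comb R M f (\<lambda>b. r \<otimes> c b) = (\<Oplus>\<^bsub>M\<^esub>b\<in>?B. (r \<otimes> c b) \<odot>\<^bsub>M\<^esub> f b)"
      by (rule lin_comb_superset[OF _ f B(1) _ B(2)]) (use c r in \<open>auto simp: supp_def\<close>)
    also have "\<dots> = (\<Oplus>\<^bsub>M\<^esub>b\<in>?B. r \<odot>\<^bsub>M\<^esub> (c b \<odot>\<^bsub>M\<^esub> f b))"
      by (rule M.finsum_cong') (use c f r B in \<open>auto simp: smult_assoc1 Pi_def subset_iff\<close>)
    also have "\<dots> = r \<odot>\<^bsub>M\<^esub> (\<Oplus>\<^bsub>M\<^esub>b\<in>?B. c b \<odot>\<^bsub>M\<^esub> f b)"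
      by (rule finsum_smult_ldistr[symmetric]) (use c f r B in \<open>auto simp: Pi_def subset_iff\<close>)
    finally show ?thesis by (simp add: lin_comb_def)
  qed
  ultimately show ?thesis by (auto simp: linear_maps_def)
qed

lemma lin_comb_basis:
  assumes "f b \<in> carrier M"
  shows "lin_comb R M f (basis_elt R b) = f b"
proof -
  have "lin_comb R M f (basis_elt R b) = (\<Oplus>\<^bsub>M\<^esub>d\<in>{b}. basis_elt R b d \<odot>\<^bsub>M\<^esub> f d)"
    by (rule lin_comb_superset[of _ "{b}"]) (use assms R.free_carrier_basis[OF singletonI, of b] in \<open>auto simp: supp_def basis_elt_def\<close>)
  also have "\<dots> = f b" using assms by (simp add: basis_elt_def)
  finally show ?thesis .
qed

lemma linear_maps_zero:
  assumes "module R N" "h \<in> linear_maps R M N"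
  shows "h \<zero>\<^bsub>M\<^esub> = \<zero>\<^bsub>N\<^esub>"
proof -
  interpret N: module R N by fact
  have "h \<zero>\<^bsub>M\<^esub> = h (\<zero> \<odot>\<^bsub>M\<^esub> \<zero>\<^bsub>M\<^esub>)" by simp
  also have "\<dots> = \<zero> \<odot>\<^bsub>N\<^esub> h \<zero>\<^bsub>M\<^esub>" using linear_mapsD(3)[OF assms(2)] by blast
  also have "\<dots> = \<zero>\<^bsub>N\<^esub>" using linear_mapsD(1)[OF assms(2)] by simp
  finally show ?thesis .
qed

lemma linear_eqI:
  assumes "h \<in> linear_maps R (free_module R S) M" "h' \<in> linear_maps R (free_module R S) M"
    and "\<And>b. b \<in> S \<Longrightarrow> h (basis_elt R b) = h' (basis_elt R b)"
    and "c \<in> free_carrier R S"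
  shows "h c = h' c"
  using assms(4)
proof (induction rule: free_induct)
  case zero
  interpret F: module R "free_module R S" by (rule free_module)
  show ?case
    using F.linear_maps_zero[OF module_axioms assms(1)] F.linear_maps_zero[OF module_axioms assms(2)]
    by simp
qed (use assms(3) linear_mapsD(2,3)[OF assms(1)] linear_mapsD(2,3)[OF assms(2)] in auto)

end

context cring
begin

text \<open>
  Addition in a free module is pointwise, hence so are its finite sums.
\<close>

lemma lin_ext_eq_lin_comb:
  assumes c: "c \<in> free_carrier R S" and f: "f \<in> S \<rightarrow> free_carrier R T"
  shows "lin_ext R f c = lin_comb R (free_module R T) f c"
proof
  fix d
  interpret F: module R "free_module R T" by (rule free_module)
  have *: "(\<Oplus>\<^bsub>free_module R T\<^esub>b\<in>B. c b \<odot>\<^bsub>free_module R T\<^esub> f b) d = (\<Oplus>b\<in>B. c b \<otimes> f b d)"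
    if "finite B" "B \<subseteq> S" for B
    using that
  proof (induction B rule: finite_induct)
    case (insert b B)
    have "(\<Oplus>\<^bsub>free_module R T\<^esub>b\<in>insert b B. c b \<odot>\<^bsub>free_module R T\<^esub> f b) =
        c b \<odot>\<^bsub>free_module R T\<^esub> f b \<oplus>\<^bsub>free_module R T\<^esub> (\<Oplus>\<^bsub>free_module R T\<^esub>b\<in>B. c b \<odot>\<^bsub>free_module R T\<^esub> f b)"
      by (rule F.finsum_insert) (use insert c f in \<open>auto simp: Pi_def subset_iff\<close>)
    then show ?case
      using insert c f by (subst finsum_insert) (auto simp: Pi_def subset_iff)
  qed simp
  show "lin_ext R f c d = lin_comb R (free_module R T) f c d"
    unfolding lin_ext_def lin_comb_def
    by (rule *[symmetric]) (use free_carrierD[OF c] in auto)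
qed

lemma lin_ext_linear:
  assumes f: "f \<in> S \<rightarrow> free_carrier R T"
  shows "lin_ext R f \<in> linear_maps R (free_module R S) (free_module R T)"
proof -
  interpret F: module R "free_module R T" by (rule free_module)
  have "lin_comb R (free_module R T) f \<in> linear_maps R (free_module R S) (free_module R T)"
    using F.lin_comb_linear[of f S] f by simp
  then show ?thesis
    using lin_ext_eq_lin_comb[OF _ f] by (auto simp: linear_maps_def)
qed

lemma lin_ext_basis:
  assumes "f b \<in> free_carrier R T"
  shows "lin_ext R f (basis_elt R b) = f b"
proof -
  interpret F: module R "free_module R T" by (rule free_module)
  show ?thesis
    using lin_ext_eq_lin_comb[of "basis_elt R b" "{b}" f T] F.lin_comb_basis[of f b] assms by simp
qed

end

context cring
begin

lemma lin_ext_cong: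
  assumes "c \<in> free_carrier R S" "\<And>b. b \<in> S \<Longrightarrow> f b = g b" "\<And>b. b \<in> S \<Longrightarrow> g b \<in> free_carrier R UNIV"
  shows "lin_ext R f c = lin_ext R g c"
  unfolding lin_ext_def
  by (intro ext finsum_cong')
     (use assms(2) free_carrierD[OF assms(1)] assms(1) in \<open>auto simp: subset_iff intro!: m_closed free_carrier_closed[OF assms(3)]\<close>)

lemma lin_ext_closed:
  assumes "c \<in> free_carrier R S" "\<And>b. b \<in> S \<Longrightarrow> f b \<in> free_carrier R T"
  shows "lin_ext R f c \<in> free_carrier R T"
  using linear_mapsD(1)[OF lin_ext_linear[of f S T]] assms by auto

lemma lin_ext_add:
  assumes "\<And>b. b \<in> S \<Longrightarrow> f b \<in> free_carrier R T" "c \<in> free_carrier R S" "d \<in> free_carrier R S"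
  shows "lin_ext R f (\<lambda>b. c b \<oplus> d b) = (\<lambda>b. lin_ext R f c b \<oplus> lin_ext R f d b)"
  using linear_mapsD(2)[OF lin_ext_linear[of f S T]] assms by auto

lemma lin_ext_smult:
  assumes "\<And>b. b \<in> S \<Longrightarrow> f b \<in> free_carrier R T" "c \<in> free_carrier R S" "r \<in> carrier R"
  shows "lin_ext R f (\<lambda>b. r \<otimes> c b) = (\<lambda>b. r \<otimes> lin_ext R f c b)"
  using linear_mapsD(3)[OF lin_ext_linear[of f S T]] assms by auto

lemma lin_ext_zero: "lin_ext R f (\<lambda>_. \<zero>) = (\<lambda>_. \<zero>)"
  by (simp add: lin_ext_def supp_def)

lemma lin_ext_lin_ext:
  assumes c: "c \<in> free_carrier R S" and f: "\<And>b. b \<in> S \<Longrightarrow> f b \<in> free_carrier R T"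
    and g: "\<And>b. b \<in> T \<Longrightarrow> g b \<in> free_carrier R U"
  shows "lin_ext R g (lin_ext R f c) = lin_ext R (\<lambda>b. lin_ext R g (f b)) c"
  using c
proof (induction rule: free_induct)
  case zero
  show ?case by (simp add: lin_ext_zero)
next
  case (basis b)
  then show ?case
    using lin_ext_closed[OF f g, of b]
    by (simp add: lin_ext_basis[OF f] lin_ext_basis[of "\<lambda>b. lin_ext R g (f b)" b U])
next
  case (add c d)
  have gf: "lin_ext R g (f b) \<in> free_carrier R U" if "b \<in> S" for b
    using lin_ext_closed[OF f g] that .
  show ?case
    using add lin_ext_closed[OF add(1) f] lin_ext_closed[OF add(2) f]
    by (simp add: lin_ext_add[OF f] lin_ext_add[OF g] lin_ext_add[OF gf])
next
  case (smult r c)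
  have gf: "lin_ext R g (f b) \<in> free_carrier R U" if "b \<in> S" for b
    using lin_ext_closed[OF f g] that .
  show ?case
    using smult lin_ext_closed[OF smult(2) f]
    by (simp add: lin_ext_smult[OF f] lin_ext_smult[OF g] lin_ext_smult[OF gf])
qed

lemma lin_ext_basis_elt: "lin_ext R f (basis_elt R b) = f b" if "f b \<in> free_carrier R UNIV"
  using lin_ext_basis that .

end

lemma linear_maps_comp:
  assumes "h \<in> linear_maps K M N" "g \<in> linear_maps K N L"
  shows "(\<lambda>x. g (h x)) \<in> linear_maps K M L"
proof -
  have "\<forall>x\<in>carrier M. h x \<in> carrier N" "\<forall>x\<in>carrier N. g x \<in> carrier L"
    using assms by (simp_all add: linear_maps_def Pi_iff)
  then show ?thesis
    using assms by (simp add: linear_maps_def)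
qed

context module
begin

lemma lin_comb_cong:
  assumes "c \<in> free_carrier R S" "\<And>b. b \<in> S \<Longrightarrow> f b = g b" "\<And>b. b \<in> S \<Longrightarrow> g b \<in> carrier M"
  shows "lin_comb R M f c = lin_comb R M g c"
  unfolding lin_comb_def using R.free_carrierD[OF assms(1)] assms
  by (intro M.finsum_cong') (auto simp: subset_iff)

lemma lin_comb_lin_ext:
  assumes c: "c \<in> free_carrier R S" and g: "\<And>b. b \<in> S \<Longrightarrow> g (\<phi> b) \<in> carrier M"
  shows "lin_comb R M g (lin_ext R (\<lambda>b. basis_elt R (\<phi> b)) c) = lin_comb R M (\<lambda>b. g (\<phi> b)) c"
proof (rule linear_eqI[OF _ _ _ c])
  have "lin_ext R (\<lambda>b. basis_elt R (\<phi> b)) \<in> linear_maps R (free_module R S) (free_module R (\<phi> ` S))"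
    by (rule lin_ext_linear) auto
  moreover have "lin_comb R M g \<in> linear_maps R (free_module R (\<phi> ` S)) M"
    by (rule lin_comb_linear) (use g in auto)
  ultimately show "(\<lambda>c. lin_comb R M g (lin_ext R (\<lambda>b. basis_elt R (\<phi> b)) c)) \<in> linear_maps R (free_module R S) M"
    by (rule linear_maps_comp)
  show "lin_comb R M (\<lambda>b. g (\<phi> b)) \<in> linear_maps R (free_module R S) M"
    by (rule lin_comb_linear) (use g in auto)
  fix b assume "b \<in> S"
  then show "lin_comb R M g (lin_ext R (\<lambda>b. basis_elt R (\<phi> b)) (basis_elt R b)) =
      lin_comb R M (\<lambda>b. g (\<phi> b)) (basis_elt R b)"
    using g by (simp add: lin_ext_basis_elt lin_comb_basis)
qed

text \<open>
  A linear map can be pulled out of a linear extension; this is applied to the operator and to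
  multiplication by fixed elements.
\<close>

lemma lin_comb_image:
  assumes c: "c \<in> free_carrier R S" and g: "\<And>b. b \<in> S \<Longrightarrow> g b \<in> carrier M"
    and h: "h \<in> linear_maps R M M"
  shows "lin_comb R M (\<lambda>b. h (g b)) c = h (lin_comb R M g c)"
proof (rule linear_eqI[OF _ _ _ c])
  have hg: "h (g b) \<in> carrier M" if "b \<in> S" for b
    using linear_mapsD(1)[OF h] g that by auto
  show "lin_comb R M (\<lambda>b. h (g b)) \<in> linear_maps R (free_module R S) M"
    by (rule lin_comb_linear) (use hg in auto)
  have "lin_comb R M g \<in> linear_maps R (free_module R S) M"
    by (rule lin_comb_linear) (use g in auto)
  then show "(\<lambda>c. h (lin_comb R M g c)) \<in> linear_maps R (free_module R S) M"
    using h by (rule linear_maps_comp)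
  fix b assume "b \<in> S"
  then show "lin_comb R M (\<lambda>b. h (g b)) (basis_elt R b) = h (lin_comb R M g (basis_elt R b))"
    using g hg by (simp add: lin_comb_basis)
qed

end

section \<open>Free modules with a bilinear product and a linear operator\<close>

context cring
begin

lemma bilin_ext_basis:
  assumes "f a b \<in> free_carrier R UNIV"
  shows "bilin_ext R f (basis_elt R a) (basis_elt R b) = f a b"
  using assms by (simp add: bilin_ext_def lin_ext_basis_elt)

lemma bilin_ext_closed:
  assumes "\<And>a b. a \<in> S \<Longrightarrow> b \<in> T \<Longrightarrow> f a b \<in> free_carrier R U"
    and "c \<in> free_carrier R S" "d \<in> free_carrier R T"
  shows "bilin_ext R f c d \<in> free_carrier R U"
  unfolding bilin_ext_def using assms by (meson lin_ext_closed)

lemma bilin_ext_add_left: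
  assumes "\<And>a b. a \<in> S \<Longrightarrow> b \<in> T \<Longrightarrow> f a b \<in> free_carrier R U"
    and "c \<in> free_carrier R S" "c' \<in> free_carrier R S" "d \<in> free_carrier R T"
  shows "bilin_ext R f (\<lambda>b. c b \<oplus> c' b) d = (\<lambda>b. bilin_ext R f c d b \<oplus> bilin_ext R f c' d b)"
  unfolding bilin_ext_def
  by (rule lin_ext_add[of S _ U]) (use assms lin_ext_closed[of d T _ U] in auto)

lemma bilin_ext_smult_left:
  assumes "\<And>a b. a \<in> S \<Longrightarrow> b \<in> T \<Longrightarrow> f a b \<in> free_carrier R U"
    and "r \<in> carrier R" "c \<in> free_carrier R S" "d \<in> free_carrier R T"
  shows "bilin_ext R f (\<lambda>b. r \<otimes> c b) d = (\<lambda>b. r \<otimes> bilin_ext R f c d b)"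
  unfolding bilin_ext_def
  by (rule lin_ext_smult[of S _ U]) (use assms lin_ext_closed[of d T _ U] in auto)

lemma bilin_ext_basis_left:
  assumes "\<And>a b. a \<in> S \<Longrightarrow> b \<in> T \<Longrightarrow> f a b \<in> free_carrier R U"
    and "a \<in> S" "d \<in> free_carrier R T"
  shows "bilin_ext R f (basis_elt R a) d = lin_ext R (f a) d"
  unfolding bilin_ext_def by (rule lin_ext_basis[of _ _ U]) (use assms lin_ext_closed[of d T _ U] in auto)

lemma bilin_ext_zero_left: "bilin_ext R f (\<lambda>_. \<zero>) d = (\<lambda>_. \<zero>)"
  by (simp add: bilin_ext_def lin_ext_zero)

lemma bilin_ext_add_right:
  assumes f: "\<And>a b. a \<in> S \<Longrightarrow> b \<in> T \<Longrightarrow> f a b \<in> free_carrier R U"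
    and c: "c \<in> free_carrier R S" and d: "d \<in> free_carrier R T" "d' \<in> free_carrier R T"
  shows "bilin_ext R f c (\<lambda>b. d b \<oplus> d' b) = (\<lambda>b. bilin_ext R f c d b \<oplus> bilin_ext R f c d' b)"
  using c
proof (induction rule: free_induct)
  case zero
  show ?case by (simp add: bilin_ext_zero_left)
next
  case (basis a)
  then show ?case
    using d lin_ext_add[of T "f a" U d d'] f
    by (simp add: bilin_ext_basis_left[OF f] del: fun_eq_iff)
next
  case (add c c')
  have cl: "bilin_ext R f x y b \<in> carrier R" if "x \<in> free_carrier R S" "y \<in> free_carrier R T" for x y b
    using bilin_ext_closed[of S T f U, OF f that] by simp
  show ?case
    using add d cl by (simp add: bilin_ext_add_left[OF f] fun_eq_iff a_ac)
next
  case (smult r c)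
  have cl: "bilin_ext R f x y b \<in> carrier R" if "x \<in> free_carrier R S" "y \<in> free_carrier R T" for x y b
    using bilin_ext_closed[of S T f U, OF f that] by simp
  show ?case
    using smult d cl by (simp add: bilin_ext_smult_left[OF f] fun_eq_iff r_distr)
qed

lemma bilin_ext_smult_right:
  assumes f: "\<And>a b. a \<in> S \<Longrightarrow> b \<in> T \<Longrightarrow> f a b \<in> free_carrier R U"
    and s: "s \<in> carrier R" and c: "c \<in> free_carrier R S" and d: "d \<in> free_carrier R T"
  shows "bilin_ext R f c (\<lambda>b. s \<otimes> d b) = (\<lambda>b. s \<otimes> bilin_ext R f c d b)"
  using c
proof (induction rule: free_induct)
  case zero
  show ?case using s by (simp add: bilin_ext_zero_left)
next
  case (basis a)
  then show ?case
    using d s lin_ext_smult[of T "f a" U d s] f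
    by (simp add: bilin_ext_basis_left[OF f] del: fun_eq_iff)
next
  case (add c c')
  have cl: "bilin_ext R f x y b \<in> carrier R" if "x \<in> free_carrier R S" "y \<in> free_carrier R T" for x y b
    using bilin_ext_closed[of S T f U, OF f that] by simp
  show ?case
    using add d s cl by (simp add: bilin_ext_add_left[OF f] fun_eq_iff r_distr)
next
  case (smult r c)
  have cl: "bilin_ext R f x y b \<in> carrier R" if "x \<in> free_carrier R S" "y \<in> free_carrier R T" for x y b
    using bilin_ext_closed[of S T f U, OF f that] by simp
  show ?case
    using smult d s cl by (simp add: bilin_ext_smult_left[OF f] fun_eq_iff m_lcomm)
qed

end

text \<open>
  A bilinear product and a linear operator, subject to no identity.  Two structures are treated in
  this way: the forest algebra, before its product is known to be associative, and the target of
  an evaluation, where the Rota--Baxter identity is required on an ideal only.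
\<close>

locale operated_module = module K A
  for K :: "('k, 'm) ring_scheme" (structure) and A :: "('k, 'a, 'n) rb_alg_scheme" (structure) +
  assumes mult_closed [simp]: "\<lbrakk>x \<in> carrier A; y \<in> carrier A\<rbrakk> \<Longrightarrow> x \<otimes>\<^bsub>A\<^esub> y \<in> carrier A"
    and mult_l_distr: "\<lbrakk>x \<in> carrier A; y \<in> carrier A; z \<in> carrier A\<rbrakk> \<Longrightarrow>
      (x \<oplus>\<^bsub>A\<^esub> y) \<otimes>\<^bsub>A\<^esub> z = x \<otimes>\<^bsub>A\<^esub> z \<oplus>\<^bsub>A\<^esub> y \<otimes>\<^bsub>A\<^esub> z"
    and mult_r_distr: "\<lbrakk>x \<in> carrier A; y \<in> carrier A; z \<in> carrier A\<rbrakk> \<Longrightarrow>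
      z \<otimes>\<^bsub>A\<^esub> (x \<oplus>\<^bsub>A\<^esub> y) = z \<otimes>\<^bsub>A\<^esub> x \<oplus>\<^bsub>A\<^esub> z \<otimes>\<^bsub>A\<^esub> y"
    and mult_smult_l: "\<lbrakk>r \<in> carrier K; x \<in> carrier A; y \<in> carrier A\<rbrakk> \<Longrightarrow>
      (r \<odot>\<^bsub>A\<^esub> x) \<otimes>\<^bsub>A\<^esub> y = r \<odot>\<^bsub>A\<^esub> (x \<otimes>\<^bsub>A\<^esub> y)"
    and mult_smult_r: "\<lbrakk>r \<in> carrier K; x \<in> carrier A; y \<in> carrier A\<rbrakk> \<Longrightarrow>
      x \<otimes>\<^bsub>A\<^esub> (r \<odot>\<^bsub>A\<^esub> y) = r \<odot>\<^bsub>A\<^esub> (x \<otimes>\<^bsub>A\<^esub> y)"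
    and op_closed [simp]: "x \<in> carrier A \<Longrightarrow> rb_op A x \<in> carrier A"
    and op_add: "\<lbrakk>x \<in> carrier A; y \<in> carrier A\<rbrakk> \<Longrightarrow>
      rb_op A (x \<oplus>\<^bsub>A\<^esub> y) = rb_op A x \<oplus>\<^bsub>A\<^esub> rb_op A y"
    and op_smult: "\<lbrakk>r \<in> carrier K; x \<in> carrier A\<rbrakk> \<Longrightarrow>
      rb_op A (r \<odot>\<^bsub>A\<^esub> x) = r \<odot>\<^bsub>A\<^esub> rb_op A x"
begin

lemma mult_zero [simp]:
  assumes "x \<in> carrier A"
  shows "\<zero>\<^bsub>A\<^esub> \<otimes>\<^bsub>A\<^esub> x = \<zero>\<^bsub>A\<^esub>" "x \<otimes>\<^bsub>A\<^esub> \<zero>\<^bsub>A\<^esub> = \<zero>\<^bsub>A\<^esub>"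
  using mult_smult_l[of \<zero> "\<zero>\<^bsub>A\<^esub>" x] mult_smult_r[of \<zero> x "\<zero>\<^bsub>A\<^esub>"] assms by simp_all

lemma op_zero [simp]: "rb_op A \<zero>\<^bsub>A\<^esub> = \<zero>\<^bsub>A\<^esub>"
  using op_smult[of \<zero> "\<zero>\<^bsub>A\<^esub>"] by simp

lemma nonunitary_rb_algebraI:
  assumes "lam \<in> carrier K"
    and "\<And>x y z. \<lbrakk>x \<in> carrier A; y \<in> carrier A; z \<in> carrier A\<rbrakk> \<Longrightarrow>
      (x \<otimes>\<^bsub>A\<^esub> y) \<otimes>\<^bsub>A\<^esub> z = x \<otimes>\<^bsub>A\<^esub> (y \<otimes>\<^bsub>A\<^esub> z)"
    and "\<And>x y. \<lbrakk>x \<in> carrier A; y \<in> carrier A\<rbrakk> \<Longrightarrow> rb_op A x \<otimes>\<^bsub>A\<^esub> rb_op A y =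
        rb_op A (rb_op A x \<otimes>\<^bsub>A\<^esub> y \<oplus>\<^bsub>A\<^esub> x \<otimes>\<^bsub>A\<^esub> rb_op A y \<oplus>\<^bsub>A\<^esub> lam \<odot>\<^bsub>A\<^esub> (x \<otimes>\<^bsub>A\<^esub> y))"
  shows "nonunitary_rb_algebra K A lam"
  by unfold_locales
     (use assms mult_l_distr mult_r_distr mult_smult_l mult_smult_r op_add op_smult in auto)

end

text \<open>
  A bilinear product and a linear operator given on a basis \<open>S\<close>: the identities of a
  Rota--Baxter algebra are multilinear, so they need only be checked on \<open>S\<close>.
\<close>

locale free_operated = cring K
  for K :: "('k, 'm) ring_scheme" (structure) and A :: "('k, 'b \<Rightarrow> 'k, 'n) rb_alg_scheme" (structure) +
  fixes S :: "'b set" and f :: "'b \<Rightarrow> 'b \<Rightarrow> 'b \<Rightarrow> 'k" and p :: "'b \<Rightarrow> 'b \<Rightarrow> 'k"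
  assumes carrier_eq: "carrier A = free_carrier K S"
    and zero_eq: "zero A = (\<lambda>_. \<zero>)"
    and add_eq: "add A = (\<lambda>c c' b. c b \<oplus> c' b)"
    and smult_eq: "smult A = (\<lambda>r c b. r \<otimes> c b)"
    and mult_eq: "mult A = bilin_ext K f"
    and op_eq: "rb_op A = lin_ext K p"
    and f_closed: "\<And>a b. a \<in> S \<Longrightarrow> b \<in> S \<Longrightarrow> f a b \<in> free_carrier K S"
    and p_closed: "\<And>b. b \<in> S \<Longrightarrow> p b \<in> free_carrier K S"
begin

lemma operated: "operated_module K A"
proof -
  interpret module K A
    using carrier_eq zero_eq add_eq smult_eq by (rule free_module_carrier)
  show ?thesis
    by unfold_locales
       (auto simp: carrier_eq add_eq smult_eq mult_eq op_eq f_closed p_closed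
         bilin_ext_closed[of S S f S] bilin_ext_add_left[of S S f S] bilin_ext_add_right[of S S f S]
         bilin_ext_smult_left[of S S f S] bilin_ext_smult_right[of S S f S]
         lin_ext_closed[of _ S] lin_ext_add[of S p S] lin_ext_smult[of S p S])
qed

sublocale operated_module K A
  by (rule operated)

lemma basis_closed [simp]: "b \<in> S \<Longrightarrow> basis_elt K b \<in> carrier A"
  by (simp add: carrier_eq)

lemma mult_basis: "a \<in> S \<Longrightarrow> b \<in> S \<Longrightarrow> basis_elt K a \<otimes>\<^bsub>A\<^esub> basis_elt K b = f a b"
  using f_closed[of a b] by (simp add: mult_eq bilin_ext_basis free_carrier_mono)

lemma op_basis: "b \<in> S \<Longrightarrow> rb_op A (basis_elt K b) = p b"
  using p_closed[of b] by (simp add: op_eq lin_ext_basis)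

lemma carrier_induct [consumes 1, case_names zero basis add smult]:
  assumes "c \<in> carrier A" and "P \<zero>\<^bsub>A\<^esub>" and "\<And>b. b \<in> S \<Longrightarrow> P (basis_elt K b)"
    and "\<And>c d. \<lbrakk>c \<in> carrier A; d \<in> carrier A; P c; P d\<rbrakk> \<Longrightarrow> P (c \<oplus>\<^bsub>A\<^esub> d)"
    and "\<And>r c. \<lbrakk>r \<in> carrier K; c \<in> carrier A; P c\<rbrakk> \<Longrightarrow> P (r \<odot>\<^bsub>A\<^esub> c)"
  shows "P c"
  using assms(1) unfolding carrier_eq
  by (induction rule: free_induct) (use assms(2-) in \<open>auto simp: carrier_eq zero_eq add_eq smult_eq\<close>)

lemma mult_assoc_from_basis:
  assumes basis: "\<And>a b d. \<lbrakk>a \<in> S; b \<in> S; d \<in> S\<rbrakk> \<Longrightarrow>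
      (basis_elt K a \<otimes>\<^bsub>A\<^esub> basis_elt K b) \<otimes>\<^bsub>A\<^esub> basis_elt K d =
      basis_elt K a \<otimes>\<^bsub>A\<^esub> (basis_elt K b \<otimes>\<^bsub>A\<^esub> basis_elt K d)"
    and x: "x \<in> carrier A" and y: "y \<in> carrier A" and z: "z \<in> carrier A"
  shows "(x \<otimes>\<^bsub>A\<^esub> y) \<otimes>\<^bsub>A\<^esub> z = x \<otimes>\<^bsub>A\<^esub> (y \<otimes>\<^bsub>A\<^esub> z)"
proof -
  note distr = mult_l_distr mult_r_distr mult_smult_l mult_smult_r
  have 1: "(basis_elt K a \<otimes>\<^bsub>A\<^esub> basis_elt K b) \<otimes>\<^bsub>A\<^esub> z = basis_elt K a \<otimes>\<^bsub>A\<^esub> (basis_elt K b \<otimes>\<^bsub>A\<^esub> z)"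
    if "a \<in> S" "b \<in> S" for a b
    using z by (induction rule: carrier_induct) (use that in \<open>simp_all add: basis distr\<close>)
  have 2: "(basis_elt K a \<otimes>\<^bsub>A\<^esub> y) \<otimes>\<^bsub>A\<^esub> z = basis_elt K a \<otimes>\<^bsub>A\<^esub> (y \<otimes>\<^bsub>A\<^esub> z)" if "a \<in> S" for a
    using y by (induction rule: carrier_induct) (use that z in \<open>simp_all add: 1 distr\<close>)
  show ?thesis
    using x by (induction rule: carrier_induct) (use y z in \<open>simp_all add: 2 distr\<close>)
qed

lemma rota_baxter_from_basis:
  assumes lam: "lam \<in> carrier K"
    and basis: "\<And>a b. \<lbrakk>a \<in> S; b \<in> S\<rbrakk> \<Longrightarrow>
      rb_op A (basis_elt K a) \<otimes>\<^bsub>A\<^esub> rb_op A (basis_elt K b) =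
        rb_op A (rb_op A (basis_elt K a) \<otimes>\<^bsub>A\<^esub> basis_elt K b \<oplus>\<^bsub>A\<^esub> basis_elt K a \<otimes>\<^bsub>A\<^esub> rb_op A (basis_elt K b)
          \<oplus>\<^bsub>A\<^esub> lam \<odot>\<^bsub>A\<^esub> (basis_elt K a \<otimes>\<^bsub>A\<^esub> basis_elt K b))"
    and x: "x \<in> carrier A" and y: "y \<in> carrier A"
  shows "rb_op A x \<otimes>\<^bsub>A\<^esub> rb_op A y =
    rb_op A (rb_op A x \<otimes>\<^bsub>A\<^esub> y \<oplus>\<^bsub>A\<^esub> x \<otimes>\<^bsub>A\<^esub> rb_op A y \<oplus>\<^bsub>A\<^esub> lam \<odot>\<^bsub>A\<^esub> (x \<otimes>\<^bsub>A\<^esub> y))"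
proof -
  have swap: "lam \<odot>\<^bsub>A\<^esub> (r \<odot>\<^bsub>A\<^esub> u) = r \<odot>\<^bsub>A\<^esub> (lam \<odot>\<^bsub>A\<^esub> u)" if "r \<in> carrier K" "u \<in> carrier A" for r u
    using that lam by (simp add: m_comm flip: smult_assoc1)
  note distr = mult_l_distr mult_r_distr mult_smult_l mult_smult_r op_add op_smult
    smult_r_distr swap M.a_ac
  have 1: "rb_op A (basis_elt K a) \<otimes>\<^bsub>A\<^esub> rb_op A y =
        rb_op A (rb_op A (basis_elt K a) \<otimes>\<^bsub>A\<^esub> y \<oplus>\<^bsub>A\<^esub> basis_elt K a \<otimes>\<^bsub>A\<^esub> rb_op A y
          \<oplus>\<^bsub>A\<^esub> lam \<odot>\<^bsub>A\<^esub> (basis_elt K a \<otimes>\<^bsub>A\<^esub> y))" if "a \<in> S" for a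
    using y
  proof (induction rule: carrier_induct)
    case (basis b)
    show ?case using that basis by (rule assms(2))
  qed (use that lam in \<open>simp_all add: distr\<close>)
  show ?thesis
    using x by (induction rule: carrier_induct) (use y lam in \<open>simp_all add: 1 distr\<close>)
qed

end

section \<open>The algebra of planar rooted forests\<close>

declare tree_prod.simps [simp del] forest_prod.simps [simp del]

lemma forest_leaves_simps [simp]:
  "forest_leaves [] = 0" "forest_leaves (T # F) = leaves T + forest_leaves F"
  "forest_leaves (F @ G) = forest_leaves F + forest_leaves G"
  by (simp_all add: forest_leaves_def)

lemma leaves_Node: "leaves (Node F) = (if F = [] then 1 else forest_leaves F)"
  by (simp add: forest_leaves_def)

declare leaves.simps [simp del]
declare leaves_Node [simp]

lemma leaves_pos: "leaves T > 0"
proof (induction T rule: leaves.induct)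
  case (1 F)
  then show ?case by (cases F) auto
qed

lemma forest_leaves_pos: "F \<noteq> [] \<Longrightarrow> forest_leaves F > 0"
  using leaves_pos by (cases F) auto

definition ladder_free_forest :: "ptree list \<Rightarrow> bool" where
  "ladder_free_forest F \<longleftrightarrow> (\<forall>T\<in>set F. ladder_free T)"

lemma ladder_free_forest_simps [simp]:
  "ladder_free_forest []" "ladder_free_forest (T # F) \<longleftrightarrow> ladder_free T \<and> ladder_free_forest F"
  "ladder_free_forest (F @ G) \<longleftrightarrow> ladder_free_forest F \<and> ladder_free_forest G"
  by (auto simp: ladder_free_forest_def)

lemma ladder_free_Node: "ladder_free (Node F) \<longleftrightarrow> F \<noteq> [bullet] \<and> ladder_free_forest F"
  by (simp add: ladder_free_forest_def)

declare ladder_free.simps [simp del]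
declare ladder_free_Node [simp]

lemma forests0_eq: "forests0 = {F. F \<noteq> [] \<and> F \<noteq> [bullet] \<and> ladder_free_forest F}"
  by (simp add: forests0_def ladder_free_forest_def)

text \<open>
  What the trees and forests occurring in a product have in common with the factors.  The number
  of leaves makes the concatenated decorations fit.  The other two conditions make \<open>forests0\<close>
  closed under the product; the one on \<open>\<bullet>\<close> also keeps the recursion from creating \<open>\<lfloor>\<bullet>\<rfloor>\<close> out of
  ladder-free factors.
\<close>

definition tree_prod_range :: "ptree \<Rightarrow> ptree \<Rightarrow> ptree set" where
  "tree_prod_range T T' = {U. leaves U + 1 = leaves T + leaves T' \<and>
     (U = bullet \<longrightarrow> T = bullet \<and> T' = bullet) \<and> (ladder_free T \<and> ladder_free T' \<longrightarrow> ladder_free U)}"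

definition forest_prod_range :: "ptree list \<Rightarrow> ptree list \<Rightarrow> ptree list set" where
  "forest_prod_range F F' = {G. G \<noteq> [] \<and> forest_leaves G + 1 = forest_leaves F + forest_leaves F' \<and>
     (G = [bullet] \<longrightarrow> F = [bullet] \<and> F' = [bullet]) \<and>
     (ladder_free_forest F \<and> ladder_free_forest F' \<longrightarrow> ladder_free_forest G)}"

lemma node_in_tree_prod_range:
  assumes "F \<noteq> []" "F' \<noteq> []"
  shows "H \<in> forest_prod_range [Node F] F' \<Longrightarrow> Node H \<in> tree_prod_range (Node F) (Node F')"
    and "H \<in> forest_prod_range F [Node F'] \<Longrightarrow> Node H \<in> tree_prod_range (Node F) (Node F')"
    and "H \<in> forest_prod_range F F' \<Longrightarrow> Node H \<in> tree_prod_range (Node F) (Node F')"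
  using assms unfolding forest_prod_range_def tree_prod_range_def by auto

text \<open>
  The recursion of the product on nonempty forests, with the two trees that meet made explicit.
\<close>

lemma prod_induct [case_names bullet_left bullet_right Node forest]:
  assumes bullets: "\<And>T. P bullet T" "\<And>T. P T bullet"
    and Node: "\<And>F F'. \<lbrakk>F \<noteq> []; F' \<noteq> []; Q [Node F] F'; Q F [Node F']; Q F F'\<rbrakk> \<Longrightarrow> P (Node F) (Node F')"
    and forest: "\<And>A T T' C. P T T' \<Longrightarrow> Q (A @ [T]) (T' # C)"
  shows "P T T'" and "F \<noteq> [] \<longrightarrow> F' \<noteq> [] \<longrightarrow> Q F F'"
proof -
  fix K :: "(nat, unit) ring_scheme" and lam :: nat
  have "P T T'" "F \<noteq> [] \<longrightarrow> F' \<noteq> [] \<longrightarrow> Q F F'"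
  proof (induction K lam T T' and K lam F F' rule: tree_prod_forest_prod.induct)
    case (1 K lam F F')
    then show ?case using bullets Node by (cases "F = [] \<or> F' = []") auto
  next
    case (2 K lam F F')
    show ?case
    proof (intro impI)
      assume "F \<noteq> []" "F' \<noteq> []"
      then show "Q F F'"
        using forest[of "last F" "hd F'" "butlast F" "tl F'"] 2 by simp
    qed
  qed
  then show "P T T'" and "F \<noteq> [] \<longrightarrow> F' \<noteq> [] \<longrightarrow> Q F F'" by blast+
qed

lemma tree_prod_bullet:
  "tree_prod K lam T bullet = basis_elt K T" "tree_prod K lam bullet T = basis_elt K T"
  by (cases T; simp add: tree_prod.simps)+

lemma tree_prod_Node:
  assumes "F \<noteq> []" "F' \<noteq> []"
  shows "tree_prod K lam (Node F) (Node F') =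
    (\<lambda>T. brackets K (forest_prod K lam [Node F] F') T
       \<oplus>\<^bsub>K\<^esub> brackets K (forest_prod K lam F [Node F']) T
       \<oplus>\<^bsub>K\<^esub> lam \<otimes>\<^bsub>K\<^esub> brackets K (forest_prod K lam F F') T)"
  using assms by (simp add: tree_prod.simps)

lemma forest_prod_eq:
  "forest_prod K lam (A @ [T]) (T' # C) =
    lin_ext K (\<lambda>U. basis_elt K (A @ [U] @ C)) (tree_prod K lam T T')"
  by (simp add: forest_prod.simps)

lemma forest_prod_Nil [simp]:
  "forest_prod K lam [] F = (\<lambda>_. \<zero>\<^bsub>K\<^esub>)" "forest_prod K lam F [] = (\<lambda>_. \<zero>\<^bsub>K\<^esub>)"
  by (simp_all add: forest_prod.simps)

text \<open>
  Undecorated forests: the decorations take no part in the recursion for the product, so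
  associativity and the Rota--Baxter identity are settled here.
\<close>

definition forest_alg :: "('k, 'm) ring_scheme \<Rightarrow> 'k \<Rightarrow> ('k, ptree list \<Rightarrow> 'k) rb_alg" where
  "forest_alg K lam =
     \<lparr>carrier = free_carrier K {F. F \<noteq> []}, mult = bilin_ext K (forest_prod K lam),
      one = basis_elt K [bullet], zero = (\<lambda>_. \<zero>\<^bsub>K\<^esub>), add = (\<lambda>c c' b. c b \<oplus>\<^bsub>K\<^esub> c' b),
      smult = (\<lambda>r c b. r \<otimes>\<^bsub>K\<^esub> c b), rb_op = lin_ext K (\<lambda>F. basis_elt K [Node F])\<rparr>"

text \<open>The bilinear extension of \<open>\<squnion>\<close>.\<close>

definition cat ::
  "('k, 'm) ring_scheme \<Rightarrow> (ptree list \<Rightarrow> 'k) \<Rightarrow> (ptree list \<Rightarrow> 'k) \<Rightarrow> (ptree list \<Rightarrow> 'k)" where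
  "cat K = bilin_ext K (\<lambda>F G. basis_elt K (F @ G))"

locale forests = cring K for K :: "('k, 'm) ring_scheme" (structure) +
  fixes lam :: 'k
  assumes lam_closed [simp]: "lam \<in> carrier K"
begin

text \<open>
  For ladder-free factors, the recursion puts a new root only on forests other than \<open>\<bullet>\<close>: of the
  two forests multiplied there, one is a bracket or both are contents of brackets, so they are
  not both equal to \<open>\<bullet>\<close>.
\<close>

lemma prods_closed:
  "tree_prod K lam T T' \<in> free_carrier K (tree_prod_range T T')"
  "F \<noteq> [] \<longrightarrow> F' \<noteq> [] \<longrightarrow> forest_prod K lam F F' \<in> free_carrier K (forest_prod_range F F')"
proof (induction T T' and F F' rule: prod_induct)
  case (bullet_left T)
  show ?case
    unfolding tree_prod_bullet by (rule free_carrier_basis) (simp add: tree_prod_range_def)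
next
  case (bullet_right T)
  show ?case
    unfolding tree_prod_bullet by (rule free_carrier_basis) (simp add: tree_prod_range_def)
next
  case (Node F F')
  have range: "Node H \<in> tree_prod_range (Node F) (Node F')"
    if "H \<in> forest_prod_range [Node F] F' \<or> H \<in> forest_prod_range F [Node F'] \<or> H \<in> forest_prod_range F F'" for H
    using node_in_tree_prod_range[OF \<open>F \<noteq> []\<close> \<open>F' \<noteq> []\<close>] that by blast
  have closed: "brackets K c \<in> free_carrier K (tree_prod_range (Node F) (Node F'))"
    if c: "c \<in> free_carrier K (forest_prod_range G G')"
      and sub: "forest_prod_range G G' \<subseteq>
        forest_prod_range [Node F] F' \<union> forest_prod_range F [Node F'] \<union> forest_prod_range F F'"
    for c G G'
    unfolding brackets_def using c
    by (rule lin_ext_closed) (use range sub in \<open>blast intro: free_carrier_basis\<close>)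
  show ?case
    unfolding tree_prod_Node[OF \<open>F \<noteq> []\<close> \<open>F' \<noteq> []\<close>]
    by (intro free_carrier_add free_carrier_smult lam_closed;
        rule closed[OF Node.IH(1)] closed[OF Node.IH(2)] closed[OF Node.IH(3)])
       (use Node.hyps in auto)
next
  case (forest A T T' C)
  show ?case
    unfolding forest_prod_eq
    by (rule lin_ext_closed[OF forest.IH free_carrier_basis])
       (auto simp: forest_prod_range_def tree_prod_range_def append_eq_Cons_conv)
qed

lemma tree_prod_closed [simp]: "tree_prod K lam T T' \<in> free_carrier K UNIV"
  using prods_closed(1) by (rule free_carrier_mono) simp

lemma forest_prod_closed:
  "F \<noteq> [] \<Longrightarrow> F' \<noteq> [] \<Longrightarrow> forest_prod K lam F F' \<in> free_carrier K (forest_prod_range F F')"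
  using prods_closed(2) by blast

sublocale FA: free_operated K "forest_alg K lam" "{F. F \<noteq> []}" "forest_prod K lam"
    "\<lambda>F. basis_elt K [Node F]"
proof unfold_locales
  fix F F' :: "ptree list"
  assume "F \<in> {F. F \<noteq> []}" "F' \<in> {F. F \<noteq> []}"
  then show "forest_prod K lam F F' \<in> free_carrier K {F. F \<noteq> []}"
    using forest_prod_closed[of F F'] by (auto intro: free_carrier_mono simp: forest_prod_range_def)
qed (simp_all add: forest_alg_def)

lemma forest_prod_UNIV [simp]: "forest_prod K lam F F' \<in> free_carrier K UNIV"
  using forest_prod_closed[of F F'] by (cases "F = [] \<or> F' = []") (auto intro: free_carrier_mono)

abbreviation FA where "FA \<equiv> forest_alg K lam"

lemma forest_one_closed [simp]: "\<one>\<^bsub>FA\<^esub> \<in> carrier FA"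
  by (simp add: forest_alg_def)

lemma forest_one_mult:
  assumes "x \<in> carrier FA"
  shows "\<one>\<^bsub>FA\<^esub> \<otimes>\<^bsub>FA\<^esub> x = x" "x \<otimes>\<^bsub>FA\<^esub> \<one>\<^bsub>FA\<^esub> = x"
proof -
  have one: "\<one>\<^bsub>FA\<^esub> = basis_elt K ([] @ [bullet])" by (simp add: forest_alg_def)
  have 1: "\<one>\<^bsub>FA\<^esub> \<otimes>\<^bsub>FA\<^esub> basis_elt K F = basis_elt K F" if "F \<noteq> []" for F
  proof -
    have "forest_prod K lam ([] @ [bullet]) (hd F # tl F) = basis_elt K ([] @ [hd F] @ tl F)"
      unfolding forest_prod_eq tree_prod_bullet by (rule lin_ext_basis_elt) simp
    with that show ?thesis unfolding one by (simp add: FA.mult_basis)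
  qed
  have 2: "basis_elt K F \<otimes>\<^bsub>FA\<^esub> \<one>\<^bsub>FA\<^esub> = basis_elt K F" if "F \<noteq> []" for F
  proof -
    have "forest_prod K lam (butlast F @ [last F]) (bullet # []) = basis_elt K (butlast F @ [last F] @ [])"
      unfolding forest_prod_eq tree_prod_bullet by (rule lin_ext_basis_elt) simp
    with that show ?thesis unfolding one by (simp add: FA.mult_basis)
  qed
  show "\<one>\<^bsub>FA\<^esub> \<otimes>\<^bsub>FA\<^esub> x = x"
    using assms by (induction rule: FA.carrier_induct) (simp_all add: 1 FA.mult_r_distr FA.mult_smult_r)
  show "x \<otimes>\<^bsub>FA\<^esub> \<one>\<^bsub>FA\<^esub> = x"
    using assms by (induction rule: FA.carrier_induct) (simp_all add: 2 FA.mult_l_distr FA.mult_smult_l)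
qed

text \<open>
  On basis elements this is the recursion for the product of two brackets.
\<close>

lemma forest_rota_baxter:
  assumes "x \<in> carrier FA" "y \<in> carrier FA"
  shows "rb_op FA x \<otimes>\<^bsub>FA\<^esub> rb_op FA y = rb_op FA (rb_op FA x \<otimes>\<^bsub>FA\<^esub> y \<oplus>\<^bsub>FA\<^esub>
    x \<otimes>\<^bsub>FA\<^esub> rb_op FA y \<oplus>\<^bsub>FA\<^esub> lam \<odot>\<^bsub>FA\<^esub> (x \<otimes>\<^bsub>FA\<^esub> y))"
proof (rule FA.rota_baxter_from_basis[OF lam_closed _ assms])
  fix F F' :: "ptree list"
  assume "F \<in> {F. F \<noteq> []}" "F' \<in> {F. F \<noteq> []}"
  then have F: "F \<noteq> []" "F' \<noteq> []" by simp_all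
  let ?\<iota> = "lin_ext K (\<lambda>U. basis_elt K [U])"
  have op: "?\<iota> (brackets K c) = rb_op FA c" if "c \<in> free_carrier K UNIV" for c
  proof -
    have "?\<iota> (brackets K c) = lin_ext K (\<lambda>G. ?\<iota> (basis_elt K (Node G))) c"
      unfolding brackets_def using that by (rule lin_ext_lin_ext[of _ UNIV _ UNIV _ UNIV]) simp_all
    also have "\<dots> = rb_op FA c"
      unfolding FA.op_eq using that by (rule lin_ext_cong) (simp_all add: lin_ext_basis_elt)
    finally show ?thesis .
  qed
  note add = lin_ext_add[of UNIV _ UNIV] and smult = lin_ext_smult[of UNIV _ UNIV]
  have br: "brackets K (forest_prod K lam G G') \<in> free_carrier K UNIV" for G G'
    unfolding brackets_def by (rule lin_ext_closed[of _ UNIV]) simp_all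
  have "rb_op FA (basis_elt K F) \<otimes>\<^bsub>FA\<^esub> rb_op FA (basis_elt K F') =
      forest_prod K lam ([] @ [Node F]) (Node F' # [])"
    using F by (simp add: FA.op_basis FA.mult_basis)
  also have "\<dots> = ?\<iota> (tree_prod K lam (Node F) (Node F'))"
    unfolding forest_prod_eq by simp
  also have "\<dots> = rb_op FA (forest_prod K lam [Node F] F') \<oplus>\<^bsub>FA\<^esub> rb_op FA (forest_prod K lam F [Node F'])
      \<oplus>\<^bsub>FA\<^esub> lam \<odot>\<^bsub>FA\<^esub> rb_op FA (forest_prod K lam F F')"
    unfolding tree_prod_Node[OF F] using br
    by (simp add: add smult op FA.add_eq FA.smult_eq)
  also have "\<dots> = rb_op FA (forest_prod K lam [Node F] F' \<oplus>\<^bsub>FA\<^esub> forest_prod K lam F [Node F']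
      \<oplus>\<^bsub>FA\<^esub> lam \<odot>\<^bsub>FA\<^esub> forest_prod K lam F F')"
    using F FA.f_closed by (simp add: FA.op_add FA.op_smult FA.carrier_eq[symmetric])
  finally show "rb_op FA (basis_elt K F) \<otimes>\<^bsub>FA\<^esub> rb_op FA (basis_elt K F') =
    rb_op FA (rb_op FA (basis_elt K F) \<otimes>\<^bsub>FA\<^esub> basis_elt K F' \<oplus>\<^bsub>FA\<^esub>
      basis_elt K F \<otimes>\<^bsub>FA\<^esub> rb_op FA (basis_elt K F') \<oplus>\<^bsub>FA\<^esub> lam \<odot>\<^bsub>FA\<^esub> (basis_elt K F \<otimes>\<^bsub>FA\<^esub> basis_elt K F'))"
    using F by (simp add: FA.op_basis FA.mult_basis)
qed

lemma cat_basis: "cat K (basis_elt K F) (basis_elt K G) = basis_elt K (F @ G)"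
  unfolding cat_def by (rule bilin_ext_basis) simp

lemma cat_closed [simp]: "x \<in> free_carrier K UNIV \<Longrightarrow> y \<in> free_carrier K UNIV \<Longrightarrow> cat K x y \<in> free_carrier K UNIV"
  unfolding cat_def by (rule bilin_ext_closed[of UNIV UNIV]) auto

lemma cat_carrier_left [simp]: "x \<in> carrier FA \<Longrightarrow> y \<in> free_carrier K UNIV \<Longrightarrow> cat K x y \<in> carrier FA"
  unfolding cat_def FA.carrier_eq by (rule bilin_ext_closed[of "{F. F \<noteq> []}" UNIV]) auto

lemma cat_carrier_right [simp]: "x \<in> free_carrier K UNIV \<Longrightarrow> y \<in> carrier FA \<Longrightarrow> cat K x y \<in> carrier FA"
  unfolding cat_def FA.carrier_eq by (rule bilin_ext_closed[of UNIV "{F. F \<noteq> []}"]) auto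

lemma carrier_UNIV [simp]: "x \<in> carrier FA \<Longrightarrow> x \<in> free_carrier K UNIV"
  by (auto simp: FA.carrier_eq intro: free_carrier_mono)

lemmas cat_linear =
  bilin_ext_add_left[of UNIV UNIV "\<lambda>(F :: ptree list) G. basis_elt K (F @ G)" UNIV, folded cat_def]
  bilin_ext_add_right[of UNIV UNIV "\<lambda>(F :: ptree list) G. basis_elt K (F @ G)" UNIV, folded cat_def]
  bilin_ext_smult_left[of UNIV UNIV "\<lambda>(F :: ptree list) G. basis_elt K (F @ G)" UNIV, folded cat_def]
  bilin_ext_smult_right[of UNIV UNIV "\<lambda>(F :: ptree list) G. basis_elt K (F @ G)" UNIV, folded cat_def]

lemma cat_zero [simp]:
  assumes "x \<in> free_carrier K UNIV"
  shows "cat K (\<lambda>_. \<zero>) x = (\<lambda>_. \<zero>)" "cat K x (\<lambda>_. \<zero>) = (\<lambda>_. \<zero>)"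
  using cat_linear(3)[of \<zero> "\<lambda>_. \<zero>" x] cat_linear(4)[of \<zero> x "\<lambda>_. \<zero>"] assms
    free_carrier_closed[OF cat_closed, of x "\<lambda>_. \<zero>"] free_carrier_closed[OF cat_closed, of "\<lambda>_. \<zero>" x]
  by simp_all

lemma cat_lin:
  "x \<in> carrier FA \<Longrightarrow> y \<in> carrier FA \<Longrightarrow> z \<in> free_carrier K UNIV \<Longrightarrow> cat K (x \<oplus>\<^bsub>FA\<^esub> y) z = cat K x z \<oplus>\<^bsub>FA\<^esub> cat K y z"
  "x \<in> carrier FA \<Longrightarrow> y \<in> carrier FA \<Longrightarrow> z \<in> free_carrier K UNIV \<Longrightarrow> cat K z (x \<oplus>\<^bsub>FA\<^esub> y) = cat K z x \<oplus>\<^bsub>FA\<^esub> cat K z y"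
  "r \<in> carrier K \<Longrightarrow> x \<in> carrier FA \<Longrightarrow> z \<in> free_carrier K UNIV \<Longrightarrow> cat K (r \<odot>\<^bsub>FA\<^esub> x) z = r \<odot>\<^bsub>FA\<^esub> cat K x z"
  "r \<in> carrier K \<Longrightarrow> x \<in> carrier FA \<Longrightarrow> z \<in> free_carrier K UNIV \<Longrightarrow> cat K z (r \<odot>\<^bsub>FA\<^esub> x) = r \<odot>\<^bsub>FA\<^esub> cat K z x"
  by (simp_all add: FA.add_eq FA.smult_eq cat_linear)

lemma cat_zero_FA [simp]:
  assumes "x \<in> free_carrier K UNIV"
  shows "cat K \<zero>\<^bsub>FA\<^esub> x = \<zero>\<^bsub>FA\<^esub>" "cat K x \<zero>\<^bsub>FA\<^esub> = \<zero>\<^bsub>FA\<^esub>"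
  using assms by (simp_all add: FA.zero_eq)

text \<open>
  In a product only the last tree of the left factor and the first tree of the right factor meet,
  so anything concatenated on the far side of either factor passes through.
\<close>

lemma mult_cat_right:
  assumes x: "x \<in> carrier FA" and y: "y \<in> carrier FA" and z: "z \<in> free_carrier K UNIV"
  shows "x \<otimes>\<^bsub>FA\<^esub> cat K y z = cat K (x \<otimes>\<^bsub>FA\<^esub> y) z"
proof -
  have 0: "basis_elt K F \<otimes>\<^bsub>FA\<^esub> basis_elt K (G @ H) = cat K (basis_elt K F \<otimes>\<^bsub>FA\<^esub> basis_elt K G) (basis_elt K H)"
    if "F \<noteq> []" "G \<noteq> []" for F G H
  proof -
    have "cat K c (basis_elt K H) = lin_ext K (\<lambda>G. basis_elt K (G @ H)) c" if "c \<in> free_carrier K UNIV" for c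
      unfolding cat_def bilin_ext_def using that
      by (rule lin_ext_cong) (auto simp: lin_ext_basis_elt)
    moreover have "lin_ext K (\<lambda>G. basis_elt K (G @ H)) (forest_prod K lam (butlast F @ [last F]) (hd G # tl G))
        = forest_prod K lam (butlast F @ [last F]) (hd G # (tl G @ H))"
      unfolding forest_prod_eq
      by (subst lin_ext_lin_ext[of _ UNIV _ UNIV _ UNIV])
         (auto simp: lin_ext_basis_elt intro!: lin_ext_cong[of _ UNIV])
    moreover have "hd G # (tl G @ H) = G @ H" using that by (cases G) auto
    ultimately show ?thesis using that by (simp add: FA.mult_basis)
  qed
  have 1: "basis_elt K F \<otimes>\<^bsub>FA\<^esub> cat K (basis_elt K G) z = cat K (basis_elt K F \<otimes>\<^bsub>FA\<^esub> basis_elt K G) z"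
    if F: "F \<noteq> []" "G \<noteq> []" for F G
    using z
  proof (induction rule: free_induct)
    case zero
    show ?case using F by (simp add: FA.zero_eq[symmetric])
  next
    case (basis H)
    show ?case using 0[OF F] by (simp add: cat_basis)
  next
    case (add c d)
    then have "basis_elt K F \<otimes>\<^bsub>FA\<^esub> (cat K (basis_elt K G) c \<oplus>\<^bsub>FA\<^esub> cat K (basis_elt K G) d)
      = cat K (basis_elt K F \<otimes>\<^bsub>FA\<^esub> basis_elt K G) c \<oplus>\<^bsub>FA\<^esub> cat K (basis_elt K F \<otimes>\<^bsub>FA\<^esub> basis_elt K G) d"
      using F by (simp add: FA.mult_r_distr)
    then show ?case using add F by (simp add: cat_linear FA.add_eq)
  next
    case (smult r c)
    then have "basis_elt K F \<otimes>\<^bsub>FA\<^esub> (r \<odot>\<^bsub>FA\<^esub> cat K (basis_elt K G) c)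
      = r \<odot>\<^bsub>FA\<^esub> cat K (basis_elt K F \<otimes>\<^bsub>FA\<^esub> basis_elt K G) c"
      using F by (simp add: FA.mult_smult_r)
    then show ?case using smult F by (simp add: cat_linear FA.smult_eq)
  qed
  have 2: "basis_elt K F \<otimes>\<^bsub>FA\<^esub> cat K y z = cat K (basis_elt K F \<otimes>\<^bsub>FA\<^esub> y) z" if "F \<noteq> []" for F
    using y by (induction rule: FA.carrier_induct)
      (use that z in \<open>simp_all add: 1 FA.mult_r_distr FA.mult_smult_r cat_lin\<close>)
  show ?thesis
    using x by (induction rule: FA.carrier_induct)
      (use y z in \<open>simp_all add: 2 FA.mult_l_distr FA.mult_smult_l cat_lin\<close>)
qed

lemma mult_cat_left:
  assumes x: "x \<in> free_carrier K UNIV" and y: "y \<in> carrier FA" and z: "z \<in> carrier FA"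
  shows "cat K x y \<otimes>\<^bsub>FA\<^esub> z = cat K x (y \<otimes>\<^bsub>FA\<^esub> z)"
proof -
  have 0: "basis_elt K (F @ G) \<otimes>\<^bsub>FA\<^esub> basis_elt K H = cat K (basis_elt K F) (basis_elt K G \<otimes>\<^bsub>FA\<^esub> basis_elt K H)"
    if "G \<noteq> []" "H \<noteq> []" for F G H
  proof -
    have "cat K (basis_elt K F) c = lin_ext K (\<lambda>G. basis_elt K (F @ G)) c" if "c \<in> free_carrier K UNIV" for c
      unfolding cat_def by (rule bilin_ext_basis_left[of UNIV UNIV _ UNIV]) (use that in auto)
    moreover have "lin_ext K (\<lambda>G. basis_elt K (F @ G)) (forest_prod K lam (butlast G @ [last G]) (hd H # tl H))
        = forest_prod K lam ((F @ butlast G) @ [last G]) (hd H # tl H)"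
      unfolding forest_prod_eq
      by (subst lin_ext_lin_ext[of _ UNIV _ UNIV _ UNIV])
         (auto simp: lin_ext_basis_elt intro!: lin_ext_cong[of _ UNIV])
    ultimately show ?thesis using that by (simp add: FA.mult_basis)
  qed
  have 1: "cat K x (basis_elt K G) \<otimes>\<^bsub>FA\<^esub> basis_elt K H = cat K x (basis_elt K G \<otimes>\<^bsub>FA\<^esub> basis_elt K H)"
    if F: "G \<noteq> []" "H \<noteq> []" for G H
    using x
  proof (induction rule: free_induct)
    case zero
    show ?case using F by (simp add: FA.zero_eq[symmetric])
  next
    case (basis F)
    show ?case using 0[OF F] by (simp add: cat_basis)
  next
    case (add c d)
    then have "(cat K c (basis_elt K G) \<oplus>\<^bsub>FA\<^esub> cat K d (basis_elt K G)) \<otimes>\<^bsub>FA\<^esub> basis_elt K H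
      = cat K c (basis_elt K G \<otimes>\<^bsub>FA\<^esub> basis_elt K H) \<oplus>\<^bsub>FA\<^esub> cat K d (basis_elt K G \<otimes>\<^bsub>FA\<^esub> basis_elt K H)"
      using F by (simp add: FA.mult_l_distr)
    then show ?case using add F by (simp add: cat_linear FA.add_eq)
  next
    case (smult r c)
    then have "(r \<odot>\<^bsub>FA\<^esub> cat K c (basis_elt K G)) \<otimes>\<^bsub>FA\<^esub> basis_elt K H
      = r \<odot>\<^bsub>FA\<^esub> cat K c (basis_elt K G \<otimes>\<^bsub>FA\<^esub> basis_elt K H)"
      using F by (simp add: FA.mult_smult_l)
    then show ?case using smult F by (simp add: cat_linear FA.smult_eq)
  qed
  have 2: "cat K x y \<otimes>\<^bsub>FA\<^esub> basis_elt K H = cat K x (y \<otimes>\<^bsub>FA\<^esub> basis_elt K H)" if "H \<noteq> []" for H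
    using y by (induction rule: FA.carrier_induct)
      (use that x in \<open>simp_all add: 1 FA.mult_l_distr FA.mult_smult_l cat_lin\<close>)
  show ?thesis
    using z by (induction rule: FA.carrier_induct)
      (use x y in \<open>simp_all add: 2 FA.mult_r_distr FA.mult_smult_r cat_lin\<close>)
qed

text \<open>
  If the middle factor has at least two trees, the two products take place at its different ends
  and do not interact.  Otherwise the outer forests can be replaced by their trees next to the
  middle one.  A factor \<open>\<bullet>\<close> is the unit.  For three brackets \<open>P x\<close>, \<open>P y\<close>, \<open>P z\<close>, the Rota--Baxter
  identity is applied twice to each side; both become \<open>P\<close> of a combination of seven triple products of
  elements among \<open>P x\<close>, \<open>x\<close>, \<open>P y\<close>, \<open>y\<close>, \<open>P z\<close>, \<open>z\<close>, and the summands agree by induction, since each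
  triple has lost at least one bracket.
\<close>

lemma forest_assoc_basis:
  assumes "F \<noteq> []" "G \<noteq> []" "H \<noteq> []"
  shows "(basis_elt K F \<otimes>\<^bsub>FA\<^esub> basis_elt K G) \<otimes>\<^bsub>FA\<^esub> basis_elt K H =
    basis_elt K F \<otimes>\<^bsub>FA\<^esub> (basis_elt K G \<otimes>\<^bsub>FA\<^esub> basis_elt K H)"
  using assms
proof (induction "size_list size F + size_list size G + size_list size H" arbitrary: F G H rule: less_induct)
  case less
  show ?case
  proof (cases "tl G = []")
    case False
    define G1 where "G1 = [hd G]"
    define G2 where "G2 = tl G"
    have G: "basis_elt K G = cat K (basis_elt K G1) (basis_elt K G2)" "G1 \<noteq> []" "G2 \<noteq> []"
      using False less.prems by (simp_all add: cat_basis G1_def G2_def)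
    show ?thesis
      unfolding G(1) using G(2,3) less.prems by (simp add: mult_cat_left mult_cat_right)
  next
    case True
    define f where "f = basis_elt K [last F]"
    define g where "g = basis_elt K G"
    define h where "h = basis_elt K [hd H]"
    define a where "a = basis_elt K (butlast F)"
    define c where "c = basis_elt K (tl H)"
    have FH: "basis_elt K F = cat K a f" "basis_elt K H = cat K h c"
      using less.prems by (simp_all add: cat_basis a_def c_def f_def h_def)
    have cl [simp]: "f \<in> carrier FA" "g \<in> carrier FA" "h \<in> carrier FA"
      "a \<in> free_carrier K UNIV" "c \<in> free_carrier K UNIV"
      using less.prems by (simp_all add: f_def g_def h_def a_def c_def)
    have G: "G = [hd G]" using True less.prems by (cases G) auto
    have assoc: "(f \<otimes>\<^bsub>FA\<^esub> g) \<otimes>\<^bsub>FA\<^esub> h = f \<otimes>\<^bsub>FA\<^esub> (g \<otimes>\<^bsub>FA\<^esub> h)"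
    proof (cases "last F = bullet \<or> hd G = bullet \<or> hd H = bullet")
      case True
      then have "f = \<one>\<^bsub>FA\<^esub> \<or> g = \<one>\<^bsub>FA\<^esub> \<or> h = \<one>\<^bsub>FA\<^esub>"
        using G by (auto simp: f_def g_def h_def forest_alg_def)
      then show ?thesis by (auto simp: forest_one_mult)
    next
      case False
      obtain F' G' H' where N: "last F = Node F'" "hd G = Node G'" "hd H = Node H'"
        by (meson ptree.exhaust)
      with False have ne: "F' \<noteq> []" "G' \<noteq> []" "H' \<noteq> []" by auto
      define x where "x = basis_elt K F'"
      define y where "y = basis_elt K G'"
      define z where "z = basis_elt K H'"
      have cl' [simp]: "x \<in> carrier FA" "y \<in> carrier FA" "z \<in> carrier FA"
        using ne by (simp_all add: x_def y_def z_def)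
      have P: "f = rb_op FA x" "g = rb_op FA y" "h = rb_op FA z"
        using ne N G by (simp_all add: f_def g_def h_def x_def y_def z_def FA.op_basis)
      have size: "size_list size F \<ge> size_list size F' + 2" "size_list size G \<ge> size_list size G' + 2"
          "size_list size H \<ge> size_list size H' + 2"
      proof -
        have "size_list size F = size_list size (butlast F @ [last F])"
          "size_list size H = size_list size (hd H # tl H)"
          "size_list size G = size_list size [hd G]"
          using less.prems G by simp_all
        then show "size_list size F \<ge> size_list size F' + 2" "size_list size G \<ge> size_list size G' + 2"
          "size_list size H \<ge> size_list size H' + 2" unfolding N size_list_append by simp_all
      qed
      have fgh: "f = basis_elt K [Node F']" "g = basis_elt K [Node G']" "h = basis_elt K [Node H']"
        using G N by (simp_all add: f_def g_def h_def)
      have IH: "(basis_elt K F1 \<otimes>\<^bsub>FA\<^esub> basis_elt K G1) \<otimes>\<^bsub>FA\<^esub> basis_elt K H1 =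
          basis_elt K F1 \<otimes>\<^bsub>FA\<^esub> (basis_elt K G1 \<otimes>\<^bsub>FA\<^esub> basis_elt K H1)"
        if "(F1, G1, H1) \<in> {([Node F'], [Node G'], H'), ([Node F'], G', [Node H']), (F', [Node G'], [Node H']),
            ([Node F'], G', H'), (F', [Node G'], H'), (F', G', [Node H']), (F', G', H')}" for F1 G1 H1
        by (rule less.hyps) (use that ne size in auto)
      have IH: "(f \<otimes>\<^bsub>FA\<^esub> g) \<otimes>\<^bsub>FA\<^esub> z = f \<otimes>\<^bsub>FA\<^esub> (g \<otimes>\<^bsub>FA\<^esub> z)"
        "(f \<otimes>\<^bsub>FA\<^esub> y) \<otimes>\<^bsub>FA\<^esub> h = f \<otimes>\<^bsub>FA\<^esub> (y \<otimes>\<^bsub>FA\<^esub> h)" "(x \<otimes>\<^bsub>FA\<^esub> g) \<otimes>\<^bsub>FA\<^esub> h = x \<otimes>\<^bsub>FA\<^esub> (g \<otimes>\<^bsub>FA\<^esub> h)"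
        "(f \<otimes>\<^bsub>FA\<^esub> y) \<otimes>\<^bsub>FA\<^esub> z = f \<otimes>\<^bsub>FA\<^esub> (y \<otimes>\<^bsub>FA\<^esub> z)" "(x \<otimes>\<^bsub>FA\<^esub> g) \<otimes>\<^bsub>FA\<^esub> z = x \<otimes>\<^bsub>FA\<^esub> (g \<otimes>\<^bsub>FA\<^esub> z)"
        "(x \<otimes>\<^bsub>FA\<^esub> y) \<otimes>\<^bsub>FA\<^esub> h = x \<otimes>\<^bsub>FA\<^esub> (y \<otimes>\<^bsub>FA\<^esub> h)" "(x \<otimes>\<^bsub>FA\<^esub> y) \<otimes>\<^bsub>FA\<^esub> z = x \<otimes>\<^bsub>FA\<^esub> (y \<otimes>\<^bsub>FA\<^esub> z)"
        unfolding fgh x_def y_def z_def by (rule IH; simp)+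
      \<comment> \<open>\<open>u\<close> and \<open>v\<close> are the arguments of the operator in \<open>P x \<cdot> P y\<close> and \<open>P y \<cdot> P z\<close>.\<close>
      define u where "u = f \<otimes>\<^bsub>FA\<^esub> y \<oplus>\<^bsub>FA\<^esub> x \<otimes>\<^bsub>FA\<^esub> g \<oplus>\<^bsub>FA\<^esub> lam \<odot>\<^bsub>FA\<^esub> (x \<otimes>\<^bsub>FA\<^esub> y)"
      define v where "v = g \<otimes>\<^bsub>FA\<^esub> z \<oplus>\<^bsub>FA\<^esub> y \<otimes>\<^bsub>FA\<^esub> h \<oplus>\<^bsub>FA\<^esub> lam \<odot>\<^bsub>FA\<^esub> (y \<otimes>\<^bsub>FA\<^esub> z)"
      have u: "f \<otimes>\<^bsub>FA\<^esub> g = rb_op FA u" and v: "g \<otimes>\<^bsub>FA\<^esub> h = rb_op FA v"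
        unfolding P u_def v_def by (rule forest_rota_baxter; simp)+
      have [simp]: "u \<in> carrier FA" "v \<in> carrier FA" by (simp_all add: u_def v_def)
      have "(f \<otimes>\<^bsub>FA\<^esub> g) \<otimes>\<^bsub>FA\<^esub> h = rb_op FA ((f \<otimes>\<^bsub>FA\<^esub> g) \<otimes>\<^bsub>FA\<^esub> z \<oplus>\<^bsub>FA\<^esub> u \<otimes>\<^bsub>FA\<^esub> h \<oplus>\<^bsub>FA\<^esub> lam \<odot>\<^bsub>FA\<^esub> (u \<otimes>\<^bsub>FA\<^esub> z))"
        unfolding u P(3) by (rule forest_rota_baxter) simp_all
      also have "(f \<otimes>\<^bsub>FA\<^esub> g) \<otimes>\<^bsub>FA\<^esub> z \<oplus>\<^bsub>FA\<^esub> u \<otimes>\<^bsub>FA\<^esub> h \<oplus>\<^bsub>FA\<^esub> lam \<odot>\<^bsub>FA\<^esub> (u \<otimes>\<^bsub>FA\<^esub> z) =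
          f \<otimes>\<^bsub>FA\<^esub> v \<oplus>\<^bsub>FA\<^esub> x \<otimes>\<^bsub>FA\<^esub> (g \<otimes>\<^bsub>FA\<^esub> h) \<oplus>\<^bsub>FA\<^esub> lam \<odot>\<^bsub>FA\<^esub> (x \<otimes>\<^bsub>FA\<^esub> v)"
        unfolding u_def v_def
        by (simp add: FA.mult_l_distr FA.mult_r_distr FA.mult_smult_l FA.mult_smult_r
            FA.smult_r_distr IH FA.M.a_ac)
      also have "rb_op FA \<dots> = f \<otimes>\<^bsub>FA\<^esub> (g \<otimes>\<^bsub>FA\<^esub> h)"
        unfolding v P(1) by (rule forest_rota_baxter[symmetric]) simp_all
      finally show ?thesis .
    qed
    show ?thesis
      unfolding FH g_def[symmetric] by (simp add: mult_cat_left mult_cat_right assoc)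
  qed
qed

lemma forest_assoc:
  assumes "x \<in> carrier FA" "y \<in> carrier FA" "z \<in> carrier FA"
  shows "(x \<otimes>\<^bsub>FA\<^esub> y) \<otimes>\<^bsub>FA\<^esub> z = x \<otimes>\<^bsub>FA\<^esub> (y \<otimes>\<^bsub>FA\<^esub> z)"
  by (rule FA.mult_assoc_from_basis[OF _ assms]) (simp add: forest_assoc_basis)

end

section \<open>The algebras of decorated forests\<close>

abbreviation decorated_prod ::
  "('k, 'm) ring_scheme \<Rightarrow> 'k \<Rightarrow> 'x decorated \<Rightarrow> 'x decorated \<Rightarrow> 'x decorated \<Rightarrow> 'k" where
  "decorated_prod K lam \<equiv> (\<lambda>(F, xs) (F', xs').
     lin_ext K (\<lambda>G. basis_elt K (G, xs @ xs')) (forest_prod K lam F F'))"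

abbreviation decorated_op :: "('k, 'm) ring_scheme \<Rightarrow> 'x decorated \<Rightarrow> 'x decorated \<Rightarrow> 'k" where
  "decorated_op K \<equiv> (\<lambda>(F, xs). basis_elt K ([Node F], xs))"

abbreviation decorated_forests0 :: "'x set \<Rightarrow> 'x decorated set" where
  "decorated_forests0 X \<equiv> {(F, xs) \<in> decorated_forests X. F \<in> forests0}"

text \<open>
  Attaching a fixed decoration to all forests of a vector.  The product of decorated forests is
  the product of the forests with concatenated decorations, so identities between undecorated
  forests carry over along this map.
\<close>

definition tag ::
  "('k, 'm) ring_scheme \<Rightarrow> 'x list \<Rightarrow> (ptree list \<Rightarrow> 'k) \<Rightarrow> ('x decorated \<Rightarrow> 'k)" where
  "tag K xs = lin_ext K (\<lambda>F. basis_elt K (F, xs))"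

text \<open>
  A fixed decoration does not fit all forests of an arbitrary vector.  Without the condition on
  its length, \<open>tag\<close> is defined on the whole forest algebra and compatible with its structure.
\<close>

definition all_decorated ::
  "('k, 'm) ring_scheme \<Rightarrow> 'k \<Rightarrow> ('k, 'x decorated \<Rightarrow> 'k) rb_alg" where
  "all_decorated K lam = (sh_nc K lam UNIV)\<lparr>carrier := free_carrier K UNIV\<rparr>"

locale decorated = forests K lam
  for K :: "('k, 'm) ring_scheme" (structure) and lam :: 'k +
  fixes X :: "'x set"
begin

lemma decorated_prod_closed:
  assumes "a \<in> decorated_forests X" "b \<in> decorated_forests X"
  shows "decorated_prod K lam a b \<in> free_carrier K (decorated_forests X)"
    and "a \<in> decorated_forests0 X \<Longrightarrow> b \<in> decorated_forests0 X \<Longrightarrow>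
      decorated_prod K lam a b \<in> free_carrier K (decorated_forests0 X)"
proof -
  obtain F xs F' xs' where ab: "a = (F, xs)" "b = (F', xs')" by fastforce
  with assms have F: "F \<noteq> []" "F' \<noteq> []" and xs: "length xs = forest_leaves F - 1"
      "length xs' = forest_leaves F' - 1" "set xs \<subseteq> X" "set xs' \<subseteq> X"
    by (auto simp: decorated_forests_def)
  have len: "length (xs @ xs') = forest_leaves G - 1" if "G \<in> forest_prod_range F F'" for G
    using that xs forest_leaves_pos[OF F(1)] forest_leaves_pos[OF F(2)] by (auto simp: forest_prod_range_def)
  show "decorated_prod K lam a b \<in> free_carrier K (decorated_forests X)"
    unfolding ab prod.case
    by (rule lin_ext_closed[OF forest_prod_closed[OF F] free_carrier_basis])
       (use len xs in \<open>auto simp: forest_prod_range_def decorated_forests_def\<close>)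
  show "decorated_prod K lam a b \<in> free_carrier K (decorated_forests0 X)"
    if "a \<in> decorated_forests0 X" "b \<in> decorated_forests0 X"
    unfolding ab prod.case
    by (rule lin_ext_closed[OF forest_prod_closed[OF F] free_carrier_basis])
       (use len xs that ab in \<open>auto simp: forest_prod_range_def decorated_forests_def forests0_eq\<close>)
qed

lemma decorated_op_closed:
  assumes "a \<in> decorated_forests X"
  shows "decorated_op K a \<in> free_carrier K (decorated_forests X)"
    and "a \<in> decorated_forests0 X \<Longrightarrow> decorated_op K a \<in> free_carrier K (decorated_forests0 X)"
  using assms by (auto simp: decorated_forests_def forests0_eq split: prod.splits)

sublocale Sh: free_operated K "sh_nc K lam X" "decorated_forests X" "decorated_prod K lam" "decorated_op K"
  by unfold_locales (simp_all add: sh_nc_def decorated_prod_closed decorated_op_closed)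

sublocale Sh0: free_operated K "sh_nc0 K lam X" "decorated_forests0 X" "decorated_prod K lam" "decorated_op K"
  by unfold_locales
     (use decorated_prod_closed(2) decorated_op_closed(2) in \<open>auto simp: sh_nc_def sh_nc0_def\<close>)

abbreviation Sh where "Sh \<equiv> sh_nc K lam X"
abbreviation Sh0 where "Sh0 \<equiv> sh_nc0 K lam X"

lemma Sh0_ops:
  "mult Sh0 = mult Sh" "rb_op Sh0 = rb_op Sh" "add Sh0 = add Sh" "smult Sh0 = smult Sh" "zero Sh0 = zero Sh"
  by (simp_all add: sh_nc0_def)

lemma Sh0_subset: "carrier Sh0 \<subseteq> carrier Sh"
  by (auto simp: Sh.carrier_eq Sh0.carrier_eq intro: free_carrier_mono)

interpretation Shu: free_operated K "all_decorated K lam :: ('k, 'x decorated \<Rightarrow> 'k) rb_alg" UNIV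
    "decorated_prod K lam" "decorated_op K"
  by unfold_locales
     (auto simp: all_decorated_def sh_nc_def intro!: lin_ext_closed[of _ UNIV] split: prod.splits)

lemma tag_basis: "tag K xs (basis_elt K F) = basis_elt K (F, xs)"
  unfolding tag_def by (rule lin_ext_basis_elt) simp

lemma tag_closed [simp]: "c \<in> free_carrier K UNIV \<Longrightarrow> tag K xs c \<in> free_carrier K UNIV"
  unfolding tag_def by (rule lin_ext_closed) auto

lemma tag_zero [simp]: "tag K xs (\<lambda>_. \<zero>) = (\<lambda>_. \<zero>)"
  by (simp add: tag_def lin_ext_zero)

lemma tag_add:
  "x \<in> carrier FA \<Longrightarrow> y \<in> carrier FA \<Longrightarrow> tag K xs (x \<oplus>\<^bsub>FA\<^esub> y) = tag K xs x \<oplus>\<^bsub>Sh\<^esub> tag K xs y"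
  unfolding tag_def FA.add_eq Sh.add_eq by (rule lin_ext_add[of UNIV _ UNIV]) auto

lemma tag_smult:
  "r \<in> carrier K \<Longrightarrow> x \<in> carrier FA \<Longrightarrow> tag K xs (r \<odot>\<^bsub>FA\<^esub> x) = r \<odot>\<^bsub>Sh\<^esub> tag K xs x"
  unfolding tag_def FA.smult_eq Sh.smult_eq by (rule lin_ext_smult[of UNIV _ UNIV]) auto

lemma tag_op:
  assumes "x \<in> carrier FA"
  shows "rb_op Sh (tag K xs x) = tag K xs (rb_op FA x)"
proof -
  have x: "x \<in> free_carrier K UNIV" using assms by simp
  have "rb_op Sh (tag K xs x) = lin_ext K (\<lambda>F. lin_ext K (decorated_op K) (basis_elt K (F, xs))) x"
    unfolding Sh.op_eq tag_def using x by (rule lin_ext_lin_ext[of _ UNIV _ UNIV _ UNIV]) auto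
  also have "\<dots> = lin_ext K (\<lambda>F. lin_ext K (\<lambda>F. basis_elt K (F, xs)) (basis_elt K [Node F])) x"
    using x by (rule lin_ext_cong) (auto simp: lin_ext_basis_elt)
  also have "\<dots> = tag K xs (rb_op FA x)"
    unfolding FA.op_eq tag_def using x by (rule lin_ext_lin_ext[of _ UNIV _ UNIV _ UNIV, symmetric]) auto
  finally show ?thesis .
qed

lemma tag_mult:
  assumes x: "x \<in> carrier FA" and y: "y \<in> carrier FA"
  shows "tag K xs x \<otimes>\<^bsub>Sh\<^esub> tag K ys y = tag K (xs @ ys) (x \<otimes>\<^bsub>FA\<^esub> y)"
proof -
  let ?U = "all_decorated K lam :: ('k, 'x decorated \<Rightarrow> 'k) rb_alg"
  have ops: "mult Sh = mult ?U" "add Sh = add ?U" "smult Sh = smult ?U"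
    by (simp_all add: all_decorated_def sh_nc_def)
  have cl: "tag K zs z \<in> carrier ?U" if "z \<in> carrier FA" for z zs
    using that by (simp add: Shu.carrier_eq)
  note ta = tag_add[unfolded ops] tag_smult[unfolded ops]
  have z: "tag K zs \<zero>\<^bsub>FA\<^esub> = \<zero>\<^bsub>?U\<^esub>" for zs by (simp add: FA.zero_eq Shu.zero_eq)
  have 0: "tag K xs (basis_elt K F) \<otimes>\<^bsub>?U\<^esub> tag K ys (basis_elt K G) =
      tag K (xs @ ys) (basis_elt K F \<otimes>\<^bsub>FA\<^esub> basis_elt K G)" if "F \<noteq> []" "G \<noteq> []" for F G
    unfolding tag_basis Shu.mult_basis[OF UNIV_I UNIV_I] using that by (simp add: FA.mult_basis tag_def)
  have 1: "tag K xs (basis_elt K F) \<otimes>\<^bsub>?U\<^esub> tag K ys y =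
      tag K (xs @ ys) (basis_elt K F \<otimes>\<^bsub>FA\<^esub> y)" if "F \<noteq> []" for F
    using y that cl
    by (induction rule: FA.carrier_induct)
       (simp_all add: z 0 ta FA.mult_r_distr FA.mult_smult_r Shu.mult_r_distr Shu.mult_smult_r)
  show ?thesis
    unfolding ops using x y cl
    by (induction rule: FA.carrier_induct)
       (simp_all add: z 1 ta FA.mult_l_distr FA.mult_smult_l Shu.mult_l_distr Shu.mult_smult_l)
qed

lemma decoratedD:
  assumes "(F, xs) \<in> decorated_forests X"
  shows "F \<noteq> []" "length xs = forest_leaves F - 1" "set xs \<subseteq> X"
  using assms by (auto simp: decorated_forests_def)

lemma Sh_assoc_basis:
  assumes "a \<in> decorated_forests X" "b \<in> decorated_forests X" "d \<in> decorated_forests X"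
  shows "(basis_elt K a \<otimes>\<^bsub>Sh\<^esub> basis_elt K b) \<otimes>\<^bsub>Sh\<^esub> basis_elt K d =
    basis_elt K a \<otimes>\<^bsub>Sh\<^esub> (basis_elt K b \<otimes>\<^bsub>Sh\<^esub> basis_elt K d)"
proof -
  obtain F xs G ys H zs where e: "a = (F, xs)" "b = (G, ys)" "d = (H, zs)"
    by (meson surj_pair)
  then have ne: "F \<noteq> []" "G \<noteq> []" "H \<noteq> []" using assms decoratedD(1) by auto
  show ?thesis
    unfolding e tag_basis[symmetric] using ne by (simp add: tag_mult forest_assoc)
qed

lemma Sh_rota_baxter_basis:
  assumes "a \<in> decorated_forests X" "b \<in> decorated_forests X"
  shows "rb_op Sh (basis_elt K a) \<otimes>\<^bsub>Sh\<^esub> rb_op Sh (basis_elt K b) =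
    rb_op Sh (rb_op Sh (basis_elt K a) \<otimes>\<^bsub>Sh\<^esub> basis_elt K b \<oplus>\<^bsub>Sh\<^esub> basis_elt K a \<otimes>\<^bsub>Sh\<^esub> rb_op Sh (basis_elt K b)
      \<oplus>\<^bsub>Sh\<^esub> lam \<odot>\<^bsub>Sh\<^esub> (basis_elt K a \<otimes>\<^bsub>Sh\<^esub> basis_elt K b))"
proof -
  obtain F xs G ys where e: "a = (F, xs)" "b = (G, ys)" by (meson surj_pair)
  then have ne: "F \<noteq> []" "G \<noteq> []" using assms decoratedD(1) by auto
  show ?thesis
    unfolding e tag_basis[symmetric] using ne
    by (simp add: tag_mult tag_op tag_add[symmetric] tag_smult[symmetric] forest_rota_baxter)
qed

theorem Sh_nonunitary: "nonunitary_rb_algebra K Sh lam"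
  by (rule Sh.nonunitary_rb_algebraI[OF lam_closed])
     (rule Sh.mult_assoc_from_basis[OF Sh_assoc_basis] Sh.rota_baxter_from_basis[OF lam_closed Sh_rota_baxter_basis]; assumption)+

theorem Sh0_nonunitary: "nonunitary_rb_algebra K Sh0 lam"
proof (rule Sh0.nonunitary_rb_algebraI[OF lam_closed])
  show "(x \<otimes>\<^bsub>Sh0\<^esub> y) \<otimes>\<^bsub>Sh0\<^esub> z = x \<otimes>\<^bsub>Sh0\<^esub> (y \<otimes>\<^bsub>Sh0\<^esub> z)"
    if "x \<in> carrier Sh0" "y \<in> carrier Sh0" "z \<in> carrier Sh0" for x y z
    by (rule Sh0.mult_assoc_from_basis[OF _ that]) (use Sh_assoc_basis in \<open>auto simp: Sh0_ops\<close>)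
  show "rb_op Sh0 x \<otimes>\<^bsub>Sh0\<^esub> rb_op Sh0 y = rb_op Sh0 (rb_op Sh0 x \<otimes>\<^bsub>Sh0\<^esub> y \<oplus>\<^bsub>Sh0\<^esub> x \<otimes>\<^bsub>Sh0\<^esub> rb_op Sh0 y
      \<oplus>\<^bsub>Sh0\<^esub> lam \<odot>\<^bsub>Sh0\<^esub> (x \<otimes>\<^bsub>Sh0\<^esub> y))"
    if "x \<in> carrier Sh0" "y \<in> carrier Sh0" for x y
    by (rule Sh0.rota_baxter_from_basis[OF lam_closed _ that])
       (use Sh_rota_baxter_basis in \<open>auto simp: Sh0_ops\<close>)
qed

lemma Sh_one: "\<one>\<^bsub>Sh\<^esub> = tag K [] \<one>\<^bsub>FA\<^esub>"
  by (simp add: sh_nc_def forest_alg_def tag_basis)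

lemma Sh_one_closed: "\<one>\<^bsub>Sh\<^esub> \<in> carrier Sh"
  unfolding Sh.carrier_eq by (simp add: sh_nc_def decorated_forests_def)

theorem Sh_unitary: "unitary_rb_algebra K Sh lam"
proof -
  interpret N: nonunitary_rb_algebra K Sh lam by (rule Sh_nonunitary)
  have basis: "\<one>\<^bsub>Sh\<^esub> \<otimes>\<^bsub>Sh\<^esub> basis_elt K b = basis_elt K b" "basis_elt K b \<otimes>\<^bsub>Sh\<^esub> \<one>\<^bsub>Sh\<^esub> = basis_elt K b"
    if "b \<in> decorated_forests X" for b
  proof -
    obtain F xs where e: "b = (F, xs)" by (meson surj_pair)
    then have "F \<noteq> []" using that decoratedD(1) by auto
    then show "\<one>\<^bsub>Sh\<^esub> \<otimes>\<^bsub>Sh\<^esub> basis_elt K b = basis_elt K b" "basis_elt K b \<otimes>\<^bsub>Sh\<^esub> \<one>\<^bsub>Sh\<^esub> = basis_elt K b"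
      unfolding e Sh_one tag_basis[symmetric] by (simp_all add: tag_mult forest_one_mult)
  qed
  have unit: "\<one>\<^bsub>Sh\<^esub> \<otimes>\<^bsub>Sh\<^esub> x = x" "x \<otimes>\<^bsub>Sh\<^esub> \<one>\<^bsub>Sh\<^esub> = x" if "x \<in> carrier Sh" for x
    using that by (induction rule: Sh.carrier_induct)
      (simp_all add: basis Sh_one_closed N.mult_l_distr N.mult_r_distr N.mult_smult_l N.mult_smult_r)
  show ?thesis
    by (intro unitary_rb_algebra.intro Sh_nonunitary ringI module.axioms(2)[OF Sh.module_axioms] monoidI)
       (auto simp: Sh_one_closed unit N.mult_closed N.mult_assoc N.mult_l_distr N.mult_r_distr)
qed

lemma generator_in:
  assumes "x \<in> X"
  shows "sh_gen K x \<in> carrier Sh0" "sh_gen K x \<in> carrier Sh"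
proof -
  show "sh_gen K x \<in> carrier Sh0"
    unfolding sh_gen_def using assms
    by (intro Sh0.basis_closed) (simp add: decorated_forests_def forests0_eq)
  then show "sh_gen K x \<in> carrier Sh" using Sh0_subset by blast
qed

text \<open>
  A single tree other than \<open>\<bullet>\<close> is the operator applied to a smaller forest.  If \<open>F = T \<squnion> G\<close>, then \<open>F\<close>
  is the product of \<open>T\<close>, \<open>\<bullet> \<squnion> \<bullet>\<close> and \<open>G\<close>, because \<open>\<bullet>\<close> is the unit; the first decoration after those
  of \<open>T\<close> belongs to the generator in the middle.  A factor \<open>T\<close> or \<open>G\<close> equal to \<open>\<bullet>\<close> is left out, as it
  need not be available.  The forests arising from one in \<open>forests0\<close> are again in it.
\<close>

lemma basis_in_generated:
  assumes gen: "\<And>x. x \<in> X \<Longrightarrow> sh_gen K x \<in> E"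
    and mult: "\<And>a b. a \<in> E \<Longrightarrow> b \<in> E \<Longrightarrow> a \<otimes>\<^bsub>Sh\<^esub> b \<in> E"
    and op: "\<And>a. a \<in> E \<Longrightarrow> rb_op Sh a \<in> E"
    and "(F, xs) \<in> decorated_forests X" and "F \<in> forests0 \<or> \<one>\<^bsub>Sh\<^esub> \<in> E"
  shows "basis_elt K (F, xs) \<in> E"
  using assms(4,5)
proof (induction "size_list size F" arbitrary: F xs rule: less_induct)
  case less
  note F = decoratedD[OF less.prems(1)]
  obtain T Ts where T: "F = T # Ts" using F(1) by (cases F) auto
  show ?case
  proof (cases "Ts = []")
    case True
    obtain G where G: "T = Node G" by (cases T)
    show ?thesis
    proof (cases "G = []")
      case True
      then have "F \<notin> forests0" "xs = []" using T \<open>Ts = []\<close> G F by (auto simp: forests0_eq)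
      then show ?thesis using less.prems(2) T \<open>Ts = []\<close> G \<open>G = []\<close> by (simp add: sh_nc_def)
    next
      case False
      have "basis_elt K (G, xs) \<in> E"
        using False less.prems T \<open>Ts = []\<close> G
        by (intro less.hyps) (auto simp: decorated_forests_def forests0_eq)
      moreover have "rb_op Sh (basis_elt K (G, xs)) = basis_elt K (F, xs)"
        unfolding tag_basis[symmetric] using False T \<open>Ts = []\<close> G by (simp add: tag_op FA.op_basis)
      ultimately show ?thesis using op by metis
    qed
  next
    case False
    \<comment> \<open>The decorations of \<open>T\<close>, the one between \<open>T\<close> and the rest, and those of the rest.\<close>
    define ts where "ts = take (leaves T - 1) xs"
    define x where "x = xs ! (leaves T - 1)"
    define ys where "ys = drop (leaves T) xs"
    have pos: "leaves T > 0" "forest_leaves Ts > 0" using leaves_pos forest_leaves_pos False by auto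
    have len: "length xs = leaves T + forest_leaves Ts - 1" using F(2) T by simp
    then have lt: "leaves T - 1 < length xs" using pos by linarith
    have xs: "xs = ts @ x # ys"
      using id_take_nth_drop[OF lt] pos by (simp add: ts_def x_def ys_def)
    have lens: "length ts = leaves T - 1" "length ys = forest_leaves Ts - 1"
      using len pos by (auto simp: ts_def ys_def)
    have X: "x \<in> X" "set ts \<subseteq> X" "set ys \<subseteq> X" using F(3) xs by auto
    have allowed: "(\<forall>U\<in>set F. ladder_free U) \<or> \<one>\<^bsub>Sh\<^esub> \<in> E"
      using less.prems(2) by (auto simp: forests0_def)
    have right: "basis_elt K (bullet # Ts, x # ys) \<in> E"
    proof (cases "Ts = [bullet]")
      case True
      then show ?thesis using gen[OF X(1)] lens by (simp add: sh_gen_def)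
    next
      case neq: False
      have "basis_elt K (Ts, ys) \<in> E"
        using less.hyps[of Ts ys] T False neq lens X allowed
        by (auto simp: decorated_forests_def forests0_def)
      moreover have "sh_gen K x \<otimes>\<^bsub>Sh\<^esub> basis_elt K (Ts, ys) = basis_elt K (bullet # Ts, x # ys)"
      proof -
        have "basis_elt K [bullet, bullet] \<otimes>\<^bsub>FA\<^esub> basis_elt K Ts =
            cat K (basis_elt K [bullet]) \<one>\<^bsub>FA\<^esub> \<otimes>\<^bsub>FA\<^esub> basis_elt K Ts"
          by (simp add: forest_alg_def cat_basis)
        also have "\<dots> = basis_elt K (bullet # Ts)"
          using False by (simp add: mult_cat_left forest_one_mult cat_basis)
        finally show ?thesis
          unfolding sh_gen_def tag_basis[symmetric] using False by (simp add: tag_mult)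
      qed
      ultimately show ?thesis using mult gen[OF X(1)] by metis
    qed
    show ?thesis
    proof (cases "T = bullet")
      case True
      then show ?thesis using right lens xs T by simp
    next
      case neq: False
      have "basis_elt K ([T], ts) \<in> E"
        using less.hyps[of "[T]" ts] T neq False lens X allowed
        by (cases Ts) (auto simp: decorated_forests_def forests0_def)
      moreover have "basis_elt K ([T], ts) \<otimes>\<^bsub>Sh\<^esub> basis_elt K (bullet # Ts, x # ys) = basis_elt K (F, xs)"
      proof -
        have "basis_elt K [T] \<otimes>\<^bsub>FA\<^esub> basis_elt K (bullet # Ts) =
            basis_elt K [T] \<otimes>\<^bsub>FA\<^esub> cat K \<one>\<^bsub>FA\<^esub> (basis_elt K Ts)"
          by (simp add: forest_alg_def cat_basis)
        also have "\<dots> = basis_elt K F"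
          by (simp add: mult_cat_right forest_one_mult cat_basis T)
        finally show ?thesis
          unfolding tag_basis[symmetric] by (simp add: tag_mult xs)
      qed
      ultimately show ?thesis using mult right by metis
    qed
  qed
qed

end

section \<open>Evaluation of decorated forests\<close>

text \<open>
  The trees \<open>T\<^sub>1, \<dots>, T\<^sub>b\<close> of a forest are separated by decorations.  The list given to \<open>ev_forest\<close> has
  one further element in front of \<open>T\<^sub>1\<close>, so that each tree comes with an element on its left and the
  recursion is uniform; the value of a decorated forest is obtained with \<open>\<one>\<close> in this place.  Here
  the decorations are already elements of the target, \<open>\<bullet>\<close> is evaluated to \<open>\<one>\<close> and a bracket to
  the operator.
\<close>

fun ev_tree :: "('k, 'r, 'n) rb_alg_scheme \<Rightarrow> ptree \<Rightarrow> 'r list \<Rightarrow> 'r"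
  and ev_forest :: "('k, 'r, 'n) rb_alg_scheme \<Rightarrow> ptree list \<Rightarrow> 'r list \<Rightarrow> 'r" where
  "ev_tree R (Node F) ys = (if F = [] then \<one>\<^bsub>R\<^esub> else rb_op R (ev_forest R F (\<one>\<^bsub>R\<^esub> # ys)))"
| "ev_forest R [] ys = \<one>\<^bsub>R\<^esub>"
| "ev_forest R (T # F) ys = hd ys \<otimes>\<^bsub>R\<^esub>
     (ev_tree R T (take (leaves T - 1) (tl ys)) \<otimes>\<^bsub>R\<^esub> ev_forest R F (drop (leaves T - 1) (tl ys)))"

text \<open>
  The target of an evaluation: a unital algebra with a linear operator into an ideal \<open>I\<close>, satisfying
  the Rota--Baxter identity on \<open>I\<close>.  A unitary Rota--Baxter algebra is the case where \<open>I\<close> is everything.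
  A nonunitary one appears as the ideal \<open>I\<close> of an algebra to which a unit has been adjoined, with no
  claim that the operator of the larger algebra satisfies the identity there.
\<close>

locale evaluation = operated_module K R
  for K :: "('k, 'm) ring_scheme" (structure) and R :: "('k, 'r, 'n) rb_alg_scheme" (structure) +
  fixes lam :: 'k and I :: "'r set"
  assumes weight_closed: "lam \<in> carrier K"
    and mult_assoc: "\<lbrakk>x \<in> carrier R; y \<in> carrier R; z \<in> carrier R\<rbrakk> \<Longrightarrow>
      (x \<otimes>\<^bsub>R\<^esub> y) \<otimes>\<^bsub>R\<^esub> z = x \<otimes>\<^bsub>R\<^esub> (y \<otimes>\<^bsub>R\<^esub> z)"
    and unit_closed [simp]: "\<one>\<^bsub>R\<^esub> \<in> carrier R"
    and unit [simp]: "x \<in> carrier R \<Longrightarrow> \<one>\<^bsub>R\<^esub> \<otimes>\<^bsub>R\<^esub> x = x" "x \<in> carrier R \<Longrightarrow> x \<otimes>\<^bsub>R\<^esub> \<one>\<^bsub>R\<^esub> = x"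
    and I_subset: "I \<subseteq> carrier R"
    and I_mult: "\<lbrakk>x \<in> I; y \<in> carrier R\<rbrakk> \<Longrightarrow> x \<otimes>\<^bsub>R\<^esub> y \<in> I" "\<lbrakk>x \<in> carrier R; y \<in> I\<rbrakk> \<Longrightarrow> x \<otimes>\<^bsub>R\<^esub> y \<in> I"
    and I_op: "x \<in> carrier R \<Longrightarrow> rb_op R x \<in> I"
    and rota_baxter: "\<lbrakk>x \<in> I; y \<in> I\<rbrakk> \<Longrightarrow> rb_op R x \<otimes>\<^bsub>R\<^esub> rb_op R y =
        rb_op R (rb_op R x \<otimes>\<^bsub>R\<^esub> y \<oplus>\<^bsub>R\<^esub> x \<otimes>\<^bsub>R\<^esub> rb_op R y \<oplus>\<^bsub>R\<^esub> lam \<odot>\<^bsub>R\<^esub> (x \<otimes>\<^bsub>R\<^esub> y))"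
begin

sublocale forests K lam
  by unfold_locales (rule weight_closed)

lemma ev_forest_Cons:
  assumes "length ys = leaves T - 1"
  shows "ev_forest R (T # F) (y # ys @ zs) = y \<otimes>\<^bsub>R\<^esub> (ev_tree R T ys \<otimes>\<^bsub>R\<^esub> ev_forest R F zs)"
  using assms by simp

lemma decoration_Cons:
  assumes "length zs = forest_leaves (T # F)"
  obtains y ys zs' where "zs = y # ys @ zs'" "length ys = leaves T - 1" "length zs' = forest_leaves F"
proof -
  obtain y us where us: "zs = y # us" using assms leaves_pos[of T] by (cases zs) auto
  show thesis
    by (rule that[of y "take (leaves T - 1) us" "drop (leaves T - 1) us"])
       (use assms us leaves_pos[of T] in auto)
qed

lemma ev_closed:
  "set ys \<subseteq> carrier R \<Longrightarrow> length ys = leaves T - 1 \<Longrightarrow> ev_tree R T ys \<in> carrier R"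
proof (induction "size T" arbitrary: T ys rule: less_induct)
  case less
  obtain F where T: "T = Node F" by (cases T)
  have *: "ev_forest R G zs \<in> carrier R"
    if "set zs \<subseteq> carrier R" "length zs = forest_leaves G" "set G \<subseteq> set F" for G zs
    using that
  proof (induction G arbitrary: zs)
    case (Cons U G)
    obtain y us zs' where zs: "zs = y # us @ zs'" "length us = leaves U - 1" "length zs' = forest_leaves G"
      using decoration_Cons[OF Cons.prems(2)] .
    have "size U \<le> size_list size F" using Cons.prems(3) by (auto intro: size_list_estimation')
    then have "size U < size T" using T by simp
    then show ?case
      unfolding zs(1) ev_forest_Cons[OF zs(2)] using Cons less.hyps zs by (auto intro!: mult_closed)
  qed simp
  show ?case
    using T less.prems by (auto intro!: op_closed * simp: Suc_diff_Suc leaves_pos forest_leaves_pos)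
qed

lemma ev_forest_closed:
  "set zs \<subseteq> carrier R \<Longrightarrow> length zs = forest_leaves F \<Longrightarrow> ev_forest R F zs \<in> carrier R"
proof (induction F arbitrary: zs)
  case (Cons T F)
  obtain y ys zs' where zs: "zs = y # ys @ zs'" "length ys = leaves T - 1" "length zs' = forest_leaves F"
    using decoration_Cons[OF Cons.prems(2)] .
  have "y \<in> carrier R" "set ys \<subseteq> carrier R" "set zs' \<subseteq> carrier R" using Cons.prems(1) zs(1) by auto
  then show ?case
    unfolding zs(1) ev_forest_Cons[OF zs(2)] using Cons.IH zs(2,3) ev_closed[of ys T] by simp
qed simp

lemma ev_forest_append:
  assumes "length zs = forest_leaves F" "length zs' = forest_leaves G"
    and "set zs \<subseteq> carrier R" "set zs' \<subseteq> carrier R"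
  shows "ev_forest R (F @ G) (zs @ zs') = ev_forest R F zs \<otimes>\<^bsub>R\<^esub> ev_forest R G zs'"
  using assms(1,3)
proof (induction F arbitrary: zs)
  case Nil
  then show ?case using ev_forest_closed[OF assms(4,2)] by simp
next
  case (Cons T F)
  obtain y ys zs1 where zs: "zs = y # ys @ zs1" "length ys = leaves T - 1" "length zs1 = forest_leaves F"
    using decoration_Cons[OF Cons.prems(1)] .
  have cl: "y \<in> carrier R" "ev_tree R T ys \<in> carrier R" "ev_forest R F zs1 \<in> carrier R"
      "ev_forest R G zs' \<in> carrier R"
    using Cons.prems zs assms ev_closed[of ys T] ev_forest_closed[of zs1 F] ev_forest_closed[of zs' G]
    by auto
  have "ev_forest R ((T # F) @ G) (zs @ zs') = y \<otimes>\<^bsub>R\<^esub> (ev_tree R T ys \<otimes>\<^bsub>R\<^esub> ev_forest R (F @ G) (zs1 @ zs'))"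
    using ev_forest_Cons[OF zs(2), of "F @ G" y "zs1 @ zs'"] zs(1) by simp
  also have "ev_forest R (F @ G) (zs1 @ zs') = ev_forest R F zs1 \<otimes>\<^bsub>R\<^esub> ev_forest R G zs'"
    using Cons zs by auto
  finally show ?case
    unfolding zs(1) ev_forest_Cons[OF zs(2)] using cl by (simp add: mult_assoc)
qed

lemma ev_forest_graft:
  assumes len: "length as = forest_leaves A" "length ts = leaves T - 1" "length cs = forest_leaves C"
    and cl: "set as \<subseteq> carrier R" "y \<in> carrier R" "set ts \<subseteq> carrier R" "set cs \<subseteq> carrier R"
  shows "ev_forest R (A @ [T] @ C) (as @ y # ts @ cs) =
    (ev_forest R A as \<otimes>\<^bsub>R\<^esub> y) \<otimes>\<^bsub>R\<^esub> (ev_tree R T ts \<otimes>\<^bsub>R\<^esub> ev_forest R C cs)"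
proof -
  have "ev_forest R (A @ T # C) (as @ y # ts @ cs) = ev_forest R A as \<otimes>\<^bsub>R\<^esub> ev_forest R (T # C) (y # ts @ cs)"
    by (rule ev_forest_append) (use len cl leaves_pos[of T] in auto)
  then show ?thesis
    using ev_forest_Cons[OF len(2)] cl len ev_closed[of ts T] ev_forest_closed[of as A] ev_forest_closed[of cs C]
    by (simp add: mult_assoc del: ev_forest.simps)
qed

lemma ev_forest_singleton:
  assumes "length ys = leaves T - 1" "set ys \<subseteq> carrier R"
  shows "ev_forest R [T] (\<one>\<^bsub>R\<^esub> # ys) = ev_tree R T ys"
  using ev_forest_Cons[OF assms(1), of "[]" "\<one>\<^bsub>R\<^esub>" "[]"] ev_closed[OF assms(2,1)]
  by (simp del: ev_forest.simps(2))

text \<open>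
  Forests whose value lies in \<open>I\<close>, together with the values of the contents of all their brackets:
  in a ladder-free forest these contents are again in \<open>forests0\<close>.
\<close>

definition evaluable :: "ptree list \<Rightarrow> bool" where
  "evaluable F \<longleftrightarrow> F \<noteq> [] \<and> (I = carrier R \<or> F \<in> forests0)"

text \<open>
  The value of a forest is a product of decorations, values of brackets and units.  It has a
  factor in the ideal as soon as there is a decoration or a bracket; only \<open>\<bullet>\<close> has neither.
\<close>

lemma ev_forest_in_I:
  assumes F: "evaluable F" and len: "length xs = forest_leaves F - 1" and xs: "set xs \<subseteq> I"
  shows "ev_forest R F (\<one>\<^bsub>R\<^esub> # xs) \<in> I"
proof (cases "I = carrier R")
  case True
  have "length (\<one>\<^bsub>R\<^esub> # xs) = forest_leaves F"
    using F len forest_leaves_pos[of F] by (simp add: evaluable_def)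
  moreover have "set (\<one>\<^bsub>R\<^esub> # xs) \<subseteq> carrier R" using xs I_subset by auto
  ultimately show ?thesis using ev_forest_closed True by metis
next
  case False
  then have F0: "F \<noteq> []" "F \<noteq> [bullet]" using F by (auto simp: evaluable_def forests0_eq)
  obtain T Ts where T: "F = T # Ts" using F0(1) by (cases F) auto
  have len': "length (\<one>\<^bsub>R\<^esub> # xs) = forest_leaves (T # Ts)" using len T leaves_pos[of T] by simp
  obtain ys zs where zs: "xs = ys @ zs" "length ys = leaves T - 1" "length zs = forest_leaves Ts"
    using decoration_Cons[OF len'] by (metis list.inject)
  have cl: "set ys \<subseteq> carrier R" "set zs \<subseteq> carrier R" using zs(1) xs I_subset by auto
  have T_cl: "ev_tree R T ys \<in> carrier R" by (rule ev_closed[OF cl(1) zs(2)])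
  show ?thesis
  proof (cases "Ts = []")
    case True
    obtain G where G: "T = Node G" by (cases T)
    have "G \<noteq> []" using True T G F0 by auto
    then have "ev_tree R T ys \<in> I"
      using G zs cl forest_leaves_pos[of G] by (auto intro!: I_op ev_forest_closed)
    then show ?thesis
      using ev_forest_singleton[OF zs(2) cl(1)] T True zs by simp
  next
    case False
    then obtain U Us where U: "Ts = U # Us" by (cases Ts) auto
    obtain y us zs' where us: "zs = y # us @ zs'" "length us = leaves U - 1" "length zs' = forest_leaves Us"
      using decoration_Cons[of zs U Us] zs(3) U by auto
    have "ev_forest R Ts zs \<in> I"
      unfolding U us(1) ev_forest_Cons[OF us(2)]
      using us zs(1) xs cl ev_closed[of us U] ev_forest_closed[of zs' Us]
      by (intro I_mult(1)) auto
    then show ?thesis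
      unfolding T zs(1) ev_forest_Cons[OF zs(2)] using T_cl by (auto intro!: I_mult)
  qed
qed

lemma mult_linear: "a \<in> carrier R \<Longrightarrow> b \<in> carrier R \<Longrightarrow> (\<lambda>x. a \<otimes>\<^bsub>R\<^esub> (x \<otimes>\<^bsub>R\<^esub> b)) \<in> linear_maps K R R"
  by (simp add: linear_maps_def mult_l_distr mult_r_distr mult_smult_l mult_smult_r)

lemma op_linear: "rb_op R \<in> linear_maps K R R"
  by (simp add: linear_maps_def op_add op_smult)

text \<open>
  The evaluation is multiplicative because the product of forests copies the identity that holds
  in the target: for two brackets the recursion and the Rota--Baxter identity in the target
  correspond term by term.  That identity is needed for the values of the contents of the two
  brackets, which lie in \<open>I\<close> under the stated condition.  For forests, the factors around the two
  trees that meet are constant and can be pulled out.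
\<close>

lemma ev_prod:
  "\<forall>ts ts'. length ts = leaves T - 1 \<longrightarrow> length ts' = leaves T' - 1 \<longrightarrow> set ts \<subseteq> I \<longrightarrow> set ts' \<subseteq> I \<longrightarrow>
     I = carrier R \<or> ladder_free T \<and> ladder_free T' \<longrightarrow>
     lin_comb K R (\<lambda>U. ev_tree R U (ts @ ts')) (tree_prod K lam T T') = ev_tree R T ts \<otimes>\<^bsub>R\<^esub> ev_tree R T' ts'"
  "F \<noteq> [] \<longrightarrow> F' \<noteq> [] \<longrightarrow> (\<forall>xs xs'. length xs = forest_leaves F - 1 \<longrightarrow> length xs' = forest_leaves F' - 1 \<longrightarrow>
     set xs \<subseteq> I \<longrightarrow> set xs' \<subseteq> I \<longrightarrow> I = carrier R \<or> ladder_free_forest F \<and> ladder_free_forest F' \<longrightarrow>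
     lin_comb K R (\<lambda>G. ev_forest R G (\<one>\<^bsub>R\<^esub> # xs @ xs')) (forest_prod K lam F F') =
       ev_forest R F (\<one>\<^bsub>R\<^esub> # xs) \<otimes>\<^bsub>R\<^esub> ev_forest R F' (\<one>\<^bsub>R\<^esub> # xs'))"
proof (induction T T' and F F' rule: prod_induct)
  case (bullet_left T)
  show ?case
  proof (intro allI impI)
    fix ts ts' assume *: "length ts = leaves bullet - 1" "length ts' = leaves T - 1" "set ts \<subseteq> I" "set ts' \<subseteq> I"
    then have "ev_tree R T ts' \<in> carrier R" using ev_closed I_subset by blast
    then show "lin_comb K R (\<lambda>U. ev_tree R U (ts @ ts')) (tree_prod K lam bullet T) =
        ev_tree R bullet ts \<otimes>\<^bsub>R\<^esub> ev_tree R T ts'"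
      unfolding tree_prod_bullet using * by (subst lin_comb_basis) simp_all
  qed
next
  case (bullet_right T)
  show ?case
  proof (intro allI impI)
    fix ts ts' assume *: "length ts = leaves T - 1" "length ts' = leaves bullet - 1" "set ts \<subseteq> I" "set ts' \<subseteq> I"
    then have "ev_tree R T ts \<in> carrier R" using ev_closed I_subset by blast
    then show "lin_comb K R (\<lambda>U. ev_tree R U (ts @ ts')) (tree_prod K lam T bullet) =
        ev_tree R T ts \<otimes>\<^bsub>R\<^esub> ev_tree R bullet ts'"
      unfolding tree_prod_bullet using * by (subst lin_comb_basis) simp_all
  qed
next
  case (Node F F')
  note F = Node.hyps(1,2)
  show ?case
  proof (intro allI impI)
    fix ts ts'
    assume len: "length ts = leaves (Node F) - 1" "length ts' = leaves (Node F') - 1"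
      and ts: "set ts \<subseteq> I" "set ts' \<subseteq> I"
      and ok: "I = carrier R \<or> ladder_free (Node F) \<and> ladder_free (Node F')"
    define x where "x = ev_forest R F (\<one>\<^bsub>R\<^esub> # ts)"
    define y where "y = ev_forest R F' (\<one>\<^bsub>R\<^esub> # ts')"
    let ?tree = "lin_comb K R (\<lambda>U. ev_tree R U (ts @ ts'))"
    let ?forest = "lin_comb K R (\<lambda>G. ev_forest R G (\<one>\<^bsub>R\<^esub> # ts @ ts'))"
    have cl: "set ts \<subseteq> carrier R" "set ts' \<subseteq> carrier R" using ts I_subset by auto
    have len': "length ts = forest_leaves F - 1" "length ts' = forest_leaves F' - 1" using len F by simp_all
    have "evaluable F" "evaluable F'" using ok F by (auto simp: evaluable_def forests0_eq)
    then have xy: "x \<in> I" "y \<in> I"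
      unfolding x_def y_def using len' ts by (blast intro: ev_forest_in_I)+
    then have xy_cl [simp]: "x \<in> carrier R" "y \<in> carrier R" using I_subset by auto
    have xy_tree: "ev_tree R (Node F) ts = rb_op R x" "ev_tree R (Node F') ts' = rb_op R y"
      using F by (simp_all add: x_def y_def)
    have IH: "?forest (forest_prod K lam [Node F] F') = rb_op R x \<otimes>\<^bsub>R\<^esub> y"
      "?forest (forest_prod K lam F [Node F']) = x \<otimes>\<^bsub>R\<^esub> rb_op R y"
      "?forest (forest_prod K lam F F') = x \<otimes>\<^bsub>R\<^esub> y"
      using Node.IH(1)[rule_format, of ts ts'] Node.IH(2)[rule_format, of ts ts'] Node.IH(3)[rule_format, of ts ts']
        F len len' ts ok cl ev_forest_singleton[of ts "Node F"] ev_forest_singleton[of ts' "Node F'"] xy_tree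
      by (auto simp: x_def y_def)
    let ?S = "{G. G \<noteq> [] \<and> forest_leaves G = length (\<one>\<^bsub>R\<^esub> # ts @ ts')}"
    have S: "forest_prod K lam [Node F] F' \<in> free_carrier K ?S" "forest_prod K lam F [Node F'] \<in> free_carrier K ?S"
      "forest_prod K lam F F' \<in> free_carrier K ?S"
      using forest_prod_closed[of "[Node F]" F'] forest_prod_closed[of F "[Node F']"] forest_prod_closed[of F F']
        F len' forest_leaves_pos[of F] forest_leaves_pos[of F']
      by (auto elim!: free_carrier_mono simp: forest_prod_range_def)
    have ev_cl: "ev_forest R G (\<one>\<^bsub>R\<^esub> # ts @ ts') \<in> carrier R" if "G \<in> ?S" for G
      using that cl by (intro ev_forest_closed) auto
    have bracket: "?tree (brackets K c) = rb_op R (?forest c)" if c: "c \<in> free_carrier K ?S" for c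
    proof -
      have "?tree (brackets K c) = lin_comb K R (\<lambda>G. ev_tree R (Node G) (ts @ ts')) c"
        unfolding brackets_def using c
        by (rule lin_comb_lin_ext) (use ev_cl in auto)
      also have "\<dots> = lin_comb K R (\<lambda>G. rb_op R (ev_forest R G (\<one>\<^bsub>R\<^esub> # ts @ ts'))) c"
        using c by (rule lin_comb_cong) (use ev_cl in auto)
      also have "\<dots> = rb_op R (?forest c)"
        using c ev_cl op_linear by (rule lin_comb_image)
      finally show ?thesis .
    qed
    have tree_linear: "?tree \<in> linear_maps K (free_module K {U. leaves U = length (\<one>\<^bsub>R\<^esub> # ts @ ts')}) R"
      by (rule lin_comb_linear) (use cl in \<open>auto intro!: ev_closed\<close>)
    have brS: "brackets K c \<in> carrier (free_module K {U. leaves U = length (\<one>\<^bsub>R\<^esub> # ts @ ts')})"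
      if c: "c \<in> free_carrier K ?S" for c
      unfolding brackets_def using c by (simp, intro lin_ext_closed[OF c]) auto
    have "?tree (tree_prod K lam (Node F) (Node F')) =
        rb_op R (rb_op R x \<otimes>\<^bsub>R\<^esub> y) \<oplus>\<^bsub>R\<^esub> rb_op R (x \<otimes>\<^bsub>R\<^esub> rb_op R y) \<oplus>\<^bsub>R\<^esub> lam \<odot>\<^bsub>R\<^esub> rb_op R (x \<otimes>\<^bsub>R\<^esub> y)"
      unfolding tree_prod_Node[OF F] IH[symmetric]
      using linear_mapsD(2,3)[OF tree_linear] brS S by (simp add: bracket)
    also have "\<dots> = rb_op R x \<otimes>\<^bsub>R\<^esub> rb_op R y"
      using rota_baxter[OF xy] by (simp add: op_add op_smult)
    finally show "?tree (tree_prod K lam (Node F) (Node F')) = ev_tree R (Node F) ts \<otimes>\<^bsub>R\<^esub> ev_tree R (Node F') ts'"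
      unfolding xy_tree .
  qed
next
  case (forest A T T' C)
  show ?case
  proof (intro impI allI)
    fix xs xs'
    assume len: "length xs = forest_leaves (A @ [T]) - 1" "length xs' = forest_leaves (T' # C) - 1"
      and xs: "set xs \<subseteq> I" "set xs' \<subseteq> I"
      and ok: "I = carrier R \<or> ladder_free_forest (A @ [T]) \<and> ladder_free_forest (T' # C)"
    \<comment> \<open>The decorations are cut at the two trees that meet: \<open>y\<close> stands in front of \<open>T\<close>, \<open>ts\<close> and \<open>ts'\<close> lie inside the trees.\<close>
    define as where "as = take (forest_leaves A) (\<one>\<^bsub>R\<^esub> # xs)"
    define y where "y = (\<one>\<^bsub>R\<^esub> # xs) ! forest_leaves A"
    define ts where "ts = drop (forest_leaves A) xs"
    define ts' where "ts' = take (leaves T' - 1) xs'"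
    define cs where "cs = drop (leaves T' - 1) xs'"
    have pos: "leaves T > 0" "leaves T' > 0" using leaves_pos by auto
    have lens: "length as = forest_leaves A" "length ts = leaves T - 1" "length ts' = leaves T' - 1"
        "length cs = forest_leaves C"
      using len pos by (auto simp: as_def ts_def ts'_def cs_def)
    have split: "\<one>\<^bsub>R\<^esub> # xs = as @ y # ts" "xs' = ts' @ cs"
      using id_take_nth_drop[of "forest_leaves A" "\<one>\<^bsub>R\<^esub> # xs"] len pos
      by (simp_all add: as_def y_def ts_def ts'_def cs_def)
    have ts_I: "set ts \<subseteq> I" "set ts' \<subseteq> I"
      using xs by (auto simp: ts_def ts'_def dest: in_set_dropD in_set_takeD)
    have "set (as @ y # ts) \<subseteq> carrier R" "set (ts' @ cs) \<subseteq> carrier R"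
      unfolding split[symmetric] using xs I_subset by auto
    then have cl: "set as \<subseteq> carrier R" "y \<in> carrier R" "set ts \<subseteq> carrier R" "set ts' \<subseteq> carrier R" "set cs \<subseteq> carrier R"
      by auto
    have ev_cl: "ev_forest R A as \<in> carrier R" "ev_forest R C cs \<in> carrier R"
        "ev_tree R T ts \<in> carrier R" "ev_tree R T' ts' \<in> carrier R"
      using cl lens by (auto intro!: ev_forest_closed ev_closed)
    let ?S = "{U. leaves U - 1 = length (ts @ ts')}"
    have S: "tree_prod K lam T T' \<in> free_carrier K ?S"
      using prods_closed(1) by (rule free_carrier_mono) (use lens pos in \<open>auto simp: tree_prod_range_def\<close>)
    have graft: "ev_forest R (A @ [U] @ C) (\<one>\<^bsub>R\<^esub> # xs @ xs') =
        (ev_forest R A as \<otimes>\<^bsub>R\<^esub> y) \<otimes>\<^bsub>R\<^esub> (ev_tree R U (ts @ ts') \<otimes>\<^bsub>R\<^esub> ev_forest R C cs)"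
      if "U \<in> ?S" for U
    proof -
      have "\<one>\<^bsub>R\<^esub> # xs @ xs' = (\<one>\<^bsub>R\<^esub> # xs) @ xs'" by simp
      also have "\<dots> = as @ y # (ts @ ts') @ cs" unfolding split by simp
      finally show ?thesis
        using ev_forest_graft[of as A "ts @ ts'" U cs C y] that lens cl by simp
    qed
    have tree_cl: "ev_tree R U (ts @ ts') \<in> carrier R" if "U \<in> ?S" for U
      using that cl by (intro ev_closed) auto
    have "lin_comb K R (\<lambda>G. ev_forest R G (\<one>\<^bsub>R\<^esub> # xs @ xs')) (forest_prod K lam (A @ [T]) (T' # C)) =
        lin_comb K R (\<lambda>U. ev_forest R (A @ [U] @ C) (\<one>\<^bsub>R\<^esub> # xs @ xs')) (tree_prod K lam T T')"
      unfolding forest_prod_eq using S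
      by (rule lin_comb_lin_ext) (use graft ev_cl tree_cl cl in \<open>auto intro!: mult_closed\<close>)
    also have "\<dots> = lin_comb K R (\<lambda>U. (ev_forest R A as \<otimes>\<^bsub>R\<^esub> y) \<otimes>\<^bsub>R\<^esub>
        (ev_tree R U (ts @ ts') \<otimes>\<^bsub>R\<^esub> ev_forest R C cs)) (tree_prod K lam T T')"
      using S graft by (rule lin_comb_cong) (use ev_cl tree_cl cl in \<open>auto intro!: mult_closed\<close>)
    also have "\<dots> = (ev_forest R A as \<otimes>\<^bsub>R\<^esub> y) \<otimes>\<^bsub>R\<^esub>
        (lin_comb K R (\<lambda>U. ev_tree R U (ts @ ts')) (tree_prod K lam T T') \<otimes>\<^bsub>R\<^esub> ev_forest R C cs)"
      using S tree_cl by (rule lin_comb_image) (use ev_cl cl in \<open>auto intro!: mult_linear mult_closed\<close>)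
    also have "lin_comb K R (\<lambda>U. ev_tree R U (ts @ ts')) (tree_prod K lam T T') = ev_tree R T ts \<otimes>\<^bsub>R\<^esub> ev_tree R T' ts'"
      using forest.IH lens ts_I ok by auto
    also have "(ev_forest R A as \<otimes>\<^bsub>R\<^esub> y) \<otimes>\<^bsub>R\<^esub> ((ev_tree R T ts \<otimes>\<^bsub>R\<^esub> ev_tree R T' ts') \<otimes>\<^bsub>R\<^esub> ev_forest R C cs) =
        ((ev_forest R A as \<otimes>\<^bsub>R\<^esub> y) \<otimes>\<^bsub>R\<^esub> ev_tree R T ts) \<otimes>\<^bsub>R\<^esub> (ev_tree R T' ts' \<otimes>\<^bsub>R\<^esub> ev_forest R C cs)"
      using ev_cl cl by (simp add: mult_assoc)
    also have "(ev_forest R A as \<otimes>\<^bsub>R\<^esub> y) \<otimes>\<^bsub>R\<^esub> ev_tree R T ts = ev_forest R (A @ [T]) (\<one>\<^bsub>R\<^esub> # xs)"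
      using ev_forest_graft[of as A ts T "[]" "[]" y] lens cl split ev_cl by simp
    also have "ev_tree R T' ts' \<otimes>\<^bsub>R\<^esub> ev_forest R C cs = ev_forest R (T' # C) (\<one>\<^bsub>R\<^esub> # xs')"
      unfolding split(2) ev_forest_Cons[OF lens(3)] using ev_cl by simp
    finally show "lin_comb K R (\<lambda>G. ev_forest R G (\<one>\<^bsub>R\<^esub> # xs @ xs')) (forest_prod K lam (A @ [T]) (T' # C)) =
      ev_forest R (A @ [T]) (\<one>\<^bsub>R\<^esub> # xs) \<otimes>\<^bsub>R\<^esub> ev_forest R (T' # C) (\<one>\<^bsub>R\<^esub> # xs')" .
  qed
qed

definition ev_lin :: "('x \<Rightarrow> 'r) \<Rightarrow> ('x decorated \<Rightarrow> 'k) \<Rightarrow> 'r" where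
  "ev_lin \<iota> = lin_comb K R (\<lambda>(F, xs). ev_forest R F (\<one>\<^bsub>R\<^esub> # map \<iota> xs))"

end

text \<open>
  One set of arguments for both free algebras: \<open>A\<close> is spanned by a set \<open>S\<close> of decorated forests
  that all evaluate into \<open>I\<close>.
\<close>

locale decorated_evaluation = evaluation K R lam I + A: free_operated K A S "decorated_prod K lam" "decorated_op K"
  for K :: "('k, 'm) ring_scheme" (structure) and R :: "('k, 'r, 'n) rb_alg_scheme" (structure)
    and lam :: 'k and I :: "'r set" and A :: "('k, 'x decorated \<Rightarrow> 'k) rb_alg" and S :: "'x decorated set" +
  fixes X :: "'x set" and \<iota> :: "'x \<Rightarrow> 'r"
  assumes S_evaluable: "S \<subseteq> decorated_forests X" "\<And>F xs. (F, xs) \<in> S \<Longrightarrow> evaluable F"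
    and letters_in_I: "\<And>x. x \<in> X \<Longrightarrow> \<iota> x \<in> I"
begin

lemma basisD:
  assumes "(F, xs) \<in> S"
  shows "F \<noteq> []" "length (map \<iota> xs) = forest_leaves F - 1" "set (map \<iota> xs) \<subseteq> I" "evaluable F"
  using assms S_evaluable letters_in_I by (fastforce simp: decorated_forests_def)+

lemma ev_basis_in_I: "(F, xs) \<in> S \<Longrightarrow> ev_forest R F (\<one>\<^bsub>R\<^esub> # map \<iota> xs) \<in> I"
  using basisD by (intro ev_forest_in_I)

lemma ev_lin_linear: "ev_lin \<iota> \<in> linear_maps K (free_module K S) R"
  unfolding ev_lin_def using ev_basis_in_I I_subset by (intro lin_comb_linear) auto

lemma ev_lin_simps [simp]:
  "c \<in> carrier A \<Longrightarrow> ev_lin \<iota> c \<in> carrier R"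
  "c \<in> carrier A \<Longrightarrow> d \<in> carrier A \<Longrightarrow> ev_lin \<iota> (c \<oplus>\<^bsub>A\<^esub> d) = ev_lin \<iota> c \<oplus>\<^bsub>R\<^esub> ev_lin \<iota> d"
  "r \<in> carrier K \<Longrightarrow> c \<in> carrier A \<Longrightarrow> ev_lin \<iota> (r \<odot>\<^bsub>A\<^esub> c) = r \<odot>\<^bsub>R\<^esub> ev_lin \<iota> c"
  using linear_mapsD[OF ev_lin_linear] by (auto simp: A.carrier_eq A.add_eq A.smult_eq)

lemma ev_lin_zero [simp]: "ev_lin \<iota> \<zero>\<^bsub>A\<^esub> = \<zero>\<^bsub>R\<^esub>"
  by (simp add: A.zero_eq ev_lin_def lin_comb_def supp_def)

lemma ev_lin_basis: "(F, xs) \<in> S \<Longrightarrow> ev_lin \<iota> (basis_elt K (F, xs)) = ev_forest R F (\<one>\<^bsub>R\<^esub> # map \<iota> xs)"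
  unfolding ev_lin_def using ev_basis_in_I I_subset by (subst lin_comb_basis) auto

lemma ev_lin_in_I:
  assumes "submodule I K R" "c \<in> carrier A"
  shows "ev_lin \<iota> c \<in> I"
proof -
  interpret I: submodule I K R by fact
  from assms(2) show ?thesis
  proof (induction rule: A.carrier_induct)
    case zero
    show ?case using I.one_closed by simp
  next
    case (basis b)
    then show ?case using ev_basis_in_I by (cases b) (simp add: ev_lin_basis)
  next
    case (add c d)
    then show ?case using I.m_closed by simp
  next
    case (smult r c)
    then show ?case using I.smult_closed by simp
  qed
qed

lemma ev_lin_op:
  assumes "c \<in> carrier A"
  shows "ev_lin \<iota> (rb_op A c) = rb_op R (ev_lin \<iota> c)"
  using assms
proof (induction rule: A.carrier_induct)
  case (basis b)
  obtain F xs where b: "b = (F, xs)" by (cases b)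
  note D = basisD[OF basis[unfolded b]]
  have "ev_lin \<iota> (basis_elt K ([Node F], xs)) = ev_forest R [Node F] (\<one>\<^bsub>R\<^esub> # map \<iota> xs)"
    unfolding ev_lin_def using D I_subset forest_leaves_pos[OF D(1)]
    by (subst lin_comb_basis) (auto simp del: ev_forest.simps simp: image_subset_iff subset_iff intro!: ev_forest_closed)
  also have "\<dots> = ev_tree R (Node F) (map \<iota> xs)"
    using D I_subset by (intro ev_forest_singleton) auto
  also have "\<dots> = rb_op R (ev_lin \<iota> (basis_elt K (F, xs)))"
    using D(1) basis b by (simp add: ev_lin_basis)
  finally show ?case using basis b by (simp add: A.op_basis)
qed (simp_all add: op_add op_smult A.op_add A.op_smult)

lemma ev_lin_mult_basis:
  assumes "(F, xs) \<in> S" "(G, ys) \<in> S"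
  shows "ev_lin \<iota> (basis_elt K (F, xs) \<otimes>\<^bsub>A\<^esub> basis_elt K (G, ys)) =
    ev_lin \<iota> (basis_elt K (F, xs)) \<otimes>\<^bsub>R\<^esub> ev_lin \<iota> (basis_elt K (G, ys))"
proof -
  note F = basisD[OF assms(1)] and G = basisD[OF assms(2)]
  let ?S = "{H. forest_leaves H = length (\<one>\<^bsub>R\<^esub> # map \<iota> xs @ map \<iota> ys)}"
  have "forest_prod K lam F G \<in> free_carrier K (forest_prod_range F G)"
    using F G by (intro forest_prod_closed)
  then have prod: "forest_prod K lam F G \<in> free_carrier K ?S"
    by (rule free_carrier_mono)
       (use F G forest_leaves_pos[of F] forest_leaves_pos[of G] in \<open>auto simp: forest_prod_range_def\<close>)
  have cl: "set (\<one>\<^bsub>R\<^esub> # map \<iota> xs @ map \<iota> ys) \<subseteq> carrier R" using F G I_subset by auto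
  have "ev_lin \<iota> (basis_elt K (F, xs) \<otimes>\<^bsub>A\<^esub> basis_elt K (G, ys)) =
      lin_comb K R (\<lambda>H. ev_forest R H (\<one>\<^bsub>R\<^esub> # map \<iota> xs @ map \<iota> ys)) (forest_prod K lam F G)"
    unfolding A.mult_basis[OF assms] prod.case ev_lin_def
    by (subst lin_comb_lin_ext[OF prod]) (use cl in \<open>auto simp: image_subset_iff intro!: ev_forest_closed\<close>)
  also have "\<dots> = ev_forest R F (\<one>\<^bsub>R\<^esub> # map \<iota> xs) \<otimes>\<^bsub>R\<^esub> ev_forest R G (\<one>\<^bsub>R\<^esub> # map \<iota> ys)"
    using F G by (intro ev_prod(2)[rule_format]) (auto simp: evaluable_def forests0_eq)
  finally show ?thesis using assms by (simp add: ev_lin_basis)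
qed

lemma ev_lin_mult:
  assumes x: "x \<in> carrier A" and y: "y \<in> carrier A"
  shows "ev_lin \<iota> (x \<otimes>\<^bsub>A\<^esub> y) = ev_lin \<iota> x \<otimes>\<^bsub>R\<^esub> ev_lin \<iota> y"
proof -
  have 1: "ev_lin \<iota> (basis_elt K a \<otimes>\<^bsub>A\<^esub> y) = ev_lin \<iota> (basis_elt K a) \<otimes>\<^bsub>R\<^esub> ev_lin \<iota> y" if a: "a \<in> S" for a
    using y
  proof (induction rule: A.carrier_induct)
    case (basis b)
    then show ?case using a ev_lin_mult_basis by (cases a, cases b) auto
  qed (use a in \<open>simp_all add: A.mult_r_distr A.mult_smult_r mult_r_distr mult_smult_r\<close>)
  show ?thesis
    using x
  proof (induction rule: A.carrier_induct)
    case (basis a)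
    then show ?case by (rule 1)
  qed (use y in \<open>simp_all add: A.mult_l_distr A.mult_smult_l mult_l_distr mult_smult_l\<close>)
qed

lemma ev_lin_gen:
  assumes "x \<in> X" "([bullet, bullet], [x]) \<in> S"
  shows "ev_lin \<iota> (sh_gen K x) = \<iota> x"
proof -
  have "\<iota> x \<in> carrier R" using letters_in_I assms I_subset by auto
  then show ?thesis using assms by (simp add: sh_gen_def ev_lin_basis)
qed

end

section \<open>The Dorroh extension\<close>

text \<open>
  The algebra obtained from \<open>A\<close> by adjoining a unit, with \<open>A\<close> embedded as \<open>0 \<times> A\<close>.  The operator is
  extended by zero to the new unit.  This is not a Rota--Baxter operator in general, since the
  identity for a pair \<open>1, x\<close> would say \<open>0 = P (P x + \<lambda> x)\<close>; on the ideal \<open>0 \<times> A\<close> it is that of \<open>A\<close>.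
\<close>

definition dorroh :: "('k, 'm) ring_scheme \<Rightarrow> ('k, 'a) rb_alg \<Rightarrow> ('k, 'k \<times> 'a) rb_alg" where
  "dorroh K A = \<lparr>carrier = carrier K \<times> carrier A,
     mult = (\<lambda>(r, a) (s, b). (r \<otimes>\<^bsub>K\<^esub> s, r \<odot>\<^bsub>A\<^esub> b \<oplus>\<^bsub>A\<^esub> s \<odot>\<^bsub>A\<^esub> a \<oplus>\<^bsub>A\<^esub> a \<otimes>\<^bsub>A\<^esub> b)),
     one = (\<one>\<^bsub>K\<^esub>, \<zero>\<^bsub>A\<^esub>), zero = (\<zero>\<^bsub>K\<^esub>, \<zero>\<^bsub>A\<^esub>),
     add = (\<lambda>(r, a) (s, b). (r \<oplus>\<^bsub>K\<^esub> s, a \<oplus>\<^bsub>A\<^esub> b)),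
     smult = (\<lambda>t (r, a). (t \<otimes>\<^bsub>K\<^esub> r, t \<odot>\<^bsub>A\<^esub> a)),
     rb_op = (\<lambda>(r, a). (\<zero>\<^bsub>K\<^esub>, rb_op A a))\<rparr>"

context nonunitary_rb_algebra
begin

lemma operated_module: "operated_module K A"
  by unfold_locales
     (simp_all add: mult_closed mult_l_distr mult_r_distr mult_smult_l mult_smult_r op_closed op_add op_smult)

end

lemma dorroh_module:
  assumes "nonunitary_rb_algebra K A lam"
  shows "module K (dorroh K A)"
proof -
  interpret nonunitary_rb_algebra K A lam by fact
  show ?thesis
  proof (intro moduleI abelian_groupI R.is_cring)
    fix x assume "x \<in> carrier (dorroh K A)"
    then obtain r a where x: "x = (r, a)" "r \<in> carrier K" "a \<in> carrier A" by (auto simp: dorroh_def)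
    then show "\<exists>y\<in>carrier (dorroh K A). y \<oplus>\<^bsub>dorroh K A\<^esub> x = \<zero>\<^bsub>dorroh K A\<^esub>"
      by (intro bexI[of _ "(\<ominus>\<^bsub>K\<^esub> r, \<ominus>\<^bsub>A\<^esub> a)"]) (auto simp: dorroh_def R.l_neg M.l_neg)
  qed (auto simp: dorroh_def R.a_ac M.a_ac R.m_assoc R.l_distr R.r_distr
      smult_l_distr smult_r_distr smult_assoc1)
qed

lemma dorroh_evaluation:
  assumes "nonunitary_rb_algebra K A lam"
  shows "evaluation K (dorroh K A) lam ({\<zero>\<^bsub>K\<^esub>} \<times> carrier A)"
proof -
  interpret nonunitary_rb_algebra K A lam by fact
  interpret D: module K "dorroh K A" by (rule dorroh_module) fact
  interpret O: operated_module K A by (rule operated_module)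
  have swap: "r \<odot>\<^bsub>A\<^esub> (s \<odot>\<^bsub>A\<^esub> x) = s \<odot>\<^bsub>A\<^esub> (r \<odot>\<^bsub>A\<^esub> x)"
    if "r \<in> carrier K" "s \<in> carrier K" "x \<in> carrier A" for r s x
    using that by (simp add: R.m_comm flip: smult_assoc1)
  show ?thesis
    by unfold_locales
       (auto simp: dorroh_def weight_closed mult_closed mult_l_distr mult_r_distr mult_smult_l mult_smult_r
         op_closed op_add op_smult rota_baxter mult_assoc R.m_assoc R.l_distr R.r_distr R.m_comm R.m_lcomm
         smult_l_distr smult_r_distr smult_assoc1 swap M.a_ac)
qed

lemma dorroh_submodule:
  assumes "nonunitary_rb_algebra K A lam"
  shows "submodule ({\<zero>\<^bsub>K\<^esub>} \<times> carrier A) K (dorroh K A)"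
proof -
  interpret nonunitary_rb_algebra K A lam by fact
  interpret D: module K "dorroh K A" by (rule dorroh_module) fact
  have "\<ominus>\<^bsub>dorroh K A\<^esub> (\<zero>\<^bsub>K\<^esub>, a) = (\<zero>\<^bsub>K\<^esub>, \<ominus>\<^bsub>A\<^esub> a)" if "a \<in> carrier A" for a
    by (rule D.minus_equality) (use that in \<open>auto simp: dorroh_def M.l_neg\<close>)
  then show ?thesis
    by (intro D.submoduleI) (auto simp: dorroh_def)
qed

section \<open>Homomorphisms and quotients of Rota--Baxter algebras\<close>

lemma rb_homD:
  assumes "h \<in> rb_hom K A B"
  shows "x \<in> carrier A \<Longrightarrow> h x \<in> carrier B"
    and "x \<in> carrier A \<Longrightarrow> y \<in> carrier A \<Longrightarrow> h (x \<oplus>\<^bsub>A\<^esub> y) = h x \<oplus>\<^bsub>B\<^esub> h y"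
    and "r \<in> carrier K \<Longrightarrow> x \<in> carrier A \<Longrightarrow> h (r \<odot>\<^bsub>A\<^esub> x) = r \<odot>\<^bsub>B\<^esub> h x"
    and "x \<in> carrier A \<Longrightarrow> y \<in> carrier A \<Longrightarrow> h (x \<otimes>\<^bsub>A\<^esub> y) = h x \<otimes>\<^bsub>B\<^esub> h y"
    and "x \<in> carrier A \<Longrightarrow> h (rb_op A x) = rb_op B (h x)"
    and "h \<in> extensional (carrier A)"
  using assms unfolding rb_hom_def by (auto simp: PiE_iff)

lemma rb_homI:
  assumes "\<And>x. x \<in> carrier A \<Longrightarrow> h x \<in> carrier B"
    and "\<And>x y. x \<in> carrier A \<Longrightarrow> y \<in> carrier A \<Longrightarrow> h (x \<oplus>\<^bsub>A\<^esub> y) = h x \<oplus>\<^bsub>B\<^esub> h y"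
    and "\<And>r x. r \<in> carrier K \<Longrightarrow> x \<in> carrier A \<Longrightarrow> h (r \<odot>\<^bsub>A\<^esub> x) = r \<odot>\<^bsub>B\<^esub> h x"
    and "\<And>x y. x \<in> carrier A \<Longrightarrow> y \<in> carrier A \<Longrightarrow> h (x \<otimes>\<^bsub>A\<^esub> y) = h x \<otimes>\<^bsub>B\<^esub> h y"
    and "\<And>x. x \<in> carrier A \<Longrightarrow> h (rb_op A x) = rb_op B (h x)"
    and "h \<in> extensional (carrier A)"
  shows "h \<in> rb_hom K A B"
  using assms unfolding rb_hom_def by (simp add: PiE_iff)

lemma rb_hom_linear: "h \<in> rb_hom K A B \<Longrightarrow> h \<in> linear_maps K A B"
  using rb_homD[of h K A B] unfolding linear_maps_def by (simp add: Pi_iff)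

lemma rb_hom_eqI:
  assumes "h \<in> rb_hom K A B" "h' \<in> rb_hom K A B" "\<And>x. x \<in> carrier A \<Longrightarrow> h x = h' x"
  shows "h = h'"
  by (rule extensionalityI) (use assms rb_homD(6) in blast)+

context nonunitary_rb_algebra
begin

lemma submodule_of_zero_fibre:
  assumes "module K N" "h \<in> linear_maps K A N"
  shows "submodule {x \<in> carrier A. h x = \<zero>\<^bsub>N\<^esub>} K A"
proof -
  interpret N: module K N by fact
  note h = linear_mapsD[OF assms(2)]
  have "h (\<ominus>\<^bsub>A\<^esub> x) = \<zero>\<^bsub>N\<^esub>" if "x \<in> carrier A" "h x = \<zero>\<^bsub>N\<^esub>" for x
    using h(3)[of "\<ominus>\<^bsub>K\<^esub> \<one>\<^bsub>K\<^esub>" x] that by (simp add: smult_l_minus)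
  then show ?thesis
    using linear_maps_zero[OF assms] h by (intro submoduleI) auto
qed

lemma linear_eq_iff:
  assumes "module K N" "h \<in> linear_maps K A N" "x \<in> carrier A" "y \<in> carrier A"
  shows "h x = h y \<longleftrightarrow> h (x \<ominus>\<^bsub>A\<^esub> y) = \<zero>\<^bsub>N\<^esub>"
proof -
  interpret N: module K N by fact
  note h = linear_mapsD[OF assms(2)]
  have "h (\<ominus>\<^bsub>A\<^esub> y) = \<ominus>\<^bsub>N\<^esub> h y"
    using h(1)[of y] h(3)[of "\<ominus>\<^bsub>K\<^esub> \<one>\<^bsub>K\<^esub>" y] assms(4) by (simp add: smult_l_minus N.smult_l_minus)
  then have "h (x \<ominus>\<^bsub>A\<^esub> y) = h x \<ominus>\<^bsub>N\<^esub> h y"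
    using assms(3,4) h(2)[of x "\<ominus>\<^bsub>A\<^esub> y"] by (simp add: a_minus_def)
  then show ?thesis
    using h(1) assms(3,4) N.minus_equality[of "h x" "\<ominus>\<^bsub>N\<^esub> h y"]
    by (auto simp: a_minus_def N.r_neg)
qed

end

locale rb_algebra = nonunitary_rb_algebra K A lam
  for K :: "('k, 'm) ring_scheme" (structure) and A :: "('k, 'a) rb_alg" (structure) and lam :: 'k
begin

lemma restrict_rb_homI:
  assumes "\<And>x. x \<in> carrier A \<Longrightarrow> h x \<in> carrier B"
    and "\<And>x y. x \<in> carrier A \<Longrightarrow> y \<in> carrier A \<Longrightarrow> h (x \<oplus>\<^bsub>A\<^esub> y) = h x \<oplus>\<^bsub>B\<^esub> h y"
    and "\<And>r x. r \<in> carrier K \<Longrightarrow> x \<in> carrier A \<Longrightarrow> h (r \<odot>\<^bsub>A\<^esub> x) = r \<odot>\<^bsub>B\<^esub> h x"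
    and "\<And>x y. x \<in> carrier A \<Longrightarrow> y \<in> carrier A \<Longrightarrow> h (x \<otimes>\<^bsub>A\<^esub> y) = h x \<otimes>\<^bsub>B\<^esub> h y"
    and "\<And>x. x \<in> carrier A \<Longrightarrow> h (rb_op A x) = rb_op B (h x)"
  shows "restrict h (carrier A) \<in> rb_hom K A B"
  by (rule rb_homI) (simp_all add: assms mult_closed op_closed)

lemma rb_hom_compose:
  assumes "h \<in> rb_hom K A B" "g \<in> rb_hom K B C"
  shows "(\<lambda>x\<in>carrier A. g (h x)) \<in> rb_hom K A C"
  by (rule restrict_rb_homI) (simp_all add: rb_homD[OF assms(1)] rb_homD[OF assms(2)])

lemma hom_image_subalgebra:
  assumes "nonunitary_rb_algebra K B lam" "h \<in> rb_hom K A B"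
  shows "rb_subalgebra K B (h ` carrier A)"
proof -
  interpret B: nonunitary_rb_algebra K B lam by fact
  note h = rb_homD[OF assms(2)]
  have zero: "h \<zero>\<^bsub>A\<^esub> = \<zero>\<^bsub>B\<^esub>"
    by (rule linear_maps_zero[OF B.module_axioms rb_hom_linear[OF assms(2)]])
  have "submodule (h ` carrier A) K B"
  proof (rule B.submoduleI)
    show "\<zero>\<^bsub>B\<^esub> \<in> h ` carrier A" using zero by (metis M.zero_closed imageI)
    fix y assume "y \<in> h ` carrier A"
    then obtain x where x: "x \<in> carrier A" "y = h x" by auto
    then have "\<ominus>\<^bsub>B\<^esub> y = h ((\<ominus>\<^bsub>K\<^esub> \<one>\<^bsub>K\<^esub>) \<odot>\<^bsub>A\<^esub> x)"
      using h(1)[of x] h(3)[of "\<ominus>\<^bsub>K\<^esub> \<one>\<^bsub>K\<^esub>" x] by (simp add: B.smult_l_minus)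
    then show "\<ominus>\<^bsub>B\<^esub> y \<in> h ` carrier A" using x by simp
  next
    fix a b assume "a \<in> h ` carrier A" "b \<in> h ` carrier A"
    then show "a \<oplus>\<^bsub>B\<^esub> b \<in> h ` carrier A" using h(2) by (metis (no_types, lifting) M.a_closed image_iff)
  next
    fix r x assume "r \<in> carrier K" "x \<in> h ` carrier A"
    then show "r \<odot>\<^bsub>B\<^esub> x \<in> h ` carrier A" using h(3) by (metis (no_types, lifting) smult_closed image_iff)
  qed (use h(1) in auto)
  then show ?thesis
    unfolding rb_subalgebra_def
    by (metis (no_types, lifting) h(4,5) image_iff mult_closed op_closed)
qed

text \<open>
  As \<open>q\<close> is onto, values can be defined through arbitrarily chosen preimages; the condition on the
  fibres makes them independent of the choice.
\<close>

lemma hom_factor: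
  assumes q: "q \<in> rb_hom K A Q" and surj: "q ` carrier A = carrier Q" and f: "f \<in> rb_hom K A B"
    and fibres: "\<And>x y. x \<in> carrier A \<Longrightarrow> y \<in> carrier A \<Longrightarrow> q x = q y \<Longrightarrow> f x = f y"
  shows "\<exists>!h. h \<in> rb_hom K Q B \<and> (\<forall>x\<in>carrier A. h (q x) = f x)"
proof (rule ex_ex1I)
  define h where "h = (\<lambda>z\<in>carrier Q. f (SOME x. x \<in> carrier A \<and> q x = z))"
  have hq: "h (q x) = f x" if x: "x \<in> carrier A" for x
  proof -
    have "(SOME x'. x' \<in> carrier A \<and> q x' = q x) \<in> carrier A \<and> q (SOME x'. x' \<in> carrier A \<and> q x' = q x) = q x"
      by (rule someI[of _ x]) (simp add: x)
    then show ?thesis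
      using fibres[of "SOME x'. x' \<in> carrier A \<and> q x' = q x" x] x rb_homD(1)[OF q x] by (simp add: h_def)
  qed
  note Q = rb_homD[OF q] and F = rb_homD[OF f]
  have "h \<in> rb_hom K Q B"
  proof (rule rb_homI)
    show "h z \<in> carrier B" if "z \<in> carrier Q" for z
      using that hq F(1) unfolding surj[symmetric] by auto
    show "h (z \<oplus>\<^bsub>Q\<^esub> w) = h z \<oplus>\<^bsub>B\<^esub> h w" if "z \<in> carrier Q" "w \<in> carrier Q" for z w
      using that hq F(2) unfolding surj[symmetric] by (auto simp flip: Q(2))
    show "h (r \<odot>\<^bsub>Q\<^esub> z) = r \<odot>\<^bsub>B\<^esub> h z" if "r \<in> carrier K" "z \<in> carrier Q" for r z
      using that hq F(3) unfolding surj[symmetric] by (auto simp flip: Q(3))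
    show "h (z \<otimes>\<^bsub>Q\<^esub> w) = h z \<otimes>\<^bsub>B\<^esub> h w" if "z \<in> carrier Q" "w \<in> carrier Q" for z w
      using that hq F(4) mult_closed unfolding surj[symmetric] by (auto simp flip: Q(4))
    show "h (rb_op Q z) = rb_op B (h z)" if "z \<in> carrier Q" for z
      using that hq F(5) op_closed unfolding surj[symmetric] by (auto simp flip: Q(5))
    show "h \<in> extensional (carrier Q)" by (simp add: h_def)
  qed
  with hq show "\<exists>h. h \<in> rb_hom K Q B \<and> (\<forall>x\<in>carrier A. h (q x) = f x)" by blast
next
  fix h h' assume h: "h \<in> rb_hom K Q B \<and> (\<forall>x\<in>carrier A. h (q x) = f x)"
    and h': "h' \<in> rb_hom K Q B \<and> (\<forall>x\<in>carrier A. h' (q x) = f x)"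
  show "h = h'"
  proof (rule rb_hom_eqI)
    fix z assume "z \<in> carrier Q"
    then obtain x where "x \<in> carrier A" "z = q x" using surj by auto
    then show "h z = h' z" using h h' by simp
  qed (use h h' in auto)
qed

end

text \<open>
  The axioms are equations between the operations, and the existence of negatives, so they pass to
  images under maps that respect the operations.
\<close>

lemma unitary_image:
  assumes "unitary_rb_algebra K A lam"
    and surj: "q ` carrier A = carrier Q"
    and q: "\<And>x y. x \<in> carrier A \<Longrightarrow> y \<in> carrier A \<Longrightarrow> q x \<oplus>\<^bsub>Q\<^esub> q y = q (x \<oplus>\<^bsub>A\<^esub> y)"
      "\<And>r x. r \<in> carrier K \<Longrightarrow> x \<in> carrier A \<Longrightarrow> r \<odot>\<^bsub>Q\<^esub> q x = q (r \<odot>\<^bsub>A\<^esub> x)"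
      "\<And>x y. x \<in> carrier A \<Longrightarrow> y \<in> carrier A \<Longrightarrow> q x \<otimes>\<^bsub>Q\<^esub> q y = q (x \<otimes>\<^bsub>A\<^esub> y)"
      "\<And>x. x \<in> carrier A \<Longrightarrow> rb_op Q (q x) = q (rb_op A x)"
      "\<zero>\<^bsub>Q\<^esub> = q \<zero>\<^bsub>A\<^esub>" "\<one>\<^bsub>Q\<^esub> = q \<one>\<^bsub>A\<^esub>"
  shows "unitary_rb_algebra K Q lam"
proof -
  interpret A: unitary_rb_algebra K A lam by fact
  have ex: "\<exists>x\<in>carrier A. z = q x" if "z \<in> carrier Q" for z
    using that unfolding surj[symmetric] by auto
  have cl: "q x \<in> carrier Q" if "x \<in> carrier A" for x
    using that unfolding surj[symmetric] by auto
  note closed = A.mult_closed A.op_closed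
  have "abelian_group Q"
  proof (rule abelian_groupI)
    fix z assume "z \<in> carrier Q"
    then obtain x where "x \<in> carrier A" "z = q x" using ex by auto
    then show "\<exists>w\<in>carrier Q. w \<oplus>\<^bsub>Q\<^esub> z = \<zero>\<^bsub>Q\<^esub>"
      by (intro bexI[of _ "q (\<ominus>\<^bsub>A\<^esub> x)"]) (simp_all add: q cl A.l_neg)
  qed (auto dest!: ex simp: q cl A.a_ac)
  moreover from this have "module K Q"
    by (intro moduleI A.R.is_cring)
       (auto dest!: ex simp: q cl A.smult_l_distr A.smult_r_distr A.smult_assoc1)
  moreover have "monoid Q"
    by (rule monoidI) (auto dest!: ex simp: q cl closed A.mult_assoc)
  ultimately show ?thesis
    by (intro unitary_rb_algebra.intro nonunitary_rb_algebra.intro nonunitary_rb_algebra_axioms.intro ringI)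
       (auto dest!: ex simp: q cl closed A.mult_assoc A.mult_l_distr A.mult_r_distr A.mult_smult_l
          A.mult_smult_r A.op_add A.op_smult A.weight_closed A.rota_baxter)
qed

locale rb_quotient = unitary_rb_algebra K A lam
  for K :: "('k, 'm) ring_scheme" (structure) and A :: "('k, 'a) rb_alg" (structure) and lam :: 'k +
  fixes I :: "'a set"
  assumes rb_ideal: "rb_ideal K A I"
begin

lemma submodule: "submodule I K A"
  using rb_ideal by (simp add: rb_ideal_def)

sublocale I: ideal I A
  by (rule idealI)
     (use rb_ideal submodule.axioms(1)[OF submodule] ring_axioms in \<open>auto simp: rb_ideal_def\<close>)

lemma coset_eq: "I +>\<^bsub>A\<^esub> y = I +>\<^bsub>A\<^esub> x" if "y \<in> I +>\<^bsub>A\<^esub> x" "x \<in> carrier A"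
  using I.a_repr_independence'[OF that] ..

text \<open>
  The operations on cosets are defined by unions over all representatives; when \<open>f\<close> respects
  congruence modulo \<open>I\<close>, all members of the union coincide.
\<close>

lemma coset_UN:
  assumes x: "x \<in> carrier A" and f: "\<And>i. i \<in> I \<Longrightarrow> f (i \<oplus>\<^bsub>A\<^esub> x) \<in> I +>\<^bsub>A\<^esub> f x" and "f x \<in> carrier A"
  shows "(\<Union>y\<in>I +>\<^bsub>A\<^esub> x. I +>\<^bsub>A\<^esub> f y) = I +>\<^bsub>A\<^esub> f x"
proof -
  have "I +>\<^bsub>A\<^esub> f y = I +>\<^bsub>A\<^esub> f x" if y: "y \<in> I +>\<^bsub>A\<^esub> x" for y
  proof -
    obtain i where "i \<in> I" "y = i \<oplus>\<^bsub>A\<^esub> x" using y by (auto simp: a_r_coset_def')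
    then show ?thesis using f assms(3) coset_eq by simp
  qed
  moreover have "x \<in> I +>\<^bsub>A\<^esub> x" using I.a_rcos_self[OF x] .
  ultimately show ?thesis by blast
qed

lemma proj_ops:
  defines "Q \<equiv> rb_quot A I" and "q \<equiv> rb_proj A I"
  shows "q ` carrier A = carrier Q"
    and "\<And>x y. x \<in> carrier A \<Longrightarrow> y \<in> carrier A \<Longrightarrow> q x \<oplus>\<^bsub>Q\<^esub> q y = q (x \<oplus>\<^bsub>A\<^esub> y)"
    and "\<And>r x. r \<in> carrier K \<Longrightarrow> x \<in> carrier A \<Longrightarrow> r \<odot>\<^bsub>Q\<^esub> q x = q (r \<odot>\<^bsub>A\<^esub> x)"
    and "\<And>x y. x \<in> carrier A \<Longrightarrow> y \<in> carrier A \<Longrightarrow> q x \<otimes>\<^bsub>Q\<^esub> q y = q (x \<otimes>\<^bsub>A\<^esub> y)"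
    and "\<And>x. x \<in> carrier A \<Longrightarrow> rb_op Q (q x) = q (rb_op A x)"
    and "\<zero>\<^bsub>Q\<^esub> = q \<zero>\<^bsub>A\<^esub>" "\<one>\<^bsub>Q\<^esub> = q \<one>\<^bsub>A\<^esub>"
proof -
  show "q ` carrier A = carrier Q"
    by (auto simp: Q_def q_def rb_proj_def rb_quot_def A_RCOSETS_def')
  show "q x \<oplus>\<^bsub>Q\<^esub> q y = q (x \<oplus>\<^bsub>A\<^esub> y)" if "x \<in> carrier A" "y \<in> carrier A" for x y
    using that by (simp add: Q_def q_def rb_proj_def rb_quot_def I.a_rcos_sum)
  show "q x \<otimes>\<^bsub>Q\<^esub> q y = q (x \<otimes>\<^bsub>A\<^esub> y)" if "x \<in> carrier A" "y \<in> carrier A" for x y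
    using that by (simp add: Q_def q_def rb_proj_def rb_quot_def I.rcoset_mult_add mult_closed)
  show "r \<odot>\<^bsub>Q\<^esub> q x = q (r \<odot>\<^bsub>A\<^esub> x)" if r: "r \<in> carrier K" and x: "x \<in> carrier A" for r x
  proof -
    have "r \<odot>\<^bsub>A\<^esub> (i \<oplus>\<^bsub>A\<^esub> x) \<in> I +>\<^bsub>A\<^esub> (r \<odot>\<^bsub>A\<^esub> x)" if i: "i \<in> I" for i
      using i r x submodule.smult_closed[OF submodule r i] I.a_Hcarr[OF i]
      by (auto simp: a_r_coset_def' smult_r_distr)
    then show ?thesis
      using r x by (simp add: Q_def q_def rb_proj_def rb_quot_def coset_UN)
  qed
  show "rb_op Q (q x) = q (rb_op A x)" if x: "x \<in> carrier A" for x
  proof -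
    have "rb_op A (i \<oplus>\<^bsub>A\<^esub> x) \<in> I +>\<^bsub>A\<^esub> rb_op A x" if i: "i \<in> I" for i
      using i x rb_ideal I.a_Hcarr[OF i]
      by (auto simp: a_r_coset_def' op_add rb_ideal_def)
    then show ?thesis
      using x by (simp add: Q_def q_def rb_proj_def rb_quot_def coset_UN op_closed)
  qed
  show "\<zero>\<^bsub>Q\<^esub> = q \<zero>\<^bsub>A\<^esub>" "\<one>\<^bsub>Q\<^esub> = q \<one>\<^bsub>A\<^esub>"
    using I.a_subset by (simp_all add: Q_def q_def rb_proj_def rb_quot_def)
qed

lemma quotient_unitary: "unitary_rb_algebra K (rb_quot A I) lam"
  by (rule unitary_image[OF unitary_rb_algebra_axioms, of "rb_proj A I"]) (simp_all add: proj_ops)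

lemma proj_hom: "rb_proj A I \<in> unitary_rb_hom K A (rb_quot A I)"
proof -
  have "rb_proj A I x \<in> carrier (rb_quot A I)" if "x \<in> carrier A" for x
    using that unfolding proj_ops(1)[symmetric] by simp
  moreover have "rb_proj A I \<in> extensional (carrier A)" by (simp add: rb_proj_def)
  ultimately have "rb_proj A I \<in> rb_hom K A (rb_quot A I)"
    by (intro rb_homI) (simp_all add: proj_ops)
  then show ?thesis by (simp add: unitary_rb_hom_def proj_ops)
qed

lemma proj_eq_iff:
  assumes "x \<in> carrier A" "y \<in> carrier A"
  shows "rb_proj A I x = rb_proj A I y \<longleftrightarrow> x \<ominus>\<^bsub>A\<^esub> y \<in> I"
proof -
  interpret Q: unitary_rb_algebra K "rb_quot A I" lam by (rule quotient_unitary)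
  have "rb_proj A I (x \<ominus>\<^bsub>A\<^esub> y) = \<zero>\<^bsub>rb_quot A I\<^esub> \<longleftrightarrow> x \<ominus>\<^bsub>A\<^esub> y \<in> I"
    using assms I.a_rcos_const I.a_rcos_self[of "x \<ominus>\<^bsub>A\<^esub> y"] by (auto simp: rb_proj_def rb_quot_def)
  then show ?thesis
    using linear_eq_iff[OF Q.module_axioms rb_hom_linear assms, of "rb_proj A I"] proj_hom
    by (simp add: unitary_rb_hom_def)
qed

end

lemma rb_ideal_generated_least: "rb_ideal K A I \<Longrightarrow> S \<subseteq> I \<Longrightarrow> rb_ideal_generated K A S \<subseteq> I"
  by (auto simp: rb_ideal_generated_def)

lemma rb_ideal_generated_superset: "S \<subseteq> rb_ideal_generated K A S"
  by (auto simp: rb_ideal_generated_def)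

lemma rb_ideal_rb_ideal_generated:
  assumes "nonunitary_rb_algebra K A lam" and S: "S \<subseteq> carrier A"
  shows "rb_ideal K A (rb_ideal_generated K A S)"
proof -
  interpret nonunitary_rb_algebra K A lam by fact
  let ?J = "rb_ideal_generated K A S"
  have carr: "rb_ideal K A (carrier A)"
    by (auto simp: rb_ideal_def mult_closed op_closed intro!: submoduleI)
  have sub: "submodule I K A" if "rb_ideal K A I" for I using that by (simp add: rb_ideal_def)
  have inv: "\<ominus>\<^bsub>A\<^esub> x \<in> I" if "rb_ideal K A I" "x \<in> I" for I x
    using submodule.axioms(1)[OF sub[OF that(1)]] that(2) subgroup.m_inv_closed[of I "add_monoid A" x]
    by (simp add: a_inv_def)
  have zero: "\<zero>\<^bsub>A\<^esub> \<in> I" if "rb_ideal K A I" for I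
    using submodule.axioms(1)[OF sub[OF that]] subgroup.one_closed[of I "add_monoid A"] by simp
  have add: "x \<oplus>\<^bsub>A\<^esub> y \<in> I" if "rb_ideal K A I" "x \<in> I" "y \<in> I" for I x y
    using submodule.axioms(1)[OF sub[OF that(1)]] subgroup.m_closed[of I "add_monoid A" x y] that by simp
  have "submodule ?J K A"
    using S carr by (intro submoduleI)
      (auto simp: rb_ideal_generated_def inv zero add submodule.smult_closed[OF sub])
  then show ?thesis
    unfolding rb_ideal_def[of K A ?J] by (auto simp: rb_ideal_generated_def rb_ideal_def)
qed

lemma kernel_rb_ideal:
  assumes "nonunitary_rb_algebra K A lam" "nonunitary_rb_algebra K B lam" and h: "h \<in> rb_hom K A B"
  shows "rb_ideal K A {x \<in> carrier A. h x = \<zero>\<^bsub>B\<^esub>}"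
proof -
  interpret A: nonunitary_rb_algebra K A lam by fact
  interpret B: nonunitary_rb_algebra K B lam by fact
  interpret O: operated_module K B by (rule B.operated_module)
  show ?thesis
    unfolding rb_ideal_def
    using A.submodule_of_zero_fibre[OF B.module_axioms rb_hom_linear[OF h]] rb_homD[OF h]
      A.mult_closed A.op_closed by auto
qed

section \<open>Freeness of the algebras of decorated forests\<close>

lemma unitary_evaluation:
  assumes "unitary_rb_algebra K B lam"
  shows "evaluation K B lam (carrier B)"
proof -
  interpret unitary_rb_algebra K B lam by fact
  interpret O: operated_module K B by (rule operated_module)
  show ?thesis
    by unfold_locales (simp_all add: weight_closed m_assoc rota_baxter)
qed

context decorated
begin

text \<open>
  Stated for any span of decorated forests, to serve both free algebras.
\<close>

lemma hom_eq_on_basis_eq: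
  assumes "free_operated K A S (decorated_prod K lam) (decorated_op K)"
    and "module K B" "h \<in> rb_hom K A B" "h' \<in> rb_hom K A B"
    and "\<And>b. b \<in> S \<Longrightarrow> h (basis_elt K b) = h' (basis_elt K b)"
  shows "h = h'"
proof -
  interpret A: free_operated K A S "decorated_prod K lam" "decorated_op K" by fact
  interpret B: module K B by fact
  show ?thesis
  proof (rule rb_hom_eqI[OF assms(3,4)])
    fix x assume "x \<in> carrier A"
    then show "h x = h' x"
    proof (induction rule: A.carrier_induct)
      case zero
      show ?case
        using A.linear_maps_zero[OF B.module_axioms] assms(3,4) rb_hom_linear by metis
    next
      case (basis b)
      then show ?case by (rule assms(5))
    qed (simp_all add: rb_homD(2,3)[OF assms(3)] rb_homD(2,3)[OF assms(4)])
  qed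
qed

lemma Sh0_hom_eqI:
  assumes B: "nonunitary_rb_algebra K B lam" and h: "h \<in> rb_hom K Sh0 B" "h' \<in> rb_hom K Sh0 B"
    and gen: "\<And>x. x \<in> X \<Longrightarrow> h (sh_gen K x) = h' (sh_gen K x)"
  shows "h = h'"
proof -
  have "module K B" using B by (simp add: nonunitary_rb_algebra_def)
  moreover have "basis_elt K b \<in> {c \<in> carrier Sh0. h c = h' c}" if b: "b \<in> decorated_forests0 X" for b
  proof -
    obtain F xs where e: "b = (F, xs)" by (cases b)
    show ?thesis
      unfolding e
    proof (rule basis_in_generated)
      show "(F, xs) \<in> decorated_forests X" "F \<in> forests0 \<or> \<one>\<^bsub>Sh\<^esub> \<in> {c \<in> carrier Sh0. h c = h' c}"
        using b e by auto
    qed (use generator_in(1) gen in \<open>auto simp: Sh0_ops[symmetric] rb_homD(4,5)[OF h(1)] rb_homD(4,5)[OF h(2)]\<close>)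
  qed
  ultimately show ?thesis
    using hom_eq_on_basis_eq[OF Sh0.free_operated_axioms _ h] by blast
qed

lemma Sh_hom_eqI:
  assumes B: "unitary_rb_algebra K B lam" and h: "h \<in> unitary_rb_hom K Sh B" "h' \<in> unitary_rb_hom K Sh B"
    and gen: "\<And>x. x \<in> X \<Longrightarrow> h (sh_gen K x) = h' (sh_gen K x)"
  shows "h = h'"
proof -
  have mod: "module K B" using B by (simp add: unitary_rb_algebra_def nonunitary_rb_algebra_def)
  have h': "h \<in> rb_hom K Sh B" "h' \<in> rb_hom K Sh B" and one: "h \<one>\<^bsub>Sh\<^esub> = h' \<one>\<^bsub>Sh\<^esub>"
    using h by (simp_all add: unitary_rb_hom_def)
  have "basis_elt K b \<in> {c \<in> carrier Sh. h c = h' c}" if b: "b \<in> decorated_forests X" for b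
  proof -
    obtain F xs where e: "b = (F, xs)" by (cases b)
    show ?thesis
      unfolding e
    proof (rule basis_in_generated)
      show "(F, xs) \<in> decorated_forests X" "F \<in> forests0 \<or> \<one>\<^bsub>Sh\<^esub> \<in> {c \<in> carrier Sh. h c = h' c}"
        using b e one Sh_one_closed by auto
    qed (use generator_in(2) gen in \<open>auto simp: rb_homD(4,5)[OF h'(1)] rb_homD(4,5)[OF h'(2)]\<close>)
  qed
  then show ?thesis
    using hom_eq_on_basis_eq[OF Sh.free_operated_axioms mod h'] by blast
qed

text \<open>
  The extension of \<open>\<iota>\<close> is the evaluation in \<open>B\<close> itself.
\<close>

lemma Sh_hom_exists:
  assumes B: "unitary_rb_algebra K B lam" and \<iota>: "\<And>x. x \<in> X \<Longrightarrow> \<iota> x \<in> carrier B"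
  shows "\<exists>h\<in>unitary_rb_hom K Sh B. \<forall>x\<in>X. h (sh_gen K x) = \<iota> x"
proof -
  interpret E: evaluation K B lam "carrier B" by (rule unitary_evaluation[OF B])
  interpret E: decorated_evaluation K B lam "carrier B" Sh "decorated_forests X" X \<iota>
    by unfold_locales (use \<iota> in \<open>auto simp: E.evaluable_def decorated_forests_def\<close>)
  interpret S: rb_algebra K Sh lam by (intro rb_algebra.intro Sh_nonunitary)
  let ?h = "restrict (E.ev_lin \<iota>) (carrier Sh)"
  have "?h \<in> rb_hom K Sh B"
    by (rule S.restrict_rb_homI) (simp_all add: E.ev_lin_mult E.ev_lin_op)
  moreover have "?h \<one>\<^bsub>Sh\<^esub> = \<one>\<^bsub>B\<^esub>"
  proof -
    have "\<one>\<^bsub>Sh\<^esub> = basis_elt K ([bullet], [])" by (simp add: sh_nc_def)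
    moreover have "([bullet], []) \<in> decorated_forests X" by (simp add: decorated_forests_def)
    ultimately show ?thesis using Sh_one_closed by (simp add: E.ev_lin_basis)
  qed
  moreover have "?h (sh_gen K x) = \<iota> x" if "x \<in> X" for x
    using that generator_in(2) by (simp add: E.ev_lin_gen decorated_forests_def)
  ultimately show ?thesis by (auto simp: unitary_rb_hom_def)
qed

text \<open>
  Without a unit in \<open>B\<close>, the tree \<open>\<bullet>\<close> has no value there.  The forests are evaluated in the Dorroh
  extension instead, where the values of those in \<open>forests0\<close> lie in the copy of \<open>B\<close>.
\<close>

lemma Sh0_hom_exists:
  assumes B: "nonunitary_rb_algebra K B lam" and \<iota>: "\<And>x. x \<in> X \<Longrightarrow> \<iota> x \<in> carrier B"
  shows "\<exists>h\<in>rb_hom K Sh0 B. \<forall>x\<in>X. h (sh_gen K x) = \<iota> x"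
proof -
  interpret B: nonunitary_rb_algebra K B lam by (rule B)
  interpret O: operated_module K B by (rule B.operated_module)
  let ?R = "dorroh K B" and ?I = "{\<zero>} \<times> carrier B" and ?\<iota> = "\<lambda>x. (\<zero>, \<iota> x)"
  interpret E: evaluation K ?R lam ?I by (rule dorroh_evaluation[OF B])
  interpret E: decorated_evaluation K ?R lam ?I Sh0 "decorated_forests0 X" X ?\<iota>
    by unfold_locales (use \<iota> in \<open>auto simp: E.evaluable_def decorated_forests_def\<close>)
  interpret S: rb_algebra K Sh0 lam by (intro rb_algebra.intro Sh0_nonunitary)
  have I: "\<exists>b\<in>carrier B. E.ev_lin ?\<iota> c = (\<zero>, b)" if "c \<in> carrier Sh0" for c
    using E.ev_lin_in_I[OF dorroh_submodule[OF B] that] by auto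
  let ?h = "restrict (\<lambda>c. snd (E.ev_lin ?\<iota> c)) (carrier Sh0)"
  have "?h \<in> rb_hom K Sh0 B"
  proof (rule S.restrict_rb_homI)
    fix x assume x: "x \<in> carrier Sh0"
    then obtain a where a: "a \<in> carrier B" "E.ev_lin ?\<iota> x = (\<zero>, a)" using I by auto
    show "snd (E.ev_lin ?\<iota> x) \<in> carrier B" using a by simp
    show "snd (E.ev_lin ?\<iota> (rb_op Sh0 x)) = rb_op B (snd (E.ev_lin ?\<iota> x))"
      using a x by (simp add: E.ev_lin_op) (simp add: dorroh_def)
    show "snd (E.ev_lin ?\<iota> (r \<odot>\<^bsub>Sh0\<^esub> x)) = r \<odot>\<^bsub>B\<^esub> snd (E.ev_lin ?\<iota> x)" if "r \<in> carrier K" for r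
      using a x that by simp (simp add: dorroh_def)
    fix y assume y: "y \<in> carrier Sh0"
    then obtain b where b: "b \<in> carrier B" "E.ev_lin ?\<iota> y = (\<zero>, b)" using I by auto
    show "snd (E.ev_lin ?\<iota> (x \<oplus>\<^bsub>Sh0\<^esub> y)) = snd (E.ev_lin ?\<iota> x) \<oplus>\<^bsub>B\<^esub> snd (E.ev_lin ?\<iota> y)"
      using a b x y by simp (simp add: dorroh_def)
    show "snd (E.ev_lin ?\<iota> (x \<otimes>\<^bsub>Sh0\<^esub> y)) = snd (E.ev_lin ?\<iota> x) \<otimes>\<^bsub>B\<^esub> snd (E.ev_lin ?\<iota> y)"
      using a b x y by (simp add: E.ev_lin_mult) (simp add: dorroh_def)
  qed
  moreover have "?h (sh_gen K x) = \<iota> x" if "x \<in> X" for x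
    using that generator_in(1) by (simp add: E.ev_lin_gen decorated_forests_def forests0_eq)
  ultimately show ?thesis by blast
qed

end

section \<open>The unitarization\<close>

text \<open>
  An algebra presented as a quotient of the free nonunitary algebra on its generators.  The free
  nonunitary algebra is a subset of the free unitary one, so the relations \<open>J\<close> of \<open>A\<close> are relations
  there as well.
\<close>

locale presented = decorated K lam X + A: rb_algebra K A lam
  for K :: "('k, 'm) ring_scheme" (structure) and lam :: 'k and X :: "'a set"
    and A :: "('k, 'a) rb_alg" (structure) +
  fixes gbar :: "('a decorated \<Rightarrow> 'k) \<Rightarrow> 'a"
  assumes X_subset: "X \<subseteq> carrier A" and generates: "rb_generated K A X = carrier A"
    and gbar: "gbar \<in> rb_hom K Sh0 A" and gbar_gen: "\<And>x. x \<in> X \<Longrightarrow> gbar (sh_gen K x) = x"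
begin

sublocale S0: rb_algebra K Sh0 lam
  by (intro rb_algebra.intro Sh0_nonunitary)

sublocale S: rb_algebra K Sh lam
  by (intro rb_algebra.intro Sh_nonunitary)

lemma gbar_surj: "gbar ` carrier Sh0 = carrier A"
proof
  show "gbar ` carrier Sh0 \<subseteq> carrier A" using rb_homD(1)[OF gbar] by auto
  have "X \<subseteq> gbar ` carrier Sh0" 
  proof
    fix x assume "x \<in> X"
    then show "x \<in> gbar ` carrier Sh0"
      by (intro image_eqI[of x gbar "sh_gen K x"]) (simp_all add: gbar_gen generator_in)
  qed
  then show "carrier A \<subseteq> gbar ` carrier Sh0"
    unfolding generates[symmetric] rb_generated_def
    using S0.hom_image_subalgebra[OF A.nonunitary_rb_algebra_axioms gbar] by blast
qed

definition J where "J = a_kernel Sh0 A gbar"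
definition J' where "J' = rb_ideal_generated K Sh J"

lemma J_eq: "J = {x \<in> carrier Sh0. gbar x = \<zero>\<^bsub>A\<^esub>}"
  by (simp add: J_def a_kernel_def')

lemma J'_ideal: "rb_ideal K Sh J'"
  unfolding J'_def using Sh0_subset
  by (intro rb_ideal_rb_ideal_generated[OF Sh_nonunitary]) (auto simp: J_eq)

sublocale Q: rb_quotient K Sh lam J'
  by (intro rb_quotient.intro rb_quotient_axioms.intro Sh_unitary J'_ideal)

abbreviation A' where "A' \<equiv> rb_quot Sh J'"
abbreviation q where "q \<equiv> rb_proj Sh J'"

lemma q_hom: "q \<in> rb_hom K Sh A'"
  using Q.proj_hom by (simp add: unitary_rb_hom_def)

lemma inclusion: "(\<lambda>z\<in>carrier Sh0. z) \<in> rb_hom K Sh0 Sh"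
  using Sh0_subset by (intro S0.restrict_rb_homI) (auto simp: Sh0_ops)

lemma q_restrict_hom: "(\<lambda>z\<in>carrier Sh0. q z) \<in> rb_hom K Sh0 A'"
  using S0.rb_hom_compose[OF inclusion q_hom] by (simp cong: restrict_cong)

text \<open>
  Negatives are defined by a description that refers to the carrier, so that those of the
  subalgebra have to be compared with those of the whole algebra.
\<close>

lemma Sh0_minus:
  assumes "x \<in> carrier Sh0" "y \<in> carrier Sh0"
  shows "x \<ominus>\<^bsub>Sh0\<^esub> y = x \<ominus>\<^bsub>Sh\<^esub> y"
proof -
  have "\<ominus>\<^bsub>Sh0\<^esub> y = \<ominus>\<^bsub>Sh\<^esub> y"
    using Sh0.smult_l_minus[of \<one> y] Sh.smult_l_minus[of \<one> y] assms Sh0_subset by (auto simp: Sh0_ops)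
  then show ?thesis by (simp add: a_minus_def Sh0_ops)
qed

text \<open>
  This makes \<open>u\<^sub>A\<close> well defined: elements with the same image in \<open>A\<close> differ by a relation of \<open>A\<close>, and
  these are among the relations imposed on the free unitary algebra.
\<close>

lemma gbar_eq_imp_q_eq:
  assumes "x \<in> carrier Sh0" "y \<in> carrier Sh0" "gbar x = gbar y"
  shows "q x = q y"
proof -
  have "gbar (x \<ominus>\<^bsub>Sh0\<^esub> y) = \<zero>\<^bsub>A\<^esub>"
    using S0.linear_eq_iff[OF A.module_axioms rb_hom_linear[OF gbar] assms(1,2)] assms(3) by simp
  then have "x \<ominus>\<^bsub>Sh0\<^esub> y \<in> J" using assms by (simp add: J_eq a_minus_def)
  then have "x \<ominus>\<^bsub>Sh\<^esub> y \<in> J'"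
    using rb_ideal_generated_superset[of J K Sh] assms by (auto simp: J'_def Sh0_minus)
  then show ?thesis using Q.proj_eq_iff assms Sh0_subset by blast
qed

lemma u_A_unique: "\<exists>!u_A. u_A \<in> rb_hom K A A' \<and> (\<forall>z\<in>carrier Sh0. u_A (gbar z) = q z)"
proof -
  have "\<exists>!u_A. u_A \<in> rb_hom K A A' \<and> (\<forall>z\<in>carrier Sh0. u_A (gbar z) = (\<lambda>z\<in>carrier Sh0. q z) z)"
  proof (rule S0.hom_factor[OF gbar gbar_surj q_restrict_hom])
    fix x y assume "x \<in> carrier Sh0" "y \<in> carrier Sh0" "gbar x = gbar y"
    then show "(\<lambda>z\<in>carrier Sh0. q z) x = (\<lambda>z\<in>carrier Sh0. q z) y"
      using gbar_eq_imp_q_eq[of x y] by simp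
  qed
  then show ?thesis by simp
qed

text \<open>
  The homomorphism \<open>fbar\<close> out of the free unitary algebra determined by the values of \<open>f\<close> on \<open>X\<close> agrees
  with \<open>f \<circ> gbar\<close> on the free nonunitary algebra, since both have the same values on the generators.
  Therefore \<open>fbar\<close> vanishes on \<open>J\<close>, and on \<open>J'\<close> because its kernel is a Rota--Baxter ideal; it descends to
  the quotient.  Conversely a factorization of \<open>f\<close>, pulled back to the free unitary algebra, has the
  values of \<open>f\<close> on \<open>X\<close>, so it is \<open>fbar\<close>.
\<close>

lemma unitarization:
  assumes u: "u \<in> rb_hom K A A'" and uq: "\<And>z. z \<in> carrier Sh0 \<Longrightarrow> u (gbar z) = q z"
  shows "unitarization TYPE('b) K lam A A' u"
  unfolding unitarization_def
proof (intro conjI allI impI ballI u Q.quotient_unitary)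
  fix B :: "('k, 'b) rb_alg" and f
  assume B: "unitary_rb_algebra K B lam" and f: "f \<in> rb_hom K A B"
  interpret B: unitary_rb_algebra K B lam by (rule B)
  obtain fbar where fbar: "fbar \<in> unitary_rb_hom K Sh B" and fbar_gen: "\<And>x. x \<in> X \<Longrightarrow> fbar (sh_gen K x) = f x"
    using Sh_hom_exists[OF B, of f] rb_homD(1)[OF f] X_subset by blast
  have fbar': "fbar \<in> rb_hom K Sh B" using fbar by (simp add: unitary_rb_hom_def)
  have "(\<lambda>z\<in>carrier Sh0. fbar ((\<lambda>z\<in>carrier Sh0. z) z)) = (\<lambda>z\<in>carrier Sh0. f (gbar z))"
    by (rule Sh0_hom_eqI[OF B.nonunitary_rb_algebra_axioms])
       (use S0.rb_hom_compose[OF inclusion fbar'] S0.rb_hom_compose[OF gbar f] fbar_gen gbar_gen generator_in(1) in auto)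
  then have fbar_gbar: "fbar z = f (gbar z)" if "z \<in> carrier Sh0" for z
    using that by (metis (no_types, lifting) restrict_apply')
  have f_zero: "f \<zero>\<^bsub>A\<^esub> = \<zero>\<^bsub>B\<^esub>"
    by (rule A.linear_maps_zero[OF B.module_axioms rb_hom_linear[OF f]])
  have "J' \<subseteq> {x \<in> carrier Sh. fbar x = \<zero>\<^bsub>B\<^esub>}"
    unfolding J'_def
    by (rule rb_ideal_generated_least[OF kernel_rb_ideal[OF Sh_nonunitary B.nonunitary_rb_algebra_axioms fbar']])
       (use Sh0_subset f_zero in \<open>auto simp: J_eq fbar_gbar\<close>)
  then have fibres: "fbar x = fbar y" if "x \<in> carrier Sh" "y \<in> carrier Sh" "q x = q y" for x y
    using S.linear_eq_iff[OF B.module_axioms rb_hom_linear[OF fbar'] that(1,2)] Q.proj_eq_iff[OF that(1,2)] that(3)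
    by auto
  have fac: "\<exists>!h. h \<in> rb_hom K A' B \<and> (\<forall>x\<in>carrier Sh. h (q x) = fbar x)"
    by (rule S.hom_factor[OF q_hom Q.proj_ops(1) fbar' fibres])
  show "\<exists>!h. h \<in> unitary_rb_hom K A' B \<and> (\<forall>a\<in>carrier A. f a = h (u a))"
  proof (rule ex_ex1I)
    obtain h where h: "h \<in> rb_hom K A' B" "\<And>x. x \<in> carrier Sh \<Longrightarrow> h (q x) = fbar x"
      using fac by blast
    have "h \<one>\<^bsub>A'\<^esub> = \<one>\<^bsub>B\<^esub>"
      using h(2)[OF Sh_one_closed] fbar by (simp add: Q.proj_ops(7) unitary_rb_hom_def)
    moreover have "f a = h (u a)" if a: "a \<in> carrier A" for a
    proof -
      obtain z where z: "z \<in> carrier Sh0" "a = gbar z" using a gbar_surj by blast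
      have "h (u a) = h (q z)" using uq[OF z(1)] z(2) by simp
      also have "\<dots> = fbar z" using h(2) z(1) Sh0_subset by blast
      also have "\<dots> = f a" using fbar_gbar[OF z(1)] z(2) by simp
      finally show ?thesis ..
    qed
    ultimately show "\<exists>h. h \<in> unitary_rb_hom K A' B \<and> (\<forall>a\<in>carrier A. f a = h (u a))"
      unfolding unitary_rb_hom_def using h(1) by blast
  next
    have lift: "\<forall>x\<in>carrier Sh. h (q x) = fbar x"
      if "h \<in> unitary_rb_hom K A' B \<and> (\<forall>a\<in>carrier A. f a = h (u a))" for h
    proof -
      have h: "h \<in> rb_hom K A' B" "h \<one>\<^bsub>A'\<^esub> = \<one>\<^bsub>B\<^esub>" "\<And>a. a \<in> carrier A \<Longrightarrow> f a = h (u a)"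
        using that by (simp_all add: unitary_rb_hom_def)
      have "(\<lambda>x\<in>carrier Sh. h (q x)) = fbar"
      proof (rule Sh_hom_eqI[OF B _ fbar])
        show "(\<lambda>x\<in>carrier Sh. h (q x)) \<in> unitary_rb_hom K Sh B"
          using S.rb_hom_compose[OF q_hom h(1)] Sh_one_closed h(2)
          by (simp add: unitary_rb_hom_def Q.proj_ops(7))
        fix x assume x: "x \<in> X"
        have "h (q (sh_gen K x)) = h (u (gbar (sh_gen K x)))" using uq generator_in(1)[OF x] by simp
        then show "(\<lambda>x\<in>carrier Sh. h (q x)) (sh_gen K x) = fbar (sh_gen K x)"
          using x X_subset h(3) generator_in(2)[OF x] gbar_gen fbar_gen by auto
      qed
      then show ?thesis by (metis (no_types, lifting) restrict_apply')
    qed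
    fix h h'
    assume *: "h \<in> unitary_rb_hom K A' B \<and> (\<forall>a\<in>carrier A. f a = h (u a))"
      "h' \<in> unitary_rb_hom K A' B \<and> (\<forall>a\<in>carrier A. f a = h' (u a))"
    show "h = h'"
      using fac lift[OF *(1)] lift[OF *(2)] * by (auto simp: unitary_rb_hom_def)
  qed
qed

end

theorem theorem4p3:
  fixes K :: "('k, 'm) ring_scheme" and lam :: 'k
    and A :: "('k, 'a) rb_alg" and X :: "'a set"
    and Sh0 Sh :: "('k, 'a decorated \<Rightarrow> 'k) rb_alg"
  assumes "cring K" and "lam \<in> carrier K"
    and "nonunitary_rb_algebra K A lam"
    and "X \<subseteq> carrier A" and "rb_generated K A X = carrier A"
    and "Sh0 = sh_nc0 K lam X" and "Sh = sh_nc K lam X"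
  shows
    "(\<exists>!u_X. u_X \<in> rb_hom K Sh0 Sh \<and> (\<forall>x\<in>X. u_X (sh_gen K x) = sh_gen K x)) \<and>
     (\<exists>!gbar. gbar \<in> rb_hom K Sh0 A \<and> (\<forall>x\<in>X. gbar (sh_gen K x) = x)) \<and>
     (\<forall>u_X gbar.
        u_X \<in> rb_hom K Sh0 Sh \<and> (\<forall>x\<in>X. u_X (sh_gen K x) = sh_gen K x) \<and>
        gbar \<in> rb_hom K Sh0 A \<and> (\<forall>x\<in>X. gbar (sh_gen K x) = x) \<longrightarrow>
        gbar ` carrier Sh0 = carrier A \<and>
        (let J = a_kernel Sh0 A gbar;
             J' = rb_ideal_generated K Sh (u_X ` J);
             A' = rb_quot Sh J';
             q = rb_proj Sh J'
         in (\<exists>!u_A. u_A \<in> rb_hom K A A' \<and> (\<forall>z\<in>carrier Sh0. u_A (gbar z) = q (u_X z))) \<and>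
            (\<forall>u_A. u_A \<in> rb_hom K A A' \<and> (\<forall>z\<in>carrier Sh0. u_A (gbar z) = q (u_X z)) \<longrightarrow>
               unitarization TYPE('b) K lam A A' u_A)))"
proof -
  interpret decorated K lam X
    using assms(1,2) by (intro decorated.intro forests.intro forests_axioms.intro)
  have Sh: "Sh0 = sh_nc0 K lam X" "Sh = sh_nc K lam X" by fact+
  let ?incl = "\<lambda>z\<in>carrier Sh0. z"
  interpret S0: rb_algebra K Sh0 lam
    unfolding Sh by (intro rb_algebra.intro Sh0_nonunitary)
  have incl: "?incl \<in> rb_hom K Sh0 Sh"
    unfolding Sh using Sh0_subset
    by (intro rb_algebra.restrict_rb_homI[OF S0.rb_algebra_axioms[unfolded Sh]]) (auto simp: Sh0_ops)
  have u_X_eq: "u = ?incl" if "u \<in> rb_hom K Sh0 Sh" "\<forall>x\<in>X. u (sh_gen K x) = sh_gen K x" for u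
    using that incl unfolding Sh by (intro Sh0_hom_eqI[OF Sh_nonunitary]) (auto simp: generator_in(1))
  have u_X: "\<exists>!u_X. u_X \<in> rb_hom K Sh0 Sh \<and> (\<forall>x\<in>X. u_X (sh_gen K x) = sh_gen K x)"
  proof (rule ex1I)
    show "?incl \<in> rb_hom K Sh0 Sh \<and> (\<forall>x\<in>X. ?incl (sh_gen K x) = sh_gen K x)"
      using incl generator_in(1) by (simp add: Sh)
  qed (use u_X_eq in blast)
  have "\<exists>gbar\<in>rb_hom K Sh0 A. \<forall>x\<in>X. gbar (sh_gen K x) = x"
    unfolding Sh using Sh0_hom_exists[OF assms(3), of "\<lambda>x. x"] assms(4) by blast
  then have gbar: "\<exists>!gbar. gbar \<in> rb_hom K Sh0 A \<and> (\<forall>x\<in>X. gbar (sh_gen K x) = x)"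
    using Sh0_hom_eqI[OF assms(3)] unfolding Sh by (metis (no_types, lifting))
  show ?thesis
  proof (intro conjI u_X gbar allI impI; elim conjE)
    fix u_X gbar
    assume u: "u_X \<in> rb_hom K Sh0 Sh" "\<forall>x\<in>X. u_X (sh_gen K x) = sh_gen K x"
      and g: "gbar \<in> rb_hom K Sh0 A" "\<forall>x\<in>X. gbar (sh_gen K x) = x"
    interpret P: presented K lam X A gbar
      using assms(3-5) g unfolding Sh
      by (intro presented.intro presented_axioms.intro decorated_axioms rb_algebra.intro) auto
    show "gbar ` carrier Sh0 = carrier A" unfolding Sh by (rule P.gbar_surj)
    have u_id: "u_X z = z" if "z \<in> carrier Sh0" for z
      using that u_X_eq[OF u] by simp
    have "u_X ` a_kernel Sh0 A gbar = a_kernel Sh0 A gbar"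
      using u_id by (force simp: a_kernel_def')
    then have J': "rb_ideal_generated K Sh (u_X ` a_kernel Sh0 A gbar) = P.J'"
      by (simp add: P.J'_def P.J_def Sh)
    show "let J = a_kernel Sh0 A gbar;
             J' = rb_ideal_generated K Sh (u_X ` J);
             A' = rb_quot Sh J';
             q = rb_proj Sh J'
         in (\<exists>!u_A. u_A \<in> rb_hom K A A' \<and> (\<forall>z\<in>carrier Sh0. u_A (gbar z) = q (u_X z))) \<and>
            (\<forall>u_A. u_A \<in> rb_hom K A A' \<and> (\<forall>z\<in>carrier Sh0. u_A (gbar z) = q (u_X z)) \<longrightarrow>
               unitarization TYPE('b) K lam A A' u_A)"
      unfolding Let_def J'
    proof (intro conjI allI impI)
      show "\<exists>!u_A. u_A \<in> rb_hom K A (rb_quot Sh P.J') \<and>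
          (\<forall>z\<in>carrier Sh0. u_A (gbar z) = rb_proj Sh P.J' (u_X z))"
        using P.u_A_unique u_id by (simp add: Sh)
      fix u_A
      assume "u_A \<in> rb_hom K A (rb_quot Sh P.J') \<and>
          (\<forall>z\<in>carrier Sh0. u_A (gbar z) = rb_proj Sh P.J' (u_X z))"
      then show "unitarization TYPE('b) K lam A (rb_quot Sh P.J') u_A"
        unfolding Sh using u_id by (intro P.unitarization) (simp_all add: Sh)
    qed
  qed
qed

end
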